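(* Let $w\in S_n$ be a vexillary permutation. Then the W-characteristic set $\mathcal{C}$ of the Schubert determinantal ideal $I_w$ with respect to the NEW term order is normal.
   Context: Let $K$ be a field, $X=(x_{ij})$ a generic $n\times n$ matrix of distinct variables and $K[\boldsymbol{x}]$ the polynomial ring in its entries. For a matrix $M$, $M_{pq}$ is its northwest $p\times q$ submatrix. For $w=w_1\cdots w_n\in S_n$ (one-line notation), $w^T$ is the $n\times n$ permutation matrix whose $i$th row has $1$ in column $w_i$ and $0$ elsewhere. The Schubert determinantal ideal $I_w\subseteq K[\boldsymbol{x}]$ is generated by all minors of $X_{pq}$ of size $\mathrm{rank}(w^T_{pq})+1$ for all $p,q\in\{1,\dots,n\}$. $w$ is vexillary if there are no $i<j<k<\ell$ with $w_j<w_i<w_\ell<w_k$. The NEW term order is the lexicographic term order induced by the variable order in which $x_{1n}$ is the greatest variable and the next greatest variables are found by scanning each row from east to west, row by row from top to bottom: $x_{1n}>x_{1,n-1}>\cdots>x_{11}>x_{2n}>\cdots>x_{21}>\cdots>x_{nn}>\cdots>x_{n1}$ (monomials are compared first by the exponent of the greatest variable). For a fixed variable order and a non-constant polynomial $F$, $\mathrm{lv}(F)$ is the greatest variable appearing in $F$, and $\mathrm{ini}(F)$ is the leading coefficient of $F$ viewed as a univariate polynomial in $\mathrm{lv}(F)$. A triangular set is an ordered set $[T_1,\dots,T_r]$ of polynomials with $\mathrm{lv}(T_1)<\cdots<\mathrm{lv}(T_r)$; it is normal if for each $i$, $\mathrm{ini}(T_i)$ involves none of $\mathrm{lv}(T_1),\dots,\mathrm{lv}(T_r)$.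 A Gröbner basis $\mathcal{G}$ is reduced if for each $G\in\mathcal{G}$ no term of $G$ is divisible by the leading term of an element of $\mathcal{G}\setminus\{G\}$, and the leading coefficient of $G$ is $\pm1$. The W-characteristic set of an ideal is the triangular set obtained from its reduced Gröbner basis $\mathcal{G}$ with respect to the lexicographic order induced by the variable order by choosing, for each variable $y$ for which $\{G\in\mathcal{G}:\mathrm{lv}(G)=y\}$ is non-empty, the element of this set that is minimal with respect to the lexicographic order (i.e. with the smallest leading term). *)

theory Defs
  imports
    "HOL-Library.Poly_Mapping"
    "HOL-Combinatorics.Permutations"
    "HOL-Algebra.Ideal"
    "Jordan_Normal_Form.Determinant"
    "Jordan_Normal_Form.DL_Rank"
    "Jordan_Normal_Form.DL_Submatrix"
begin

section \<open>Multivariate polynomials\<close>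

text \<open>
  Power products are finitely supported exponent functions, written additively; polynomials are
  finitely supported coefficient functions on power products, with the convolution product of
  \<^theory>\<open>HOL-Library.Poly_Mapping\<close>.
\<close>

type_synonym 'v pprod = "'v \<Rightarrow>\<^sub>0 nat"
type_synonym ('v, 'k) mpoly = "('v \<Rightarrow>\<^sub>0 nat) \<Rightarrow>\<^sub>0 'k"

definition mvar :: "'v \<Rightarrow> ('v, 'k::field) mpoly" where
  "mvar v = Poly_Mapping.single (Poly_Mapping.single v 1) 1"

definition mvars :: "('v, 'k::field) mpoly \<Rightarrow> 'v set" where
  "mvars f = (\<Union>m\<in>Poly_Mapping.keys f. Poly_Mapping.keys m)"

text \<open>The polynomial ring in the variables \<open>V\<close>, a subring of the ring of all polynomials.\<close>

definition mpoly_ring :: "'v set \<Rightarrow> ('v, 'k::field) mpoly ring" where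
  "mpoly_ring V = \<lparr>carrier = {f. mvars f \<subseteq> V}, monoid.mult = (*), one = 1, zero = 0, add = (+)\<rparr>"


section \<open>Lexicographic order and leading terms\<close>

text \<open>Below, \<open>vless\<close> is a strict total order on the variables; \<open>vless u v\<close> means \<open>u < v\<close>.\<close>

definition lex_less :: "('v \<Rightarrow> 'v \<Rightarrow> bool) \<Rightarrow> 'v pprod \<Rightarrow> 'v pprod \<Rightarrow> bool" where
  "lex_less vless s t \<longleftrightarrow>
     (\<exists>v. Poly_Mapping.lookup s v < Poly_Mapping.lookup t v \<and>
          (\<forall>u. vless v u \<longrightarrow> Poly_Mapping.lookup s u = Poly_Mapping.lookup t u))"

text \<open>Leading power product, coefficient and term; meaningful for nonzero polynomials only.\<close>

definition lpp :: "('v \<Rightarrow> 'v \<Rightarrow> bool) \<Rightarrow> ('v, 'k::field) mpoly \<Rightarrow> 'v pprod" where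
  "lpp vless f = (THE m. m \<in> Poly_Mapping.keys f \<and>
     (\<forall>m'\<in>Poly_Mapping.keys f. m' \<noteq> m \<longrightarrow> lex_less vless m' m))"

definition lcoef :: "('v \<Rightarrow> 'v \<Rightarrow> bool) \<Rightarrow> ('v, 'k::field) mpoly \<Rightarrow> 'k" where
  "lcoef vless f = Poly_Mapping.lookup f (lpp vless f)"

definition lterm :: "('v \<Rightarrow> 'v \<Rightarrow> bool) \<Rightarrow> ('v, 'k::field) mpoly \<Rightarrow> ('v, 'k) mpoly" where
  "lterm vless f = Poly_Mapping.single (lpp vless f) (lcoef vless f)"

definition mterms :: "('v, 'k::field) mpoly \<Rightarrow> ('v, 'k) mpoly set" where
  "mterms f = (\<lambda>m. Poly_Mapping.single m (Poly_Mapping.lookup f m)) ` Poly_Mapping.keys f"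


section \<open>Reduced Groebner bases\<close>

definition groebner_basis ::
  "('v \<Rightarrow> 'v \<Rightarrow> bool) \<Rightarrow> 'v set \<Rightarrow> ('v, 'k::field) mpoly set \<Rightarrow> ('v, 'k) mpoly set \<Rightarrow> bool" where
  "groebner_basis vless V I G \<longleftrightarrow>
     finite G \<and> G \<subseteq> I - {0} \<and>
     genideal (mpoly_ring V) (lterm vless ` G) = genideal (mpoly_ring V) (lterm vless ` (I - {0}))"

text \<open>Leading coefficients are normalised up to sign only, so a reduced basis is unique up to the
  signs of its elements.\<close>

definition reduced_groebner_basis ::
  "('v \<Rightarrow> 'v \<Rightarrow> bool) \<Rightarrow> 'v set \<Rightarrow> ('v, 'k::field) mpoly set \<Rightarrow> ('v, 'k) mpoly set \<Rightarrow> bool" where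
  "reduced_groebner_basis vless V I G \<longleftrightarrow>
     groebner_basis vless V I G \<and>
     (\<forall>g\<in>G. (\<forall>t\<in>mterms g. \<forall>h\<in>G - {g}. \<not> lterm vless h dvd t) \<and>
             (lcoef vless g = 1 \<or> lcoef vless g = - 1))"


section \<open>Triangular sets and W-characteristic sets\<close>

definition mconstant :: "('v, 'k::field) mpoly \<Rightarrow> bool" where
  "mconstant f \<longleftrightarrow> mvars f = {}"

definition lv :: "('v \<Rightarrow> 'v \<Rightarrow> bool) \<Rightarrow> ('v, 'k::field) mpoly \<Rightarrow> 'v" where
  "lv vless f = (THE v. v \<in> mvars f \<and> (\<forall>u\<in>mvars f. u \<noteq> v \<longrightarrow> vless u v))"

definition degree_in :: "'v \<Rightarrow> ('v, 'k::field) mpoly \<Rightarrow> nat" where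
  "degree_in y f = Max ((\<lambda>m. Poly_Mapping.lookup m y) ` Poly_Mapping.keys f)"

text \<open>The coefficient of \<open>y\<^sup>d\<close> in \<open>f\<close>, viewed as a univariate polynomial in \<open>y\<close>.\<close>

definition coeff_in :: "'v \<Rightarrow> nat \<Rightarrow> ('v, 'k::field) mpoly \<Rightarrow> ('v, 'k) mpoly" where
  "coeff_in y d f =
     (\<Sum>m | m \<in> Poly_Mapping.keys f \<and> Poly_Mapping.lookup m y = d.
        Poly_Mapping.single (m - Poly_Mapping.single y d) (Poly_Mapping.lookup f m))"

definition ini :: "('v \<Rightarrow> 'v \<Rightarrow> bool) \<Rightarrow> ('v, 'k::field) mpoly \<Rightarrow> ('v, 'k) mpoly" where
  "ini vless f = (let y = lv vless f in coeff_in y (degree_in y f) f)"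

definition triangular_set :: "('v \<Rightarrow> 'v \<Rightarrow> bool) \<Rightarrow> ('v, 'k::field) mpoly list \<Rightarrow> bool" where
  "triangular_set vless Ts \<longleftrightarrow>
     (\<forall>T\<in>set Ts. \<not> mconstant T) \<and> sorted_wrt (\<lambda>S T. vless (lv vless S) (lv vless T)) Ts"

definition normal_triangular_set :: "('v \<Rightarrow> 'v \<Rightarrow> bool) \<Rightarrow> ('v, 'k::field) mpoly list \<Rightarrow> bool" where
  "normal_triangular_set vless Ts \<longleftrightarrow>
     triangular_set vless Ts \<and>
     (\<forall>T\<in>set Ts. mvars (ini vless T) \<inter> lv vless ` set Ts = {})"

definition with_lv ::
  "('v \<Rightarrow> 'v \<Rightarrow> bool) \<Rightarrow> ('v, 'k::field) mpoly set \<Rightarrow> 'v \<Rightarrow> ('v, 'k) mpoly set" where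
  "with_lv vless G y = {g \<in> G. \<not> mconstant g \<and> lv vless g = y}"

text \<open>A relation, because the reduced Groebner basis is fixed only up to signs. Distinct elements
  of a reduced basis have distinct leading power products, so the minimum is unique.\<close>

definition W_characteristic_set ::
  "('v \<Rightarrow> 'v \<Rightarrow> bool) \<Rightarrow> 'v set \<Rightarrow> ('v, 'k::field) mpoly set \<Rightarrow> ('v, 'k) mpoly list \<Rightarrow> bool" where
  "W_characteristic_set vless V I Cs \<longleftrightarrow>
     (\<exists>G. reduced_groebner_basis vless V I G \<and>
          triangular_set vless Cs \<and>
          set Cs = {g. \<exists>y. g \<in> with_lv vless G y \<and>
                       (\<forall>h\<in>with_lv vless G y. h \<noteq> g \<longrightarrow>
                          lex_less vless (lpp vless g) (lpp vless h))})"


section \<open>Schubert determinantal ideals\<close>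

text \<open>
  The variable \<open>x\<^sub>i\<^sub>j\<close> is indexed by the pair \<open>(i, j)\<close> with \<open>i, j \<in> {1..n}\<close>, and permutations act on
  \<open>{1..n}\<close>. Entries of the type \<open>mat\<close> are numbered from 0.
\<close>

definition Xvars :: "nat \<Rightarrow> (nat \<times> nat) set" where
  "Xvars n = {1..n} \<times> {1..n}"

definition generic_matrix :: "nat \<Rightarrow> (nat \<times> nat, 'k::field) mpoly mat" where
  "generic_matrix n = mat n n (\<lambda>(i, j). mvar (i + 1, j + 1))"

definition perm_matrix :: "nat \<Rightarrow> (nat \<Rightarrow> nat) \<Rightarrow> rat mat" where
  "perm_matrix n w = mat n n (\<lambda>(i, j). if w (i + 1) = j + 1 then 1 else 0)"

definition northwest :: "'a mat \<Rightarrow> nat \<Rightarrow> nat \<Rightarrow> 'a mat" where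
  "northwest M p q = submatrix M {..<p} {..<q}"

definition minors :: "'a::comm_ring_1 mat \<Rightarrow> nat \<Rightarrow> 'a set" where
  "minors M r = {det (submatrix M I J) | I J.
     I \<subseteq> {..<dim_row M} \<and> J \<subseteq> {..<dim_col M} \<and> card I = r \<and> card J = r}"

text \<open>The first argument of \<^const>\<open>vec_space.rank\<close> is the number of rows of the matrix.\<close>

definition nw_rank :: "nat \<Rightarrow> (nat \<Rightarrow> nat) \<Rightarrow> nat \<Rightarrow> nat \<Rightarrow> nat" where
  "nw_rank n w p q = vec_space.rank p (northwest (perm_matrix n w) p q)"

definition schubert_ideal ::
  "nat \<Rightarrow> (nat \<Rightarrow> nat) \<Rightarrow> (nat \<times> nat, 'k::field) mpoly set" where
  "schubert_ideal n w = genideal (mpoly_ring (Xvars n))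
     (\<Union>p\<in>{1..n}. \<Union>q\<in>{1..n}. minors (northwest (generic_matrix n) p q) (nw_rank n w p q + 1))"

definition vexillary :: "nat \<Rightarrow> (nat \<Rightarrow> nat) \<Rightarrow> bool" where
  "vexillary n w \<longleftrightarrow>
     \<not> (\<exists>i j k l. 1 \<le> i \<and> i < j \<and> j < k \<and> k < l \<and> l \<le> n \<and>
          w j < w i \<and> w i < w l \<and> w l < w k)"

definition new_less :: "nat \<times> nat \<Rightarrow> nat \<times> nat \<Rightarrow> bool" where
  "new_less u v \<longleftrightarrow> fst v < fst u \<or> (fst u = fst v \<and> snd u < snd v)"

end

theory Submission
  imports Defs
begin

text \<open>
  The order is antidiagonal: the leading power product of a minor is its antidiagonal. The minors
  form a Groebner basis (Knutson and Miller). This is shown by comparing, variable by variable from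
  the greatest to the least, a polynomial in the ideal with its values at points satisfying the rank
  conditions over an infinite extension field: if the greatest variable \<open>y\<close> occurs, the leading
  coefficient with respect to \<open>y\<close> vanishes wherever the blocks southwest of \<open>y\<close> have smaller rank,
  since such points are limits of points with \<open>y \<rightarrow> \<infinity>\<close>. So the leading power products of a reduced
  basis are the minimal antidiagonals violating a rank condition, and an element of the
  W-characteristic set corresponds to the lexicographically least one \<open>S\<close> with a given top. If \<open>w\<close> is
  vexillary, then the dots of \<open>w\<close> in the northwest block bounding \<open>S\<close> are increasing. This implies
  that the initial involves only variables of the grid spanned by \<open>S\<close> without its top, and that none
  of these is the top of a minimal violating antidiagonal.
\<close>

section \<open>Polynomials and evaluation\<close>

text \<open>The induction propagates only vanishing on rank varieties, never membership in an ideal;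
  over a finite field vanishing says too little, hence the larger field. Elimination along a row
  leaves a staircase of variables. A northwest block meets it in two overlapping rectangles, so each
  condition in \<open>C\<close> is imposed on both. Conditions created by passing to a leading
  coefficient concern only rows strictly south of \<open>y\<close>; they wait in \<open>N\<close>
  and join \<open>C\<close> when the row is finished. If \<open>y\<close> does not occur in the
  leading monomial, points still have to be lifted: either all blocks southwest of \<open>y\<close>
  have dropped rank and the limit argument applies, or one has full rank and linear algebra supplies
  a value for \<open>y\<close>. On the combinatorial side, increasing dots make the count in a
  smaller block depend on its rows alone or on its columns alone (\<open>dot_count_cases\<close>),
  which reduces badness to counting rows and columns. Elements of a reduced basis need not be
  minors, so the initial is controlled by showing that their terms containing \<open>y\<close> are
  supported on transversals of \<open>S\<close>.\<close>

abbreviation lookup :: "('a \<Rightarrow>\<^sub>0 'b::zero) \<Rightarrow> 'a \<Rightarrow> 'b" where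
  "lookup \<equiv> Poly_Mapping.lookup"

abbreviation keys :: "('a \<Rightarrow>\<^sub>0 'b::zero) \<Rightarrow> 'a set" where
  "keys \<equiv> Poly_Mapping.keys"

abbreviation single :: "'a \<Rightarrow> 'b \<Rightarrow> ('a \<Rightarrow>\<^sub>0 'b::zero)" where
  "single \<equiv> Poly_Mapping.single"

definition pprod_eval :: "('v \<Rightarrow> 'f::comm_semiring_1) \<Rightarrow> 'v pprod \<Rightarrow> 'f" where
  "pprod_eval z m = (\<Prod>v\<in>keys m. z v ^ lookup m v)"

text \<open>Coefficients are mapped by \<open>h\<close>, so that points may be taken over a larger
  field than the coefficients.\<close>

definition mpoly_eval ::
  "('k::field \<Rightarrow> 'f::comm_ring_1) \<Rightarrow> ('v \<Rightarrow> 'f) \<Rightarrow> ('v, 'k) mpoly \<Rightarrow> 'f" where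
  "mpoly_eval h z f = (\<Sum>m\<in>keys f. h (lookup f m) * pprod_eval z m)"

lemma pprod_eval_superset:
  assumes "finite A" "keys m \<subseteq> A"
  shows "pprod_eval z m = (\<Prod>v\<in>A. z v ^ lookup m v)"
  unfolding pprod_eval_def
  by (rule prod.mono_neutral_left) (use assms in \<open>auto simp: in_keys_iff\<close>)

lemma pprod_eval_0 [simp]: "pprod_eval z 0 = 1"
  by (simp add: pprod_eval_def)

lemma pprod_eval_add: "pprod_eval z (m + m') = pprod_eval z m * pprod_eval z m'"
proof -
  let ?A = "keys m \<union> keys m'"
  have "keys (m + m') \<subseteq> ?A" by (rule keys_add)
  then show ?thesis
    by (subst (1 2 3) pprod_eval_superset[where A = ?A])
      (auto simp: lookup_add power_add prod.distrib)
qed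

lemma pprod_eval_single [simp]: "pprod_eval z (single v e) = z v ^ e"
  by (cases "e = 0") (simp_all add: pprod_eval_def)

lemma pprod_eval_cong:
  "(\<And>v. v \<in> keys m \<Longrightarrow> z v = z' v) \<Longrightarrow> pprod_eval z m = pprod_eval z' m"
  by (simp add: pprod_eval_def)

lemma mpoly_eval_superset:
  assumes "comm_ring_hom h" "finite A" "keys f \<subseteq> A"
  shows "mpoly_eval h z f = (\<Sum>m\<in>A. h (lookup f m) * pprod_eval z m)"
proof -
  interpret comm_ring_hom h by fact
  show ?thesis unfolding mpoly_eval_def
    by (rule sum.mono_neutral_left) (use assms in \<open>auto simp: in_keys_iff\<close>)
qed

lemma mpoly_eval_0 [simp]: "mpoly_eval h z 0 = 0"
  by (simp add: mpoly_eval_def)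

lemma mpoly_eval_add:
  assumes "comm_ring_hom h"
  shows "mpoly_eval h z (f + g) = mpoly_eval h z f + mpoly_eval h z g"
proof -
  interpret comm_ring_hom h by fact
  let ?A = "keys f \<union> keys g"
  have "keys (f + g) \<subseteq> ?A" by (rule keys_add)
  then show ?thesis
    by (subst (1 2 3) mpoly_eval_superset[where A = ?A])
      (auto simp: lookup_add hom_add distrib_right sum.distrib assms)
qed

lemma mpoly_eval_uminus:
  assumes "comm_ring_hom h"
  shows "mpoly_eval h z (- f) = - mpoly_eval h z f"
proof -
  interpret comm_ring_hom h by fact
  have "mpoly_eval h z (- f) + mpoly_eval h z f = 0"
    using mpoly_eval_add[OF assms, of z "- f" f] by simp
  then show ?thesis by (simp add: eq_neg_iff_add_eq_0)
qed

lemma mpoly_eval_single: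
  assumes "comm_ring_hom h"
  shows "mpoly_eval h z (single m c) = h c * pprod_eval z m"
proof -
  interpret comm_ring_hom h by fact
  show ?thesis by (simp add: mpoly_eval_def)
qed

lemma mpoly_eval_sum:
  assumes "comm_ring_hom h"
  shows "mpoly_eval h z (\<Sum>x\<in>A. F x) = (\<Sum>x\<in>A. mpoly_eval h z (F x))"
  by (induction A rule: infinite_finite_induct) (simp_all add: mpoly_eval_add[OF assms])

lemma poly_mapping_sum_single: "(\<Sum>m\<in>keys f. single m (lookup f m)) = f"
proof (rule poly_mapping_eqI)
  fix k
  show "lookup (\<Sum>m\<in>keys f. single m (lookup f m)) k = lookup f k"
    by (simp add: lookup_sum lookup_single when_def in_keys_iff sum.delta)
qed

lemma mpoly_mult_sum_single:
  "f * g = (\<Sum>m\<in>keys f. \<Sum>m'\<in>keys g. single (m + m') (lookup f m * lookup g m'))"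
  for f g :: "('v, 'k::field) mpoly"
proof -
  have "f * g = (\<Sum>m\<in>keys f. single m (lookup f m)) * (\<Sum>m\<in>keys g. single m (lookup g m))"
    by (simp add: poly_mapping_sum_single)
  also have "\<dots> = (\<Sum>m\<in>keys f. \<Sum>m'\<in>keys g. single (m + m') (lookup f m * lookup g m'))"
    by (simp only: sum_product mult_single)
  finally show ?thesis .
qed

lemma mpoly_eval_mult:
  assumes "comm_ring_hom h"
  shows "mpoly_eval h z (f * g) = mpoly_eval h z f * mpoly_eval h z g"
proof -
  interpret comm_ring_hom h by fact
  have "mpoly_eval h z (f * g) = (\<Sum>m\<in>keys f. \<Sum>m'\<in>keys g.
      (h (lookup f m) * pprod_eval z m) * (h (lookup g m') * pprod_eval z m'))"
    by (subst mpoly_mult_sum_single)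
      (simp add: mpoly_eval_sum[OF assms] mpoly_eval_single[OF assms] pprod_eval_add hom_mult ac_simps)
  then show ?thesis by (simp add: mpoly_eval_def sum_product)
qed

lemma mpoly_eval_mvar:
  assumes "comm_ring_hom h"
  shows "mpoly_eval h z (mvar v) = z v"
proof -
  interpret comm_ring_hom h by fact
  show ?thesis by (simp add: mvar_def mpoly_eval_single[OF assms])
qed

lemma comm_ring_hom_mpoly_eval:
  assumes "comm_ring_hom h"
  shows "comm_ring_hom (mpoly_eval h z)"
proof -
  interpret comm_ring_hom h by fact
  have "mpoly_eval h z 1 = 1"
    using mpoly_eval_single[OF assms, of z 0 1] by simp
  then show ?thesis
    by unfold_locales (simp_all add: mpoly_eval_add mpoly_eval_mult assms)
qed

lemma mvars_0 [simp]: "mvars 0 = {}"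
  and mvars_1 [simp]: "mvars 1 = {}"
  and mvars_mvar [simp]: "mvars (mvar v :: ('v, 'k::field) mpoly) = {v}"
  and mvars_uminus [simp]: "mvars (- f) = mvars f"
  by (simp_all add: mvars_def mvar_def)

lemma mvars_add: "mvars (f + g) \<subseteq> mvars f \<union> mvars g"
  unfolding mvars_def using keys_add[of f g] by blast

lemma mvars_single: "mvars (single m c) \<subseteq> keys m"
  by (cases "c = 0") (simp_all add: mvars_def)

lemma mvars_sum: "mvars (\<Sum>x\<in>A. F x) \<subseteq> (\<Union>x\<in>A. mvars (F x))"
proof (induction A rule: infinite_finite_induct)
  case (insert x A)
  then show ?case using mvars_add[of "F x" "\<Sum>x\<in>A. F x"] by auto
qed simp_all

lemma mvars_mult: "mvars (f * g) \<subseteq> mvars f \<union> mvars g"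
proof -
  have "mvars (f * g) \<subseteq> (\<Union>m\<in>keys f. \<Union>m'\<in>keys g. keys (m + m'))"
    by (subst mpoly_mult_sum_single)
      (intro order_trans[OF mvars_sum] UN_mono order_refl mvars_single)
  also have "\<dots> \<subseteq> mvars f \<union> mvars g"
  proof -
    have "keys (m + m') \<subseteq> keys m \<union> keys m'" for m m' :: "'a \<Rightarrow>\<^sub>0 nat"
      by (rule keys_add)
    then show ?thesis unfolding mvars_def by blast
  qed
  finally show ?thesis .
qed

lemma mvars_prod: "mvars (\<Prod>x\<in>A. F x) \<subseteq> (\<Union>x\<in>A. mvars (F x))"
proof (induction A rule: infinite_finite_induct)
  case (insert x A)
  then show ?case using mvars_mult[of "F x" "\<Prod>x\<in>A. F x"] by auto
qed simp_all

lemma cring_mpoly_ring: "cring (mpoly_ring V)"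
proof (rule cringI)
  show "abelian_group (mpoly_ring V)"
  proof (rule abelian_groupI)
    fix x assume "x \<in> carrier (mpoly_ring V)"
    then show "\<exists>y\<in>carrier (mpoly_ring V). y \<oplus>\<^bsub>mpoly_ring V\<^esub> x = \<zero>\<^bsub>mpoly_ring V\<^esub>"
      by (intro bexI[of _ "- x"]) (simp_all add: mpoly_ring_def)
  qed (use mvars_add in \<open>fastforce simp: mpoly_ring_def add_ac\<close>)+
  show "Group.comm_monoid (mpoly_ring V)"
    by (rule Group.comm_monoidI) (use mvars_mult in \<open>fastforce simp: mpoly_ring_def mult_ac\<close>)+
qed (simp add: mpoly_ring_def distrib_right)

section \<open>Rank conditions by factorisation\<close>

text \<open>Rank at most \<open>r\<close> is encoded as a factorisation through \<open>r\<close>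
  inner indices: restriction, row operations and bordering become explicit changes of
  \<open>U\<close> and \<open>V\<close>, with no minors or dimensions involved.\<close>

definition rank_le :: "nat set \<Rightarrow> nat set \<Rightarrow> nat \<Rightarrow> (nat \<times> nat \<Rightarrow> 'f::field) \<Rightarrow> bool" where
  "rank_le A B r z \<longleftrightarrow> (\<exists>U V. \<forall>i\<in>A. \<forall>j\<in>B. z (i, j) = (\<Sum>k<r. U i k * V k j))"

lemma rank_leE:
  assumes "rank_le A B r z"
  obtains U V where "\<And>i j. i \<in> A \<Longrightarrow> j \<in> B \<Longrightarrow> z (i, j) = (\<Sum>k<r. U i k * V k j)"
  using assms unfolding rank_le_def by blast

lemma rank_leI:
  assumes "\<And>i j. i \<in> A \<Longrightarrow> j \<in> B \<Longrightarrow> z (i, j) = (\<Sum>k<r. U i k * V k j)"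
  shows "rank_le A B r z"
  using assms unfolding rank_le_def by blast

lemma rank_leI_finite:
  assumes "finite K" "card K = r"
    and "\<And>i j. i \<in> A \<Longrightarrow> j \<in> B \<Longrightarrow> z (i, j) = (\<Sum>k\<in>K. U i k * V k j)"
  shows "rank_le A B r z"
proof -
  obtain f where f: "bij_betw f {..<r} K"
    using ex_bij_betw_nat_finite[OF assms(1)] assms(2) by (auto simp: atLeast0LessThan)
  show ?thesis
    by (rule rank_leI[where U = "\<lambda>i k. U i (f k)" and V = "\<lambda>k j. V (f k) j"])
      (simp add: assms(3) sum.reindex_bij_betw[OF f, symmetric])
qed

lemma rank_le_mono: "rank_le A B r z \<Longrightarrow> A' \<subseteq> A \<Longrightarrow> B' \<subseteq> B \<Longrightarrow> rank_le A' B' r z"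
  unfolding rank_le_def by blast

lemma rank_le_cong:
  assumes "\<And>i j. i \<in> A \<Longrightarrow> j \<in> B \<Longrightarrow> z (i, j) = z' (i, j)"
  shows "rank_le A B r z \<longleftrightarrow> rank_le A B r z'"
  unfolding rank_le_def using assms by simp

lemma rank_le_empty [simp]: "rank_le {} B r z" "rank_le A {} r z"
  unfolding rank_le_def by simp_all

lemma rank_le_zero: "rank_le A B r (\<lambda>_. 0)"
  by (rule rank_leI[where U = "\<lambda>_ _. 0" and V = "\<lambda>_ _. 0"]) simp

lemma rank_le_transpose: "rank_le A B r z \<Longrightarrow> rank_le B A r (\<lambda>(i, j). z (j, i))"
  by (erule rank_leE, rule_tac U = "\<lambda>i k. V k i" and V = "\<lambda>k j. U j k" in rank_leI)
    (simp add: mult.commute)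

lemma rank_le_row_op:
  assumes "rank_le A B r z" "a \<in> A"
    and "\<And>i j. i \<in> A \<Longrightarrow> j \<in> B \<Longrightarrow> z' (i, j) = z (i, j) + t i * z (a, j)"
  shows "rank_le A B r z'"
proof -
  obtain U V where UV: "\<And>i j. i \<in> A \<Longrightarrow> j \<in> B \<Longrightarrow> z (i, j) = (\<Sum>k<r. U i k * V k j)"
    using assms(1) by (rule rank_leE) blast
  show ?thesis
    by (rule rank_leI[where U = "\<lambda>i k. U i k + t i * U a k" and V = V])
      (simp add: assms(2,3) UV distrib_right sum.distrib sum_distrib_left mult.assoc)
qed

lemma rank_le_col_op:
  assumes "rank_le A B r z" "b \<in> B"
    and "\<And>i j. i \<in> A \<Longrightarrow> j \<in> B \<Longrightarrow> z' (i, j) = z (i, j) + t j * z (i, b)"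
  shows "rank_le A B r z'"
  using rank_le_transpose[OF rank_le_row_op[OF rank_le_transpose[OF assms(1)] assms(2),
        of "\<lambda>(i, j). z' (j, i)" t]] assms(3)
  by simp

lemma rank_le_insert_row:
  assumes "rank_le A B r z"
    and "\<And>j. j \<in> B \<Longrightarrow> z (a, j) = (\<Sum>i\<in>A. l i * z (i, j))"
  shows "rank_le (insert a A) B r z"
proof -
  obtain U V where UV: "\<And>i j. i \<in> A \<Longrightarrow> j \<in> B \<Longrightarrow> z (i, j) = (\<Sum>k<r. U i k * V k j)"
    using assms(1) by (rule rank_leE) blast
  have "z (a, j) = (\<Sum>k<r. (\<Sum>x\<in>A. l x * U x k) * V k j)" if "j \<in> B" for j
  proof -
    have "z (a, j) = (\<Sum>x\<in>A. \<Sum>k<r. l x * U x k * V k j)"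
      by (simp add: assms(2) that UV sum_distrib_left mult.assoc)
    then show ?thesis by (subst (asm) sum.swap) (simp add: sum_distrib_right)
  qed
  note a = this
  show ?thesis
  proof (rule rank_leI[where U = "\<lambda>i k. if i = a then \<Sum>x\<in>A. l x * U x k else U i k" and V = V])
    fix i j assume "i \<in> insert a A" "j \<in> B"
    then show "z (i, j) = (\<Sum>k<r. (if i = a then \<Sum>x\<in>A. l x * U x k else U i k) * V k j)"
      using a UV by (cases "i = a") auto
  qed
qed

lemma rank_le_insert_col:
  assumes "rank_le A B r z"
    and "\<And>i. i \<in> A \<Longrightarrow> z (i, b) = (\<Sum>j\<in>B. z (i, j) * l j)"
  shows "rank_le A (insert b B) r z"
  using rank_le_transpose[OF rank_le_insert_row[OF rank_le_transpose[OF assms(1)], of b l]] assms(2)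
  by (simp add: mult.commute)

text \<open>Schur complement: the bordered matrix with pivot \<open>1/s\<close> in the corner \<open>(a, b)\<close> has rank one
  more than the block \<open>z\<close>.\<close>

lemma rank_le_border:
  assumes "rank_le A B r z" "a \<notin> A" "b \<notin> B" "s \<noteq> 0"
    and "\<And>i j. i \<in> A \<Longrightarrow> j \<in> B \<Longrightarrow> z' (i, j) = z (i, j) + s * z (i, b) * z (a, j)"
    and "\<And>i. i \<in> A \<Longrightarrow> z' (i, b) = z (i, b)"
    and "\<And>j. j \<in> B \<Longrightarrow> z' (a, j) = z (a, j)"
    and "z' (a, b) = 1 / s"
  shows "rank_le (insert a A) (insert b B) (Suc r) z'"
proof -
  obtain U V where UV: "\<And>i j. i \<in> A \<Longrightarrow> j \<in> B \<Longrightarrow> z (i, j) = (\<Sum>k<r. U i k * V k j)"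
    using assms(1) by (rule rank_leE) blast
  \<comment> \<open>The new inner index \<open>r\<close> carries the rank-one correction of the
    block; row \<open>a\<close> and column \<open>b\<close> are expressed through it alone.\<close>
  let ?U = "\<lambda>i k. if i = a then (if k = r then 1 else 0) else if k = r then s * z (i, b) else U i k"
  let ?V = "\<lambda>k j. if j = b then (if k = r then 1 / s else 0) else if k = r then z (a, j) else V k j"
  show ?thesis
    by (rule rank_leI[where U = ?U and V = ?V])
      (use assms(2-) in \<open>auto simp: UV intro!: sum.cong\<close>)
qed

section \<open>Linear dependence and blocks of exact rank\<close>

text \<open>The rows of \<open>V\<close> are added one at a time. If the new row is not a
  combination of the old ones, its residual has a nonzero entry, from which the missing column of
  the right inverse is built.\<close>

lemma right_inverse_or_dependent:
  fixes V :: "nat \<Rightarrow> nat \<Rightarrow> 'f::field"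
  assumes "finite B"
  shows "(\<exists>S. \<forall>k<r. \<forall>l<r. (\<Sum>j\<in>B. V k j * S j l) = (if k = l then 1 else 0)) \<or>
    (\<exists>c. (\<exists>k<r. c k \<noteq> 0) \<and> (\<forall>j\<in>B. (\<Sum>k<r. c k * V k j) = 0))"
proof (induction r)
  case (Suc r)
  show ?case
  proof (cases "\<exists>c. (\<exists>k<r. c k \<noteq> 0) \<and> (\<forall>j\<in>B. (\<Sum>k<r. c k * V k j) = 0)")
    case True
    then obtain c k where c: "k < r" "c k \<noteq> 0" "\<And>j. j \<in> B \<Longrightarrow> (\<Sum>k<r. c k * V k j) = 0"
      by blast
    have "(\<Sum>k<Suc r. (c(r := 0)) k * V k j) = 0" if "j \<in> B" for j
      using c(3)[OF that] by simp
    moreover have "(c(r := 0)) k \<noteq> 0" "k < Suc r" using c by auto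
    ultimately show ?thesis by blast
  next
    case False
    then obtain S where
      S: "\<And>k l. k < r \<Longrightarrow> l < r \<Longrightarrow> (\<Sum>j\<in>B. V k j * S j l) = (if k = l then 1 else 0)"
      using Suc.IH by blast
    \<comment> \<open>\<open>v\<close> is the residual of row \<open>r\<close>: it is annihilated by
      the first \<open>r\<close> columns of \<open>S\<close>.\<close>
    define d where "d l = (\<Sum>j\<in>B. V r j * S j l)" for l
    define v where "v j = V r j - (\<Sum>k<r. d k * V k j)" for j
    show ?thesis
    proof (cases "\<forall>j\<in>B. v j = 0")
      case True
      have "(\<Sum>k<Suc r. (if k = r then 1 else - d k) * V k j) = 0" if "j \<in> B" for j
        using True that by (simp add: v_def sum_negf)
      then show ?thesis
        by (intro disjI2 exI[of _ "\<lambda>k. if k = r then 1 else - d k"] conjI exI[of _ r]) auto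
    next
      case False
      then obtain j0 where j0: "j0 \<in> B" "v j0 \<noteq> 0" by blast
      \<comment> \<open>The unit vector at \<open>j0\<close>, projected to the kernel of the first
        \<open>r\<close> rows and scaled so that row \<open>r\<close> yields 1. In \<open>S'\<close>
        a multiple of it clears row \<open>r\<close> against the old columns.\<close>
      define s where "s j = ((if j = j0 then 1 else 0) - (\<Sum>l<r. S j l * V l j0)) / v j0" for j
      define S' where "S' j l = (if l = r then s j else S j l - d l * s j)" for j l
      have Vs: "(\<Sum>j\<in>B. V k j * s j) = (V k j0 - (\<Sum>l<r. (\<Sum>j\<in>B. V k j * S j l) * V l j0)) / v j0"
        for k
      proof -
        have "(\<Sum>j\<in>B. V k j * s j) =
            ((\<Sum>j\<in>B. V k j * (if j = j0 then 1 else 0)) - (\<Sum>j\<in>B. \<Sum>l<r. V k j * S j l * V l j0)) / v j0"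
          by (simp add: s_def right_diff_distrib sum_subtractf sum_distrib_left mult.assoc
              flip: sum_divide_distrib)
        also have "(\<Sum>j\<in>B. V k j * (if j = j0 then 1 else 0)) = V k j0"
          using assms j0 by (simp add: if_distrib sum.delta cong: if_cong)
        also have "(\<Sum>j\<in>B. \<Sum>l<r. V k j * S j l * V l j0) = (\<Sum>l<r. (\<Sum>j\<in>B. V k j * S j l) * V l j0)"
          by (subst sum.swap) (simp add: sum_distrib_right)
        finally show ?thesis .
      qed
      have 1: "(\<Sum>j\<in>B. V k j * s j) = 0" if "k < r" for k
      proof -
        have "(\<Sum>l<r. (\<Sum>j\<in>B. V k j * S j l) * V l j0) = (\<Sum>l<r. if k = l then V l j0 else 0)"
          using that by (intro sum.cong) (auto simp: S)
        then show ?thesis using that by (simp add: Vs)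
      qed
      have 2: "(\<Sum>j\<in>B. V r j * s j) = 1"
        using j0 by (simp add: Vs flip: d_def v_def)
      have 3: "(\<Sum>j\<in>B. V k j * S' j l) = (\<Sum>j\<in>B. V k j * S j l) - d l * (\<Sum>j\<in>B. V k j * s j)"
        if "l < r" for k l
        using that by (simp add: S'_def right_diff_distrib sum_subtractf sum_distrib_left ac_simps)
      have "(\<Sum>j\<in>B. V k j * S' j l) = (if k = l then 1 else 0)" if "k < Suc r" "l < Suc r" for k l
      proof (cases "l = r")
        case True
        then show ?thesis using that 1 2 by (cases "k = r") (auto simp: S'_def)
      next
        case False
        then have "l < r" using that by simp
        then show ?thesis using that 1 2 3 S by (cases "k = r") (auto simp flip: d_def)
      qed
      then show ?thesis by blast
    qed
  qed
qed simp

text \<open>Row \<open>m\<close> of \<open>V\<close> is a combination of the other rows, so the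
  inner index \<open>m\<close> can be absorbed into the others.\<close>

lemma rank_le_dependent:
  fixes z :: "nat \<times> nat \<Rightarrow> 'f::field"
  assumes UV: "\<And>i j. i \<in> A \<Longrightarrow> j \<in> B \<Longrightarrow> z (i, j) = (\<Sum>k<r. U i k * V k j)"
    and m: "m < r" "c m \<noteq> 0" and c: "\<And>j. j \<in> B \<Longrightarrow> (\<Sum>k<r. c k * V k j) = 0"
  shows "rank_le A B (r - 1) z"
proof (rule rank_leI_finite[of "{..<r} - {m}" "r - 1"])
  show "card ({..<r} - {m}) = r - 1" using m by simp
  fix i j assume ij: "i \<in> A" "j \<in> B"
  let ?K = "{..<r} - {m}"
  have split: "(\<Sum>k<r. F k) = F m + (\<Sum>k\<in>?K. F k)" for F :: "nat \<Rightarrow> 'f"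
    using m by (simp add: sum.remove)
  have "c m * V m j = - (\<Sum>k\<in>?K. c k * V k j)"
    using c[OF ij(2)] split[of "\<lambda>k. c k * V k j"] by (simp add: eq_neg_iff_add_eq_0)
  then have V: "V m j = - (\<Sum>k\<in>?K. c k * V k j) / c m"
    using m by (simp add: field_simps)
  have "(\<Sum>k\<in>?K. (U i k - U i m * c k / c m) * V k j) =
      (\<Sum>k\<in>?K. U i k * V k j) - U i m * (\<Sum>k\<in>?K. c k * V k j) / c m"
    by (simp add: left_diff_distrib sum_subtractf sum_distrib_left sum_divide_distrib mult.assoc)
  then show "z (i, j) = (\<Sum>k\<in>?K. (U i k - U i m * c k / c m) * V k j)"
    by (simp add: UV[OF ij] split V)
qed simp

text \<open>The third assumption makes the rank on \<open>A\<close> and \<open>B\<close> exactly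
  \<open>r\<close>. Then \<open>V\<close> has a right inverse \<open>S\<close> on \<open>B\<close>,
  which recovers \<open>U\<close> from the columns in \<open>B\<close>, and hence column
  \<open>b\<close>. The conjunct \<open>1 \<le> r\<close> lets rank 0 count as exact although the
  truncated \<open>r - 1\<close> is again 0.\<close>

lemma rank_le_solve_col:
  fixes z :: "nat \<times> nat \<Rightarrow> 'f::field"
  assumes "rank_le A (insert b B) r z" "finite B" "\<not> (1 \<le> r \<and> rank_le A B (r - 1) z)"
  obtains l where "\<And>i. i \<in> A \<Longrightarrow> z (i, b) = (\<Sum>j\<in>B. z (i, j) * l j)"
proof -
  obtain U V where UV: "\<And>i j. i \<in> A \<Longrightarrow> j \<in> insert b B \<Longrightarrow> z (i, j) = (\<Sum>k<r. U i k * V k j)"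
    using assms(1) by (rule rank_leE) blast
  have "\<not> (\<exists>c. (\<exists>k<r. c k \<noteq> 0) \<and> (\<forall>j\<in>B. (\<Sum>k<r. c k * V k j) = 0))"
    using rank_le_dependent[where A = A and B = B and z = z and r = r and U = U and V = V] UV assms(3) by fastforce
  then obtain S where
    S: "\<And>k l. k < r \<Longrightarrow> l < r \<Longrightarrow> (\<Sum>j\<in>B. V k j * S j l) = (if k = l then 1 else 0)"
    using right_inverse_or_dependent[OF assms(2), of r V] by blast
  have "z (i, b) = (\<Sum>j\<in>B. z (i, j) * (\<Sum>l<r. S j l * V l b))" if i: "i \<in> A" for i
  proof -
    have "(\<Sum>j\<in>B. z (i, j) * (\<Sum>l<r. S j l * V l b)) =
        (\<Sum>j\<in>B. \<Sum>k<r. \<Sum>l<r. U i k * (V k j * S j l) * V l b)"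
      by (intro sum.cong refl) (simp only: UV[OF i insertI2] sum_product mult.assoc)
    also have "\<dots> = (\<Sum>k<r. \<Sum>l<r. \<Sum>j\<in>B. U i k * (V k j * S j l) * V l b)"
      by (subst sum.swap) (intro sum.cong refl sum.swap)
    also have "\<dots> = (\<Sum>k<r. \<Sum>l<r. U i k * (if k = l then 1 else 0) * V l b)"
      by (intro sum.cong refl) (simp add: S flip: sum_distrib_left sum_distrib_right)
    also have "\<dots> = (\<Sum>k<r. U i k * V k b)"
      by (intro sum.cong refl) (simp add: if_distrib if_distribR cong: if_cong)
    finally show ?thesis by (simp add: UV i)
  qed
  then show ?thesis by (rule that)
qed

lemma rank_le_solve_row:
  fixes z :: "nat \<times> nat \<Rightarrow> 'f::field"
  assumes "rank_le (insert a A) B r z" "finite A" "\<not> (1 \<le> r \<and> rank_le A B (r - 1) z)"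
  obtains l where "\<And>j. j \<in> B \<Longrightarrow> z (a, j) = (\<Sum>i\<in>A. l i * z (i, j))"
proof -
  have "\<not> (1 \<le> r \<and> rank_le B A (r - 1) (\<lambda>(i, j). z (j, i)))"
    using rank_le_transpose[of B A "r - 1" "\<lambda>(i, j). z (j, i)"] assms(3) by auto
  from rank_le_solve_col[OF rank_le_transpose[OF assms(1)] assms(2) this]
  obtain l where "\<And>j. j \<in> B \<Longrightarrow> z (a, j) = (\<Sum>i\<in>A. z (i, j) * l i)" by auto
  then show ?thesis by (intro that[of l]) (simp add: mult.commute)
qed

section \<open>Rank varieties and leading monomials\<close>

lemma lookup_coeff_in:
  "lookup (coeff_in y d f) m = (if lookup m y = 0 then lookup f (m + single y d) else 0)"
proof -
  have *: "m' - single y d = m \<longleftrightarrow> lookup m y = 0 \<and> m' = m + single y d"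
    if "lookup m' y = d" for m'
  proof
    assume m: "m' - single y d = m"
    then show "lookup m y = 0 \<and> m' = m + single y d"
      using that by (auto intro!: poly_mapping_eqI simp: lookup_minus lookup_add lookup_single when_def)
  qed simp
  let ?A = "{m' \<in> keys f. lookup m' y = d}"
  have "lookup (coeff_in y d f) m =
      (\<Sum>m'\<in>?A. if m' = m + single y d then if lookup m y = 0 then lookup f m' else 0 else 0)"
    unfolding coeff_in_def lookup_sum lookup_single when_def
    by (intro sum.cong refl) (simp add: *)
  also have "\<dots> = (if lookup m y = 0 then lookup f (m + single y d) else 0)"
    by (subst sum.delta) (simp_all add: lookup_add in_keys_iff)
  finally show ?thesis .
qed

lemma keys_coeff_in: "m \<in> keys (coeff_in y d f) \<longleftrightarrow> lookup m y = 0 \<and> m + single y d \<in> keys f"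
  by (simp add: in_keys_iff lookup_coeff_in)

lemma pprod_eval_upd:
  "pprod_eval (z(y := t)) m = t ^ lookup m y * pprod_eval (z(y := 1)) m"
proof -
  let ?A = "insert y (keys m)"
  have "pprod_eval (z(y := u)) m = u ^ lookup m y * (\<Prod>v\<in>?A - {y}. z v ^ lookup m v)" for u
    by (subst pprod_eval_superset[where A = ?A]) (auto simp: prod.remove[of ?A y])
  from this[of t] this[of 1] show ?thesis by simp
qed

lemma pprod_eval_diff_single:
  assumes "lookup m y = d"
  shows "pprod_eval z (m - single y d) = pprod_eval (z(y := 1)) m"
proof -
  have m: "m = (m - single y d) + single y d"
    using assms by (auto intro!: poly_mapping_eqI simp: lookup_minus lookup_add lookup_single when_def)
  have "pprod_eval (z(y := 1)) m = pprod_eval (z(y := 1)) (m - single y d)"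
    by (subst m) (simp add: pprod_eval_add)
  also have "\<dots> = pprod_eval z (m - single y d)"
    by (rule pprod_eval_cong) (use assms in \<open>auto simp: in_keys_iff lookup_minus\<close>)
  finally show ?thesis by simp
qed

text \<open>Along a curve on which \<open>y = 1/s\<close> while the other coordinates are polynomial in \<open>s\<close>, the
  polynomial \<open>s\<^sup>d f\<close> tends to the coefficient of \<open>y\<^sup>d\<close> at \<open>s = 0\<close>.\<close>

lemma coeff_in_vanishes_at_limit:
  fixes h :: "'k::field \<Rightarrow> 'f::field"
  assumes h: "comm_ring_hom h" and inf: "infinite (UNIV :: 'f set)"
    and D: "\<And>m. m \<in> keys f \<Longrightarrow> lookup m y \<le> d"
    and van: "\<And>s. s \<noteq> 0 \<Longrightarrow> mpoly_eval h ((\<lambda>v. poly (Z v) s)(y := 1 / s)) f = 0"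
  shows "mpoly_eval h (\<lambda>v. poly (Z v) 0) (coeff_in y d f) = 0"
proof -
  interpret comm_ring_hom h by fact
  \<comment> \<open>For nonzero \<open>s\<close> this is \<open>s^d\<close> times the value of
    \<open>f\<close> on the curve; with denominators cleared it also makes sense at
    \<open>s = 0\<close>, where only the terms of degree \<open>d\<close> in \<open>y\<close>
    survive.\<close>
  define P where "P = (\<Sum>m\<in>keys f. [:h (lookup f m):] * monom 1 (d - lookup m y) * pprod_eval (Z(y := 1)) m)"
  have Z1: "poly (pprod_eval (Z(y := 1)) m) s = pprod_eval ((\<lambda>v. poly (Z v) s)(y := 1)) m" for m s
    unfolding pprod_eval_def by (auto simp: poly_prod intro!: prod.cong)
  have P: "poly P s = (\<Sum>m\<in>keys f. h (lookup f m) * s ^ (d - lookup m y) *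
      pprod_eval ((\<lambda>v. poly (Z v) s)(y := 1)) m)" for s
    by (simp add: P_def poly_sum poly_monom Z1 mult.assoc)
  have "poly P s = 0" if "s \<noteq> 0" for s
  proof -
    have "poly P s = (\<Sum>m\<in>keys f. s ^ d * (h (lookup f m) *
      pprod_eval ((\<lambda>v. poly (Z v) s)(y := 1 / s)) m))"
      unfolding P
    proof (rule sum.cong[OF refl])
      fix m assume "m \<in> keys f"
      then have "s ^ (d - lookup m y) = s ^ d * (1 / s) ^ lookup m y"
        using that D by (simp add: power_diff power_one_over field_simps)
      then show "h (lookup f m) * s ^ (d - lookup m y) * pprod_eval ((\<lambda>v. poly (Z v) s)(y := 1)) m =
          s ^ d * (h (lookup f m) * pprod_eval ((\<lambda>v. poly (Z v) s)(y := 1 / s)) m)"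
        by (subst (2) pprod_eval_upd) (simp only: ac_simps)
    qed
    then show ?thesis
      using van[OF that] by (simp add: mpoly_eval_def flip: sum_distrib_left)
  qed
  then have "UNIV - {0} \<subseteq> {s. poly P s = 0}" by blast
  then have "P = 0"
    using inf poly_roots_finite[of P] finite_subset by fastforce
  have "mpoly_eval h (\<lambda>v. poly (Z v) 0) (coeff_in y d f) =
      (\<Sum>m | m \<in> keys f \<and> lookup m y = d. h (lookup f m) * pprod_eval ((\<lambda>v. poly (Z v) 0)(y := 1)) m)"
    by (simp add: coeff_in_def mpoly_eval_sum[OF h] mpoly_eval_single[OF h] pprod_eval_diff_single)
  also have "\<dots> = (\<Sum>m\<in>keys f. h (lookup f m) * 0 ^ (d - lookup m y) *
      pprod_eval ((\<lambda>v. poly (Z v) 0)(y := 1)) m)"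
    by (rule sum.mono_neutral_cong_left) (use D in \<open>auto simp: power_0_left le_antisym\<close>)
  also have "\<dots> = poly P 0" by (simp add: P)
  finally show ?thesis by (simp add: \<open>P = 0\<close>)
qed

section \<open>Stages of the elimination and lifting of points\<close>

text \<open>The order \<^const>\<open>new_less\<close> runs through the variables row by row, so a stage of the elimination
  is given by the pair \<open>(a, b)\<close>: only the rows below \<open>a\<close> and the first \<open>b\<close> entries of row \<open>a\<close>
  are left.\<close>

definition region :: "nat \<Rightarrow> nat \<Rightarrow> nat \<Rightarrow> (nat \<times> nat) set" where
  "region n a b = {(i, j). 1 \<le> j \<and> j \<le> n \<and> i \<le> n \<and> (a < i \<or> i = a \<and> j \<le> b)}"

text \<open>A triple \<open>(p, q, r)\<close> bounds by \<open>r\<close> the rank of the northwest \<open>p \<times> q\<close> block; the conditions in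
  \<open>N\<close> are imposed on the rows below \<open>a\<close> only.\<close>

definition rank_variety ::
  "nat \<Rightarrow> nat \<Rightarrow> (nat \<times> nat \<times> nat) set \<Rightarrow> (nat \<times> nat \<times> nat) set \<Rightarrow> (nat \<times> nat \<Rightarrow> 'f::field) set"
  where
  "rank_variety a b C N = {z.
     (\<forall>(p, q, r)\<in>C \<union> N. rank_le {a<..p} {1..q} r z) \<and>
     (\<forall>(p, q, r)\<in>C. rank_le {a..p} {1..min q b} r z)}"

definition antidiagonal :: "(nat \<times> nat) set \<Rightarrow> bool" where
  "antidiagonal S \<longleftrightarrow> (\<forall>u\<in>S. \<forall>v\<in>S. u \<noteq> v \<longrightarrow>
     fst u < fst v \<and> snd v < snd u \<or> fst v < fst u \<and> snd u < snd v)"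

text \<open>The two alternatives mirror the two rectangles in \<open>rank_variety\<close>: all
  columns of the block in the rows below \<open>a\<close>, or row \<open>a\<close> included but only
  its first \<open>b\<close> columns.\<close>

definition violating ::
  "nat \<Rightarrow> nat \<Rightarrow> (nat \<times> nat \<times> nat) set \<Rightarrow> (nat \<times> nat \<times> nat) set \<Rightarrow> (nat \<times> nat) set \<Rightarrow> bool"
  where
  "violating a b C N S \<longleftrightarrow> antidiagonal S \<and>
     ((\<exists>(p, q, r)\<in>C \<union> N. S \<subseteq> {a<..p} \<times> {1..q} \<and> card S = Suc r) \<or>
      (\<exists>(p, q, r)\<in>C. S \<subseteq> {a..p} \<times> {1..min q b} \<and> card S = Suc r))"

text \<open>Chosen so that the Schur complement of the corner \<open>1 / s\<close> is the block of
  \<open>z\<close> strictly southwest of \<open>(a, b)\<close>. Every entry except the corner is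
  polynomial in \<open>s\<close> and returns to its value in \<open>z\<close> at
  \<open>s = 0\<close>.\<close>

definition bend :: "nat \<Rightarrow> nat \<Rightarrow> 'f::field \<Rightarrow> (nat \<times> nat \<Rightarrow> 'f) \<Rightarrow> nat \<times> nat \<Rightarrow> 'f" where
  "bend a b s z = (\<lambda>(i, j). if i = a \<and> j = b then 1 / s
     else if a < i \<and> j < b then z (i, j) + s * z (i, b) * z (a, j) else z (i, j))"

lemma bend_in_rank_variety:
  assumes z: "z \<in> rank_variety a (b - 1) C N" and b: "1 \<le> b"
    and N: "\<And>p q r. (p, q, r) \<in> N \<Longrightarrow> b \<le> q"
    and act: "\<And>p q r. (p, q, r) \<in> C \<Longrightarrow> a \<le> p \<Longrightarrow> b \<le> q \<Longrightarrow>
      1 \<le> r \<and> rank_le {a<..p} {1..b - 1} (r - 1) z"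
    and s: "s \<noteq> 0"
  shows "bend a b s z \<in> rank_variety a b C N"
proof -
  have z1: "rank_le {a<..p} {1..q} r z" if "(p, q, r) \<in> C \<union> N" for p q r
    using z that unfolding rank_variety_def by blast
  have z2: "rank_le {a..p} {1..min q (b - 1)} r z" if "(p, q, r) \<in> C" for p q r
    using z that unfolding rank_variety_def by blast
  have rows: "rank_le {a..p} {1..q} r (bend a b s z)" if "(p, q, r) \<in> C" "q < b" "a \<le> p" for p q r
  proof (rule rank_le_row_op[where t = "\<lambda>i. if a < i then s * z (i, b) else 0" and a = a])
    have "min q (b - 1) = q" using that by linarith
    then show "rank_le {a..p} {1..q} r z" using z2[OF that(1)] by simp
  qed (use that in \<open>auto simp: bend_def\<close>)
  have 1: "rank_le {a<..p} {1..q} r (bend a b s z)" if pqr: "(p, q, r) \<in> C \<union> N" for p q r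
  proof (cases "b \<le> q")
    case True
    show ?thesis
      by (rule rank_le_col_op[OF z1[OF pqr], where t = "\<lambda>j. if j < b then s * z (a, j) else 0" and b = b])
        (use True b in \<open>auto simp: bend_def\<close>)
  next
    case False
    then have "(p, q, r) \<in> C" using N pqr by blast
    then have "a \<le> p \<Longrightarrow> rank_le {a..p} {1..q} r (bend a b s z)"
      using rows False by simp
    then show ?thesis
      by (cases "a \<le> p") (force elim: rank_le_mono, simp)
  qed
  have 2: "rank_le {a..p} {1..min q b} r (bend a b s z)" if pqr: "(p, q, r) \<in> C" for p q r
  proof -
    consider "p < a" | "a \<le> p" "q < b" | "a \<le> p" "b \<le> q" by linarith
    then show ?thesis
    proof cases
      case 2
      then show ?thesis using rows[OF pqr] by simp
    next
      case 3
      have "rank_le (insert a {a<..p}) (insert b {1..b - 1}) (Suc (r - 1)) (bend a b s z)"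
        by (rule rank_le_border[where z = z and s = s])
          (use act[OF pqr 3] s b in \<open>auto simp: bend_def\<close>)
      moreover have "insert a {a<..p} = {a..p}" "insert b {1..b - 1} = {1..min q b}"
        using 3 b by auto
      ultimately show ?thesis using act[OF pqr 3] by simp
    qed simp
  qed
  show ?thesis
    unfolding rank_variety_def using 1 2 by blast
qed

text \<open>If one block southwest of \<open>(a, b)\<close> has full rank, then column
  \<open>b\<close> is a combination of the columns to its west and row \<open>a\<close> one of the
  rows below it. Both relations predict the same value for the missing entry, and this value raises
  no rank.\<close>

lemma extend_in_rank_variety:
  assumes z: "z \<in> rank_variety a (b - 1) C N" and b: "1 \<le> b"
    and pqr: "(p, q, r) \<in> C" "a \<le> p" "b \<le> q"
    and full: "\<not> (1 \<le> r \<and> rank_le {a<..p} {1..b - 1} (r - 1) z)"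
  shows "\<exists>t. z((a, b) := t) \<in> rank_variety a b C N"
proof -
  have z1: "rank_le {a<..p} {1..q} r z" if "(p, q, r) \<in> C \<union> N" for p q r
    using z that unfolding rank_variety_def by blast
  have z2: "rank_le {a..p} {1..min q (b - 1)} r z" if "(p, q, r) \<in> C" for p q r
    using z that unfolding rank_variety_def by blast
  have "rank_le {a<..p} (insert b {1..b - 1}) r z"
    by (rule rank_le_mono[OF z1]) (use pqr b in auto)
  from rank_le_solve_col[OF this _ full]
  obtain \<mu> where \<mu>: "\<And>i. i \<in> {a<..p} \<Longrightarrow> z (i, b) = (\<Sum>j\<in>{1..b - 1}. z (i, j) * \<mu> j)"
    by auto
  have "rank_le (insert a {a<..p}) {1..b - 1} r z"
    by (rule rank_le_mono[OF z2[OF pqr(1)]]) (use pqr b in auto)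
  from rank_le_solve_row[OF this _ full]
  obtain l where l: "\<And>j. j \<in> {1..b - 1} \<Longrightarrow> z (a, j) = (\<Sum>i\<in>{a<..p}. l i * z (i, j))"
    by auto
  define t where "t = (\<Sum>j\<in>{1..b - 1}. z (a, j) * \<mu> j)"
  have t: "t = (\<Sum>i\<in>{a<..p}. l i * z (i, b))"
  proof -
    have "t = (\<Sum>j\<in>{1..b - 1}. \<Sum>i\<in>{a<..p}. l i * (z (i, j) * \<mu> j))"
      by (simp add: t_def l sum_distrib_right mult.assoc)
    then show ?thesis
      by (subst (asm) sum.swap) (simp add: \<mu> sum_distrib_left)
  qed
  let ?z = "z((a, b) := t)"
  have 1: "rank_le {a<..p'} {1..q'} r' ?z" if "(p', q', r') \<in> C \<union> N" for p' q' r'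
    using z1[OF that] by (rule rank_le_cong[THEN iffD1, rotated]) auto
  have 2: "rank_le {a..p'} {1..min q' b} r' ?z" if pqr': "(p', q', r') \<in> C" for p' q' r'
  proof -
    have *: "rank_le {a..p'} {1..min q' (b - 1)} r' ?z"
      using z2[OF that] by (rule rank_le_cong[THEN iffD1, rotated]) (use b in auto)
    \<comment> \<open>The column relation holds in the rows up to \<open>p\<close>, so it restricts
      to fewer rows; the row relation uses only rows up to \<open>p\<close>, so it stays available
      when there are more rows.\<close>
    consider "p' < a" | "q' < b" | "a \<le> p'" "b \<le> q'" "p' \<le> p" | "a \<le> p'" "b \<le> q'" "p < p'"
      by linarith
    then show ?thesis
    proof cases
      case 2
      then show ?thesis using * by (simp add: min_def split: if_splits)
    next
      case 3
      have "rank_le {a..p'} (insert b {1..b - 1}) r' ?z"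
      proof (rule rank_le_insert_col[where l = \<mu>])
        have "min q' (b - 1) = b - 1" using 3 by linarith
        then show "rank_le {a..p'} {1..b - 1} r' ?z" using * by simp
        fix i assume "i \<in> {a..p'}"
        then show "?z (i, b) = (\<Sum>j\<in>{1..b - 1}. ?z (i, j) * \<mu> j)"
          using 3 b by (cases "i = a") (auto simp: t_def \<mu> intro!: sum.cong)
      qed
      moreover have "insert b {1..b - 1} = {1..min q' b}" using 3 b by auto
      ultimately show ?thesis by simp
    next
      case 4
      have "rank_le (insert a {a<..p'}) {1..b} r' ?z"
      proof (rule rank_le_insert_row[where l = "\<lambda>i. if i \<le> p then l i else 0"])
        show "rank_le {a<..p'} {1..b} r' ?z"
          by (rule rank_le_mono[OF 1]) (use 4 pqr' in auto)
        fix j assume j: "j \<in> {1..b}"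
        have "(\<Sum>i\<in>{a<..p'}. (if i \<le> p then l i else 0) * ?z (i, j)) = (\<Sum>i\<in>{a<..p}. l i * z (i, j))"
          by (rule sum.mono_neutral_cong_right) (use 4 in auto)
        also have "\<dots> = ?z (a, j)"
          using j by (cases "j = b") (auto simp: t l)
        finally show "?z (a, j) = (\<Sum>i\<in>{a<..p'}. (if i \<le> p then l i else 0) * ?z (i, j))" ..
      qed
      moreover have "insert a {a<..p'} = {a..p'}" using 4 by auto
      ultimately show ?thesis using 4 by (simp add: min_def)
    qed simp
  qed
  show ?thesis unfolding rank_variety_def using 1 2 by blast
qed

lemma lex_less_cancel:
  assumes "lex_less R (m + k) (m' + k)"
  shows "lex_less R m m'"
  using assms unfolding lex_less_def by (simp add: lookup_add)

lemma coeff_in_vanishes_on_rank_variety: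
  fixes h :: "'k::field \<Rightarrow> 'f::field"
  assumes h: "comm_ring_hom h" and inf: "infinite (UNIV :: 'f set)"
    and D: "\<And>m. m \<in> keys f \<Longrightarrow> lookup m (a, b) \<le> d"
    and van: "\<And>z. z \<in> rank_variety a b C N \<Longrightarrow> mpoly_eval h z f = 0"
    and z: "z \<in> rank_variety a (b - 1) C N" and b: "1 \<le> b"
    and N: "\<And>p q r. (p, q, r) \<in> N \<Longrightarrow> b \<le> q"
    and act: "\<And>p q r. (p, q, r) \<in> C \<Longrightarrow> a \<le> p \<Longrightarrow> b \<le> q \<Longrightarrow>
      1 \<le> r \<and> rank_le {a<..p} {1..b - 1} (r - 1) z"
  shows "mpoly_eval h z (coeff_in (a, b) d f) = 0"
proof -
  define Z where "Z = (\<lambda>(i, j). if a < i \<and> j < b then [:z (i, j), z (i, b) * z (a, j):] else [:z (i, j):])"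
  have bend: "bend a b s z = (\<lambda>v. poly (Z v) s)((a, b) := 1 / s)" for s
    by (auto simp: bend_def Z_def fun_eq_iff ac_simps)
  have "mpoly_eval h (\<lambda>v. poly (Z v) 0) (coeff_in (a, b) d f) = 0"
    by (rule coeff_in_vanishes_at_limit[OF h inf D])
      (simp_all add: van bend_in_rank_variety[OF z b N act] flip: bend)
  moreover have "(\<lambda>v. poly (Z v) 0) = z" by (auto simp: Z_def fun_eq_iff)
  ultimately show ?thesis by simp
qed

text \<open>With row \<open>a\<close> exhausted, "below \<open>a\<close>" means "from row
  \<open>Suc a\<close> on", so the conditions in \<open>N\<close> become ordinary conditions of the
  next row.\<close>

lemma rank_variety_next_row:
  assumes "\<And>p q r. (p, q, r) \<in> C \<union> N \<Longrightarrow> q \<le> n"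
    and "z \<in> rank_variety (Suc a) n (C \<union> N) {}"
  shows "z \<in> rank_variety a 0 C N"
proof -
  have "rank_le {a<..p} {1..q} r z" if "(p, q, r) \<in> C \<union> N" for p q r
  proof -
    have "rank_le {Suc a..p} {1..min q n} r z"
      using assms(2) that unfolding rank_variety_def by blast
    then show ?thesis
      using assms(1)[OF that] by (simp add: min_def atLeastSucAtMost_greaterThanAtMost)
  qed
  then show ?thesis unfolding rank_variety_def by auto
qed

lemma violating_next_row:
  assumes "violating (Suc a) n (C \<union> N) {} S"
  shows "violating a 0 C N S"
proof -
  obtain p q r where "(p, q, r) \<in> C \<union> N" "card S = Suc r" "antidiagonal S"
    and S: "S \<subseteq> {Suc a<..p} \<times> {1..q} \<or> S \<subseteq> {Suc a..p} \<times> {1..min q n}"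
    using assms unfolding violating_def by blast
  moreover have "S \<subseteq> {a<..p} \<times> {1..q}"
    using S by (elim disjE order_trans) auto
  ultimately show ?thesis unfolding violating_def by blast
qed

lemma antidiagonal_subset: "antidiagonal S \<Longrightarrow> T \<subseteq> S \<Longrightarrow> antidiagonal T"
  unfolding antidiagonal_def by blast

lemma antidiagonal_insert:
  assumes "antidiagonal S" "\<And>u. u \<in> S \<Longrightarrow> a < fst u \<and> snd u < b"
  shows "antidiagonal (insert (a, b) S)"
  using assms unfolding antidiagonal_def by auto

text \<open>This contains the theorem of Knutson and Miller that the minors form a Groebner basis. The
  induction eliminates the greatest variable \<open>y\<close>, at \<open>(a, b)\<close>. If \<open>y\<close> occurs in the leading monomial,
  then the leading coefficient with respect to \<open>y\<close> vanishes at all points whose blocks strictly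
  southwest of \<open>(a, b)\<close> have rank smaller by one, because \<^const>\<open>bend\<close> lifts such a point to a curve
  along which \<open>y\<close> tends to infinity.\<close>

theorem leading_monomial_contains_violating:
  fixes h :: "'k::field \<Rightarrow> 'f::field"
  assumes h: "comm_ring_hom h" and inf: "infinite (UNIV :: 'f set)"
  assumes "\<And>m. m \<in> keys f \<Longrightarrow> keys m \<subseteq> region n a b"
    and "m0 \<in> keys f" "\<And>m. m \<in> keys f \<Longrightarrow> m \<noteq> m0 \<Longrightarrow> lex_less new_less m m0"
    and "\<And>z. z \<in> rank_variety a b C N \<Longrightarrow> mpoly_eval h z f = 0"
    and "b \<le> n" "\<And>p q r. (p, q, r) \<in> C \<union> N \<Longrightarrow> q \<le> n"
    and "\<And>p q r. (p, q, r) \<in> N \<Longrightarrow> b \<le> q"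
  shows "\<exists>S \<subseteq> keys m0. violating a b C N S"
  using assms(3-)
\<comment> \<open>The weight \<open>Suc n\<close> of a row pays for the restart at
  \<open>b = n\<close> in the next row.\<close>
proof (induction "(Suc n - a) * Suc n + b" arbitrary: a b C N f m0 rule: less_induct)
  case (less a b C N f m0)
  note supp = less.prems(1) and m0 = less.prems(2) and lead = less.prems(3) and van = less.prems(4)
    and bn = less.prems(5) and qn = less.prems(6) and N = less.prems(7)
  interpret comm_ring_hom h by fact
  consider "n < a" | "a \<le> n" "b = 0" | "a \<le> n" "1 \<le> b" by linarith
  then show ?case
  proof cases
    \<comment> \<open>No variable is left: \<open>f\<close> is a nonzero constant, and it would have
      to vanish at the zero point.\<close>
    case 1
    have "region n a b = {}" using 1 by (auto simp: region_def)
    then have k0: "m = 0" if "m \<in> keys f" for m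
      using supp[OF that] by simp
    then have kf: "keys f = {0}" using m0 by auto
    then have c: "lookup f 0 \<noteq> 0" by (simp add: in_keys_iff[symmetric])
    have "(\<lambda>_. 0) \<in> rank_variety a b C N"
      by (auto simp: rank_variety_def rank_le_zero)
    then have "h (lookup f 0) = 0"
      using van by (fastforce simp: mpoly_eval_def kf)
    then have "h (lookup f 0 * inverse (lookup f 0)) = 0" by (simp add: hom_mult)
    then show ?thesis using c by simp
  next
    case 2
    have reg: "region n a 0 = region n (Suc a) n" by (auto simp: region_def)
    have "Suc n - a = Suc (Suc n - Suc a)" using 2 by simp
    then have dec: "(Suc n - Suc a) * Suc n + n < (Suc n - a) * Suc n + b" by simp
    have "\<exists>S \<subseteq> keys m0. violating (Suc a) n (C \<union> N) {} S"
    proof (rule less.hyps[OF dec, of f])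
      show "mpoly_eval h z f = 0" if "z \<in> rank_variety (Suc a) n (C \<union> N) {}" for z
        using van rank_variety_next_row[OF qn that] 2 by simp
    qed (use supp m0 lead qn 2 reg in auto)
    then show ?thesis using violating_next_row 2 by blast
  next
    case 3
    let ?y = "(a, b)"
    define d where "d = lookup m0 ?y"
    define g where "g = coeff_in ?y d f"
    define m1 where "m1 = m0 - single ?y d"
    have m1: "m1 + single ?y d = m0" "lookup m1 ?y = 0"
      by (auto intro!: poly_mapping_eqI simp: m1_def d_def lookup_minus lookup_add lookup_single when_def)
    have m1g: "m1 \<in> keys g" using m0 m1 by (simp add: g_def keys_coeff_in)
    have leadg: "lex_less new_less m m1" if "m \<in> keys g" "m \<noteq> m1" for m
    proof -
      have "m + single ?y d \<in> keys f" "m + single ?y d \<noteq> m0"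
        using that m1 by (auto simp: g_def keys_coeff_in)
      then show ?thesis using lead lex_less_cancel m1(1) by metis
    qed
    have ymax: "new_less v ?y" if "v \<in> region n a b" "v \<noteq> ?y" for v
      using that by (cases v) (auto simp: region_def new_less_def)
    have D: "lookup m ?y \<le> d" if mf: "m \<in> keys f" for m
    proof (cases "m = m0")
      case False
      then obtain v where v: "lookup m v < lookup m0 v"
          "\<And>u. new_less v u \<Longrightarrow> lookup m u = lookup m0 u"
        using lead[OF mf] unfolding lex_less_def by blast
      then have "v \<in> region n a b" using supp[OF m0] by (auto simp: in_keys_iff)
      then show ?thesis
        using ymax[of v] v by (cases "v = ?y") (auto simp: d_def less_imp_le)
    qed (simp add: d_def)
    have suppg: "keys m \<subseteq> region n a (b - 1)" if "m \<in> keys g" for m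
    proof
      fix v assume v: "v \<in> keys m"
      have "lookup m ?y = 0" "m + single ?y d \<in> keys f"
        using that by (auto simp: g_def keys_coeff_in)
      then have "v \<noteq> ?y" "v \<in> keys (m + single ?y d)"
        using v by (auto simp: in_keys_iff lookup_add)
      then have "v \<in> region n a b" "v \<noteq> ?y"
        using supp \<open>m + single ?y d \<in> keys f\<close> by blast+
      then show "v \<in> region n a (b - 1)" by (auto simp: region_def)
    qed
    have dec: "(Suc n - a) * Suc n + (b - 1) < (Suc n - a) * Suc n + b" using 3 by simp
    have m10: "keys m1 \<subseteq> keys m0" by (auto simp: m1_def in_keys_iff lookup_minus)
    have mono: "violating a b C N S" if "violating a (b - 1) C N S" for S
    proof -
      have "{a..p} \<times> {1..min q (b - 1)} \<subseteq> {a..p} \<times> {1..min q b}" for p q by auto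
      then show ?thesis using that unfolding violating_def by fast
    qed
    show ?thesis
    proof (cases "d = 0")
      case True
      have y0: "lookup m ?y = 0" if "m \<in> keys f" for m using D[OF that] True by simp
      have gf: "g = f"
      proof (rule poly_mapping_eqI)
        show "lookup g m = lookup f m" for m
          using y0[of m] True by (cases "lookup f m = 0") (auto simp: g_def lookup_coeff_in in_keys_iff)
      qed
      have "\<exists>S \<subseteq> keys m1. violating a (b - 1) C N S"
      proof (rule less.hyps[OF dec, of g])
        fix z :: "nat \<times> nat \<Rightarrow> 'f" assume z: "z \<in> rank_variety a (b - 1) C N"
        show "mpoly_eval h z g = 0"
        \<comment> \<open>Here \<open>f\<close> does not involve \<open>y\<close>. If all relevant
          blocks have dropped rank, the limit argument applies with exponent 0; otherwise
          \<open>y\<close> can be given a suitable value, which \<open>f\<close> does not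
          see.\<close>
        proof (cases "\<forall>p q r. (p, q, r) \<in> C \<longrightarrow> a \<le> p \<longrightarrow> b \<le> q \<longrightarrow>
            1 \<le> r \<and> rank_le {a<..p} {1..b - 1} (r - 1) z")
          case True
          then show ?thesis unfolding g_def
            by (intro coeff_in_vanishes_on_rank_variety[OF h inf D van z _ N]) (use 3 in auto)
        next
          case False
          then obtain t where t: "z(?y := t) \<in> rank_variety a b C N"
            using extend_in_rank_variety[OF z] 3 by blast
          have "pprod_eval z m = pprod_eval (z(?y := t)) m" if "m \<in> keys f" for m
            by (rule pprod_eval_cong) (use y0[OF that] in \<open>auto simp: in_keys_iff\<close>)
          then have "mpoly_eval h z f = mpoly_eval h (z(?y := t)) f"
            by (simp add: mpoly_eval_def)
          then show ?thesis using van[OF t] gf by simp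
        qed
      next
        show "b - 1 \<le> q" if "(p, q, r) \<in> N" for p q r using N[OF that] by simp
      qed (use suppg m1g leadg bn qn in auto)
      then show ?thesis using mono m10 by blast
    next
      case False
      then have ym0: "?y \<in> keys m0" by (auto simp: d_def in_keys_iff)
      show ?thesis
      proof (cases "\<exists>p q. (p, q, 0) \<in> C \<and> a \<le> p \<and> b \<le> q")
        case True
        then obtain p q where "(p, q, 0) \<in> C" "a \<le> p" "b \<le> q" by blast
        then have "violating a b C N {?y}"
          unfolding violating_def antidiagonal_def using 3
          by (intro conjI disjI2 bexI[of _ "(p, q, 0)"]) auto
        then show ?thesis using ym0 by blast
      next
        case rpos: False
        \<comment> \<open>Every block containing \<open>y\<close> passes on a bound smaller by one
          to its part strictly southwest of \<open>y\<close>. The last column is exactly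
          \<open>b - 1\<close>, as the next stage requires of its second family.\<close>
        define N' where "N' = {(p, b - 1, r - 1) | p q r. (p, q, r) \<in> C \<and> a \<le> p \<and> b \<le> q}"
        have "\<exists>S \<subseteq> keys m1. violating a (b - 1) C (N \<union> N') S"
        proof (rule less.hyps[OF dec, of g])
          fix z :: "nat \<times> nat \<Rightarrow> 'f" assume z: "z \<in> rank_variety a (b - 1) C (N \<union> N')"
          have z': "z \<in> rank_variety a (b - 1) C N"
            using z unfolding rank_variety_def by blast
          have "1 \<le> r \<and> rank_le {a<..p} {1..b - 1} (r - 1) z"
            if "(p, q, r) \<in> C" "a \<le> p" "b \<le> q" for p q r
          proof
            show "1 \<le> r" using rpos that by (cases r) auto
            have "(p, b - 1, r - 1) \<in> N'" using that by (auto simp: N'_def)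
            then show "rank_le {a<..p} {1..b - 1} (r - 1) z"
              using z unfolding rank_variety_def by blast
          qed
          then show "mpoly_eval h z g = 0" unfolding g_def
            by (intro coeff_in_vanishes_on_rank_variety[OF h inf D van z' _ N]) (use 3 in auto)
        next
          show "b - 1 \<le> q" if "(p, q, r) \<in> N \<union> N'" for p q r
            using N that by (fastforce simp: N'_def)
          show "q \<le> n" if "(p, q, r) \<in> C \<union> (N \<union> N')" for p q r
            using qn that bn by (fastforce simp: N'_def)
        qed (use suppg m1g leadg bn in auto)
        then obtain S where S: "S \<subseteq> keys m1" "violating a (b - 1) C (N \<union> N') S" by blast
        show ?thesis
        proof (cases "violating a (b - 1) C N S")
          case True
          then show ?thesis using mono S(1) m10 by blast
        next
          \<comment> \<open>Only a new condition is violated, so \<open>S\<close> has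
            \<open>r\<close> elements strictly southwest of \<open>y\<close>; together with
            \<open>y\<close> it violates the condition it came from.\<close>
          case False
          have "antidiagonal S" using S(2) by (simp add: violating_def)
          then obtain t where t: "t \<in> N'"
            "case t of (p, q, r) \<Rightarrow> S \<subseteq> {a<..p} \<times> {1..q} \<and> card S = Suc r"
            using S(2) False unfolding violating_def by blast
          then obtain p q r where pqr: "(p, q, r) \<in> C" "a \<le> p" "b \<le> q"
            and S': "S \<subseteq> {a<..p} \<times> {1..b - 1}" "card S = Suc (r - 1)"
            unfolding N'_def by auto
          have "1 \<le> r" using rpos pqr by (cases r) auto
          have "finite S" by (rule finite_subset[OF S'(1)]) simp
          have S'': "a < fst u \<and> snd u < b" if "u \<in> S" for u
            using subsetD[OF S'(1) that] 3 by auto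
          then have "?y \<notin> S" by fastforce
          then have card: "card (insert ?y S) = Suc r"
            using S'(2) \<open>finite S\<close> \<open>1 \<le> r\<close> by simp
          have "{a<..p} \<times> {1..b - 1} \<subseteq> {a..p} \<times> {1..min q b}"
            using pqr 3 by (intro Sigma_mono) auto
          then have "insert ?y S \<subseteq> {a..p} \<times> {1..min q b}"
            using S'(1) pqr 3 by auto
          then have "violating a b C N (insert ?y S)"
            unfolding violating_def using antidiagonal_insert[OF \<open>antidiagonal S\<close> S''] pqr(1) card by blast
          then show ?thesis using S(1) m10 ym0 by blast
        qed
      qed
    qed
  qed
qed

section \<open>Bad antidiagonals of a vexillary permutation\<close>

definition dots :: "(nat \<Rightarrow> nat) \<Rightarrow> nat \<Rightarrow> nat \<Rightarrow> nat set" where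
  "dots w p q = {i \<in> {1..p}. w i \<le> q}"

definition dot_count :: "(nat \<Rightarrow> nat) \<Rightarrow> nat \<Rightarrow> nat \<Rightarrow> nat" where
  "dot_count w p q = card (dots w p q)"

definition bad :: "nat \<Rightarrow> (nat \<Rightarrow> nat) \<Rightarrow> (nat \<times> nat) set \<Rightarrow> bool" where
  "bad n w S \<longleftrightarrow> antidiagonal S \<and>
     (\<exists>p\<in>{1..n}. \<exists>q\<in>{1..n}. S \<subseteq> {1..p} \<times> {1..q} \<and> dot_count w p q < card S)"

text \<open>For vexillary \<open>w\<close> these are the supports of the leading power products of a
  reduced Groebner basis; see \<open>reduced_groebner_basis_schubert_lpp\<close> and
  \<open>minimal_bad_is_lpp\<close>.\<close>

definition minimal_bad :: "nat \<Rightarrow> (nat \<Rightarrow> nat) \<Rightarrow> (nat \<times> nat) set \<Rightarrow> bool" where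
  "minimal_bad n w S \<longleftrightarrow> bad n w S \<and> (\<forall>T. T \<subset> S \<longrightarrow> \<not> bad n w T)"

text \<open>The northeast end of an antidiagonal, hence its greatest variable; by
  \<open>lv_eq_top\<close> it is the leading variable of every polynomial led by
  \<open>S\<close>.\<close>

definition top_of :: "(nat \<times> nat) set \<Rightarrow> nat \<times> nat \<Rightarrow> bool" where
  "top_of S y \<longleftrightarrow> y \<in> S \<and> (\<forall>u\<in>S - {y}. fst y < fst u \<and> snd u < snd y)"

text \<open>The lexicographic order on squarefree monomials, in terms of their supports.\<close>

definition set_less :: "(nat \<times> nat) set \<Rightarrow> (nat \<times> nat) set \<Rightarrow> bool" where
  "set_less S T \<longleftrightarrow> (\<exists>v\<in>T - S. \<forall>u. new_less v u \<longrightarrow> (u \<in> S \<longleftrightarrow> u \<in> T))"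

lemma set_less_asym: "set_less S T \<Longrightarrow> \<not> set_less T S"
proof
  assume "set_less S T" "set_less T S"
  then obtain v v' where v: "v \<in> T" "v \<notin> S" "\<And>u. new_less v u \<Longrightarrow> u \<in> S \<longleftrightarrow> u \<in> T"
    and v': "v' \<in> S" "v' \<notin> T" "\<And>u. new_less v' u \<Longrightarrow> u \<in> T \<longleftrightarrow> u \<in> S"
    unfolding set_less_def by blast
  have "new_less v v' \<or> new_less v' v \<or> v = v'"
    unfolding new_less_def by (auto simp: prod_eq_iff)
  then show False using v v' by blast
qed

section \<open>Antidiagonals and transversals\<close>

lemma antidiagonal_inj:
  assumes "antidiagonal S"
  shows "inj_on fst S" "inj_on snd S"
  using assms unfolding antidiagonal_def inj_on_def by (metis less_irrefl)+

lemma antidiagonal_le_iff: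
  assumes "antidiagonal S" "u \<in> S" "v \<in> S"
  shows "fst u \<le> fst v \<longleftrightarrow> snd v \<le> snd u"
  using assms unfolding antidiagonal_def by (metis leD le_cases nless_le)

lemma antidiagonal_exists_top:
  assumes "antidiagonal S" "finite S" "S \<noteq> {}"
  shows "\<exists>y. top_of S y"
proof -
  obtain y where "y \<in> S" "\<And>u. u \<in> S \<Longrightarrow> fst y \<le> fst u"
    using ex_min_if_finite[of "fst ` S"] assms(2,3) by (auto simp: not_less)
  then show ?thesis
    using assms(1) unfolding top_of_def antidiagonal_def by (metis DiffE insertI1 leD)
qed

lemma antidiagonal_exists:
  fixes R C :: "nat set"
  assumes "finite R" "finite C" "card R = card C"
  shows "\<exists>T. antidiagonal T \<and> fst ` T = R \<and> snd ` T = C"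
  using assms
proof (induction "card R" arbitrary: R C)
  case 0
  then show ?case by (intro exI[of _ "{}"]) (simp add: antidiagonal_def)
next
  case (Suc k)
  let ?i = "Min R" and ?j = "Max C"
  have ne: "R \<noteq> {}" "C \<noteq> {}" using Suc.hyps(2) Suc.prems by auto
  have i: "?i \<in> R" "?j \<in> C" using ne Suc.prems by simp_all
  then have "k = card (R - {?i})" "card (R - {?i}) = card (C - {?j})"
    using Suc.hyps(2) Suc.prems by simp_all
  then obtain T where T: "antidiagonal T" "fst ` T = R - {?i}" "snd ` T = C - {?j}"
    using Suc.hyps(1)[of "R - {?i}" "C - {?j}"] Suc.prems by blast
  have "?i < fst u \<and> snd u < ?j" if "u \<in> T" for u
  proof -
    have "fst u \<in> R - {?i}" "snd u \<in> C - {?j}" using T that by blast+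
    moreover from this have "?i \<le> fst u" "snd u \<le> ?j" using Suc.prems by simp_all
    ultimately show ?thesis by (auto simp: less_le)
  qed
  then have "antidiagonal (insert (?i, ?j) T)"
    by (intro antidiagonal_insert T(1)) auto
  moreover have "fst ` insert (?i, ?j) T = R" "snd ` insert (?i, ?j) T = C"
    using T i by auto
  ultimately show ?case by blast
qed

text \<open>The supports of the terms in the Leibniz expansion of the minor on the rows and columns
  of \<open>S\<close>.\<close>

definition transversal :: "(nat \<times> nat) set \<Rightarrow> (nat \<times> nat) set \<Rightarrow> bool" where
  "transversal S T \<longleftrightarrow> finite T \<and> inj_on fst T \<and> inj_on snd T \<and> fst ` T = fst ` S \<and> snd ` T = snd ` S"

text \<open>Take the topmost \<open>v\<close> in \<open>S - T\<close>. An element of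
  \<open>T\<close> greater than \<open>v\<close> lies in a higher row, or in the row of
  \<open>v\<close> further east; its row or its column is then already used by an element of
  \<open>S\<close> above \<open>v\<close>, which belongs to \<open>T\<close>, and injectivity
  identifies the two.\<close>

lemma set_less_antidiagonal:
  assumes S: "antidiagonal S" and trans: "transversal S T" and ne: "T \<noteq> S" and "finite S"
  shows "set_less T S"
proof -
  have T: "inj_on fst T" "inj_on snd T" "fst ` T = fst ` S" "snd ` T = snd ` S"
    and "finite T"
    using trans by (simp_all add: transversal_def)
  have "card T = card S"
    using card_image[OF T(1)] card_image[OF antidiagonal_inj(1)[OF S]] T(3) by simp
  have "S - T \<noteq> {}"
  proof
    assume "S - T = {}"
    then have "S = T" using card_subset_eq[OF \<open>finite T\<close>, of S] \<open>card T = card S\<close> by simp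
    then show False using ne by simp
  qed
  then obtain v where "top_of (S - T) v"
    using antidiagonal_exists_top[OF antidiagonal_subset[OF S], of "S - T"] \<open>finite S\<close> by auto
  then have v: "v \<in> S" "v \<notin> T" and vmin: "\<And>u. u \<in> S \<Longrightarrow> u \<notin> T \<Longrightarrow> u \<noteq> v \<Longrightarrow> fst v < fst u"
    unfolding top_of_def by blast+
  have sub: "u \<in> T" if "u \<in> S" "fst u < fst v \<or> snd v < snd u" for u
  proof (rule ccontr)
    assume "u \<notin> T"
    moreover have "u \<noteq> v" using that(2) by auto
    ultimately have "fst v < fst u" using vmin that(1) by simp
    then show False
      using that antidiagonal_le_iff[OF S that(1) v(1)] by simp
  qed
  have "u \<in> T \<longleftrightarrow> u \<in> S" if "new_less v u" for u
  proof
    assume uT: "u \<in> T"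
    have "fst u \<in> fst ` S" "snd u \<in> snd ` S" 
      using imageI[OF uT, of fst] imageI[OF uT, of snd] T(3,4) by simp_all
    then obtain s s' where s: "s \<in> S" "fst s = fst u" and s': "s' \<in> S" "snd s' = snd u"
      by (metis imageE)
    show "u \<in> S"
    proof (cases "fst u < fst v")
      case True
      then have "s \<in> T" using sub s by simp
      then have "s = u" using inj_onD[OF T(1) s(2)] uT by simp
      then show ?thesis using s by simp
    next
      case False
      then have "snd v < snd s'" using that s' by (auto simp: new_less_def)
      then have "s' \<in> T" using sub s' by simp
      then have "s' = u" using inj_onD[OF T(2) s'(2)] uT by simp
      then show ?thesis using s' by simp
    qed
  next
    assume "u \<in> S"
    then show "u \<in> T" using sub[of u] that by (auto simp: new_less_def)
  qed
  then have "\<forall>u. new_less v u \<longrightarrow> (u \<in> T \<longleftrightarrow> u \<in> S)" by simp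
  then show ?thesis using v unfolding set_less_def by blast
qed

section \<open>Dot counts and bounding blocks\<close>

lemma dots_finite [simp]: "finite (dots w p q)"
  by (simp add: dots_def)

lemma dots_mono: "p \<le> p' \<Longrightarrow> q \<le> q' \<Longrightarrow> dots w p q \<subseteq> dots w p' q'"
  by (auto simp: dots_def)

lemma dot_count_mono: "p \<le> p' \<Longrightarrow> q \<le> q' \<Longrightarrow> dot_count w p q \<le> dot_count w p' q'"
  unfolding dot_count_def by (intro card_mono dots_mono) simp_all

lemma bad_finite: "bad n w S \<Longrightarrow> finite S"
  unfolding bad_def by (metis finite_SigmaI finite_atLeastAtMost finite_subset)

lemma bad_nonempty: "bad n w S \<Longrightarrow> S \<noteq> {}"
  unfolding bad_def by auto

lemma bad_contains_minimal_bad: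
  assumes "bad n w S"
  shows "\<exists>T \<subseteq> S. minimal_bad n w T"
proof -
  have "finite S" using assms by (rule bad_finite)
  then show ?thesis using assms
  proof (induction S rule: finite_psubset_induct)
    case (psubset S)
    show ?case
    proof (cases "minimal_bad n w S")
      case False
      then obtain T where "T \<subset> S" "bad n w T" using psubset unfolding minimal_bad_def by blast
      then show ?thesis using psubset.IH[of T] by blast
    qed blast
  qed
qed

lemma bad_exists_top: "bad n w S \<Longrightarrow> \<exists>y. top_of S y"
  by (rule antidiagonal_exists_top) (simp_all add: bad_finite bad_nonempty, simp add: bad_def)

text \<open>Shrinking a witnessing block to the bounding block of \<open>S\<close> can only lower
  the dot count.\<close>

lemma bad_bounding:
  assumes "bad n w S" "i = Max (fst ` S)" "j = Max (snd ` S)"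
  shows "i \<in> {1..n}" "j \<in> {1..n}" "S \<subseteq> {1..i} \<times> {1..j}" "dot_count w i j < card S"
    "i \<in> fst ` S" "j \<in> snd ` S"
proof -
  obtain p q where pq: "p \<in> {1..n}" "q \<in> {1..n}" "S \<subseteq> {1..p} \<times> {1..q}" "dot_count w p q < card S"
    using assms unfolding bad_def by blast
  have fin: "finite S" "S \<noteq> {}" using bad_finite bad_nonempty assms by blast+
  show i: "i \<in> fst ` S" and j: "j \<in> snd ` S" using fin assms(2,3) by simp_all
  have "i \<in> {1..p}" "j \<in> {1..q}" using pq(3) i j by auto
  then show "i \<in> {1..n}" "j \<in> {1..n}" using pq by auto
  show "S \<subseteq> {1..i} \<times> {1..j}"
  proof
    fix u assume u: "u \<in> S"
    then have "fst u \<le> i" "snd u \<le> j" using fin assms by simp_all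
    then show "u \<in> {1..i} \<times> {1..j}" using u pq(3) by (cases u) auto
  qed
  have "dot_count w i j \<le> dot_count w p q"
    using \<open>i \<in> {1..p}\<close> \<open>j \<in> {1..q}\<close> by (intro dot_count_mono) auto
  then show "dot_count w i j < card S" using pq by simp
qed

section \<open>Dots in the bounding block of a minimal bad antidiagonal\<close>

text \<open>The top also gives the last column, so the bounding block of \<open>S\<close> is
  \<open>p\<close> by \<open>b\<close>.\<close>

locale minimal_bad_antidiagonal =
  fixes n :: nat and w :: "nat \<Rightarrow> nat" and S :: "(nat \<times> nat) set" and a b p :: nat
  assumes perm: "w permutes {1..n}" and vex: "vexillary n w"
    and min: "minimal_bad n w S" and top: "top_of S (a, b)"
    and p: "p = Max (fst ` S)"
begin

abbreviation "S' \<equiv> S - {(a, b)}"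

lemma bad_S: "bad n w S" and not_bad_subset: "T \<subset> S \<Longrightarrow> \<not> bad n w T"
  using min unfolding minimal_bad_def by auto

lemma antidiagonal_S: "antidiagonal S"
  using bad_S unfolding bad_def by blast

lemma finite_S [simp]: "finite S"
  using bad_S by (rule bad_finite)

lemma top_in: "(a, b) \<in> S"
  using top unfolding top_of_def by blast

lemma below_top: "u \<in> S' \<Longrightarrow> a < fst u \<and> snd u < b"
  using top unfolding top_of_def by auto

lemma b_max: "b = Max (snd ` S)"
proof (rule sym, rule Max_eqI)
  show "v \<le> b" if "v \<in> snd ` S" for v
    using that below_top by fastforce
  show "b \<in> snd ` S" using top_in by force
qed simp

lemma bounds: "p \<in> {1..n}" "b \<in> {1..n}" "S \<subseteq> {1..p} \<times> {1..b}" "dot_count w p b < card S"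
    "p \<in> fst ` S"
  using bad_bounding[OF bad_S p b_max] by auto

lemma card_proper_subset:
  assumes "T \<subset> S" "T \<subseteq> {1..i} \<times> {1..j}" "i \<in> {1..n}" "j \<in> {1..n}"
  shows "card T \<le> dot_count w i j"
proof (rule ccontr)
  assume "\<not> ?thesis"
  moreover have "antidiagonal T"
    using antidiagonal_subset[OF antidiagonal_S] assms(1) by simp
  ultimately have "bad n w T"
    unfolding bad_def using assms by (intro conjI bexI[of _ i] bexI[of _ j]) simp_all
  then show False using not_bad_subset[OF assms(1)] by simp
qed

text \<open>Minimality leaves no slack: \<open>S\<close> exceeds the dot count, while
  \<open>S\<close> without its top does not.\<close>

lemma card_S': "card S' = dot_count w p b"
proof -
  have "card S' \<le> dot_count w p b"
    using bounds top_in by (intro card_proper_subset) auto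
  then show ?thesis using bounds(4) top_in by simp
qed

lemma card_S: "card S = Suc (dot_count w p b)"
  unfolding card.remove[OF finite_S top_in] card_S' ..

text \<open>If the dot of row \<open>p\<close> were in the block, dropping that row would lower both
  the dot count and the size of \<open>S\<close> by one, and a proper subset of \<open>S\<close>
  would be bad.\<close>

lemma row_p: "b < w p"
proof (rule ccontr)
  assume "\<not> b < w p"
  then have "dots w p b = insert p (dots w (p - 1) b)"
    using bounds(1) by (auto simp: dots_def le_less)
  moreover have "p \<notin> dots w (p - 1) b" using bounds(1) by (auto simp: dots_def)
  ultimately have dc: "dot_count w p b = Suc (dot_count w (p - 1) b)"
    by (simp add: dot_count_def)
  obtain u where u: "u \<in> S" "fst u = p" using bounds(5) by blast
  have T: "S - {u} \<subseteq> {1..p - 1} \<times> {1..b}"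
  proof
    fix v assume v: "v \<in> S - {u}"
    then have "fst v \<noteq> p" using antidiagonal_inj(1)[OF antidiagonal_S] u by (metis DiffE inj_onD singletonI)
    moreover have "v \<in> {1..p} \<times> {1..b}" using bounds(3) v by blast
    ultimately show "v \<in> {1..p - 1} \<times> {1..b}" by (cases v) auto
  qed
  have "card (S - {u}) = Suc (dot_count w (p - 1) b)" using card_S dc u by simp
  then have "S - {u} \<noteq> {}" by (metis card.empty nat.distinct(1))
  then have "p - 1 \<in> {1..n}" using T bounds(1) by auto
  then have "card (S - {u}) \<le> dot_count w (p - 1) b"
    using T u bounds(2) by (intro card_proper_subset) auto
  then show False using card_S dc u by simp
qed

text \<open>The same deletion argument for the last column, whose only element of \<open>S\<close>
  is the top.\<close>

lemma col_b:
  assumes "i \<in> {1..p}"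
  shows "w i \<noteq> b"
proof
  assume wi: "w i = b"
  have "w x = b \<longleftrightarrow> x = i" for x
    using wi permutes_inj[OF perm] by (metis injD)
  moreover have "w x \<le> b \<longleftrightarrow> w x = b \<or> w x \<le> b - 1" for x
    using bounds(2) by auto
  ultimately have "dots w p b = insert i (dots w p (b - 1))"
    using assms by (auto simp: dots_def)
  moreover have "i \<notin> dots w p (b - 1)" using wi bounds(2) by (auto simp: dots_def)
  ultimately have dc: "dot_count w p b = Suc (dot_count w p (b - 1))"
    by (simp add: dot_count_def)
  have T: "S' \<subseteq> {1..p} \<times> {1..b - 1}"
  proof
    fix v assume v: "v \<in> S'"
    then show "v \<in> {1..p} \<times> {1..b - 1}"
      using below_top[OF v] bounds(3) by (cases v) auto
  qed
  have "S' \<noteq> {}" using card_S' dc by (metis card.empty nat.distinct(1))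
  then have "b - 1 \<in> {1..n}" using T bounds(2) by auto
  then have "card S' \<le> dot_count w p (b - 1)"
    using T top_in bounds(1) by (intro card_proper_subset) auto
  then show False using card_S' dc by simp
qed

text \<open>The dot of row \<open>p\<close> lies east of the block and the dot of column \<open>b\<close> lies south of it, so an
  inversion inside the block would complete a pattern 2143.\<close>

lemma increasing:
  assumes "i < j" "i \<in> dots w p b" "j \<in> dots w p b"
  shows "w i < w j"
proof (rule ccontr)
  assume "\<not> w i < w j"
  moreover have "w i \<noteq> w j" using assms(1) permutes_inj[OF perm] by (metis injD less_irrefl)
  ultimately have "w j < w i" by simp
  have "w j \<le> b" "w i \<le> b" "i \<in> {1..p}" "j \<in> {1..p}" using assms by (auto simp: dots_def)
  have "j \<noteq> p" using row_p \<open>w j \<le> b\<close> by auto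
  have "w i < b" using col_b[OF \<open>i \<in> {1..p}\<close>] \<open>w i \<le> b\<close> by simp
  obtain l where l: "l \<in> {1..n}" "w l = b"
    using permutes_image[OF perm] bounds(2) by (metis imageE)
  have "p < l" using col_b[of l] l by fastforce
  then have "1 \<le> i \<and> i < j \<and> j < p \<and> p < l \<and> l \<le> n \<and> w j < w i \<and> w i < w l \<and> w l < w p"
    using \<open>i < j\<close> \<open>i \<in> {1..p}\<close> \<open>j \<in> {1..p}\<close> \<open>j \<noteq> p\<close> l \<open>w j < w i\<close> \<open>w i < b\<close> row_p by auto
  then show False using vex unfolding vexillary_def by blast
qed

text \<open>If both equalities failed, one dot would be cut off only by the column bound and another
  only by the row bound; these two dots would form an inversion in the block.\<close>

lemma dot_count_cases:
  assumes "i \<le> p" "j \<le> b"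
  shows "dot_count w i j = dot_count w i b \<or> dot_count w i j = dot_count w p j"
proof (rule ccontr)
  assume "\<not> ?thesis"
  then have "dots w i j \<noteq> dots w i b" "dots w i j \<noteq> dots w p j"
    by (auto simp: dot_count_def)
  moreover have "dots w i j \<subseteq> dots w i b" "dots w i j \<subseteq> dots w p j"
    using assms by (auto simp: dots_def)
  ultimately obtain x x' where x: "x \<in> dots w i b" "x \<notin> dots w i j"
    and x': "x' \<in> dots w p j" "x' \<notin> dots w i j"
    by blast
  then have "x < x'" "x \<in> dots w p b" "x' \<in> dots w p b" "w x' < w x"
    using assms by (auto simp: dots_def)
  then show False using increasing by fastforce
qed

lemma card_rows:
  assumes "i \<in> {1..n}" "i < p"
  shows "card {r \<in> fst ` S. r \<le> i} \<le> dot_count w i b"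
proof -
  let ?T = "{u \<in> S. fst u \<le> i}"
  have "{r \<in> fst ` S. r \<le> i} = fst ` ?T" by auto
  then have "card {r \<in> fst ` S. r \<le> i} \<le> card ?T" by (simp add: card_image_le)
  also have "\<dots> \<le> dot_count w i b"
  proof (rule card_proper_subset)
    obtain u where "u \<in> S" "fst u = p" using bounds(5) by blast
    then have "u \<in> S - ?T" using assms by simp
    then show "?T \<subset> S" by blast
    show "?T \<subseteq> {1..i} \<times> {1..b}" using bounds(3) by auto
  qed (use assms bounds in auto)
  finally show ?thesis .
qed

text \<open>Without the top the subset stays proper for every \<open>j\<close>, even when no column
  is cut off.\<close>

lemma card_cols:
  assumes "j \<in> {1..n}"
  shows "card {c \<in> snd ` S'. c \<le> j} \<le> dot_count w p j"
proof -
  let ?T = "{u \<in> S'. snd u \<le> j}"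
  have "{c \<in> snd ` S'. c \<le> j} = snd ` ?T" by auto
  then have "card {c \<in> snd ` S'. c \<le> j} \<le> card ?T" by (simp add: card_image_le)
  also have "\<dots> \<le> dot_count w p j"
  proof (rule card_proper_subset)
    show "?T \<subset> S" using top_in by auto
    show "?T \<subseteq> {1..p} \<times> {1..j}" using bounds(3) by auto
  qed (use assms bounds in auto)
  finally show ?thesis .
qed

lemma rows_S': "fst ` S' = fst ` S - {a}" "a \<in> fst ` S"
  using inj_on_image_set_diff[OF antidiagonal_inj(1)[OF antidiagonal_S], of S "{(a, b)}"]
    imageI[OF top_in, of fst] top_in by simp_all

lemma cols_S': "snd ` S' = snd ` S - {b}" "b \<in> snd ` S"
  using inj_on_image_set_diff[OF antidiagonal_inj(2)[OF antidiagonal_S], of S "{(a, b)}"]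
    imageI[OF top_in, of snd] top_in by simp_all

lemma card_rows_S': "card (fst ` S') = dot_count w p b"
  using card_S' card_image[OF inj_on_subset[OF antidiagonal_inj(1)[OF antidiagonal_S]], of S'] by simp

text \<open>By \<open>dot_count_cases\<close> the dot count in the bounding block of
  \<open>B\<close> is governed by rows alone or by columns alone. The rows are bounded through
  minimality of \<open>S\<close>, the columns by assumption.\<close>

lemma not_bad_below_top:
  assumes rows: "fst ` B \<subseteq> fst ` S'" and cols: "\<And>u. u \<in> B \<Longrightarrow> snd u \<le> b"
    and col_count: "\<And>j. j \<in> {1..n} \<Longrightarrow> card {c \<in> snd ` B. c \<le> j} \<le> dot_count w p j"
  shows "\<not> bad n w B"
proof
  assume bad: "bad n w B"
  define i j where "i = Max (fst ` B)" and "j = Max (snd ` B)"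
  note B = bad_bounding[OF bad i_def j_def]
  have inj: "inj_on fst B" "inj_on snd B"
    using antidiagonal_inj[of B] bad by (simp_all add: bad_def)
  have Bi: "r \<le> i" if "r \<in> fst ` B" for r using B(3) that by auto
  have Bj: "c \<le> j" if "c \<in> snd ` B" for c using B(3) that by auto
  have rows': "fst ` S' \<subseteq> fst ` S" by (rule image_mono) simp
  have "i \<in> fst ` S" using subsetD[OF rows B(5)] rows' by (rule rev_subsetD)
  then have "i \<le> p" using bounds(3) by auto
  moreover have "j \<le> b" using B(6) cols by fastforce
  ultimately consider "dot_count w i j = dot_count w i b" | "dot_count w i j = dot_count w p j"
    using dot_count_cases by blast
  then show False
  proof cases
    case 1
    have cardB: "card B \<le> card {r \<in> fst ` S'. r \<le> i}"
    proof -
      have "card B = card (fst ` B)" using inj by (simp add: card_image)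
      also have "\<dots> \<le> card {r \<in> fst ` S'. r \<le> i}"
        using subsetD[OF rows] Bi by (intro card_mono subsetI CollectI conjI) simp_all
      finally show ?thesis .
    qed
    show False
    \<comment> \<open>The bound \<open>card_rows\<close> needs \<open>i < p\<close>; for
      \<open>i = p\<close> the total number of rows of \<open>S'\<close> is small enough.\<close>
    proof (cases "i = p")
      case True
      have "card {r \<in> fst ` S'. r \<le> i} \<le> card (fst ` S')"
        by (intro card_mono Collect_subset) simp
      then show False using cardB B(4) 1 True card_rows_S' by simp
    next
      case False
      have "card {r \<in> fst ` S'. r \<le> i} \<le> card {r \<in> fst ` S. r \<le> i}"
        using subsetD[OF rows'] by (intro card_mono Collect_mono conj_mono impI) simp_all
      also have "\<dots> \<le> dot_count w i b"
        using False \<open>i \<le> p\<close> B(1) by (intro card_rows) auto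
      finally show False using cardB B(4) 1 by simp
    qed
  next
    case 2
    have "{c \<in> snd ` B. c \<le> j} = snd ` B" using Bj by blast
    then have "card B \<le> dot_count w p j"
      using col_count[OF B(2)] inj by (simp add: card_image)
    then show False using B(4) 2 by simp
  qed
qed

text \<open>This makes the terms of the minor that contain the top irreducible, apart from its
  leading term. A bad subset must contain the top by \<open>not_bad_below_top\<close>; its block
  then has last column \<open>b\<close>, and counting rows forces it to be all of
  \<open>T\<close>.\<close>

lemma transversal_bad:
  assumes trans: "transversal S T" and yT: "(a, b) \<in> T" and B: "B \<subseteq> T" "bad n w B"
  shows "T = S"
proof -
  have T: "inj_on fst T" "inj_on snd T" "fst ` T = fst ` S" "snd ` T = snd ` S"
    and finT: "finite T"
    using trans by (simp_all add: transversal_def)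
  show ?thesis
  proof (cases "(a, b) \<in> B")
    case False
    have B': "fst u \<in> fst ` S' \<and> snd u \<in> snd ` S'" if "u \<in> B" for u
    proof -
      have u: "u \<in> T" "u \<noteq> (a, b)" using that B False by auto
      then have "fst u \<noteq> a" "snd u \<noteq> b"
        using inj_onD[OF T(1) _ u(1) yT] inj_onD[OF T(2) _ u(1) yT] by auto
      then show ?thesis
        using imageI[OF u(1), of fst] imageI[OF u(1), of snd] T(3,4) rows_S' cols_S' by simp
    qed
    have "\<not> bad n w B"
    proof (rule not_bad_below_top)
      show "fst ` B \<subseteq> fst ` S'" using B' by (simp add: image_subset_iff)
      show "snd u \<le> b" if u: "u \<in> B" for u
      proof -
        obtain v where "v \<in> S'" "snd u = snd v" using B'[OF u] by (metis imageE)
        then show ?thesis using below_top[of v] by simp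
      qed
      fix j assume j: "j \<in> {1..n}"
      have "card {c \<in> snd ` B. c \<le> j} \<le> card {c \<in> snd ` S'. c \<le> j}"
        using B' by (intro card_mono finite_subset[OF _ finite_imageI[of S' snd]] subsetI)
          (simp_all, blast+)
      then show "card {c \<in> snd ` B. c \<le> j} \<le> dot_count w p j"
        using card_cols[OF j] by simp
    qed
    then show ?thesis using B by blast
  next
    case True
    define i j where "i = Max (fst ` B)" and "j = Max (snd ` B)"
    note Bb = bad_bounding[OF B(2) i_def j_def]
    have inj: "inj_on fst B" using T(1) B(1) by (rule inj_on_subset)
    have "snd u \<le> b" if "u \<in> B" for u
    proof -
      have "snd u \<in> snd ` S" using imageI[OF subsetD[OF B(1) that], of snd] T(4) by simp
      then show ?thesis using bounds(3) by auto
    qed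
    then have "j \<le> b" using Bb(6) by blast
    moreover have "b \<le> j" using Bb(3) True by auto
    ultimately have j: "j = b" by simp
    have Bi: "r \<le> i" if "r \<in> fst ` B" for r using Bb(3) that by auto
    have rows: "fst ` B \<subseteq> fst ` S" using image_mono[OF B(1), of fst] T(3) by simp
    then have "i \<in> fst ` S" using Bb(5) by (rule subsetD)
    then have "i \<le> p" using bounds(3) by auto
    have "card B = card (fst ` B)" using inj by (simp add: card_image)
    also have "\<dots> \<le> card {r \<in> fst ` S. r \<le> i}"
      using subsetD[OF rows] Bi by (intro card_mono subsetI CollectI conjI) simp_all
    finally have "i = p"
      using card_rows[of i] Bb \<open>i \<le> p\<close> j by (cases "i = p") auto
    then have "card S \<le> card B" using Bb(4) j card_S by simp
    moreover have "card T = card S"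
      using card_image[OF T(1)] card_image[OF antidiagonal_inj(1)[OF antidiagonal_S]] T(3) by simp
    ultimately have "B = T" using card_seteq[OF finT B(1)] by simp
    then have "antidiagonal T" using B unfolding bad_def by blast
    show ?thesis
    proof (rule ccontr)
      assume "T \<noteq> S"
      \<comment> \<open>Two distinct antidiagonals with the same rows and columns would each be
        greater than the other.\<close>
      have "transversal T S"
        unfolding transversal_def using antidiagonal_inj[OF antidiagonal_S] T(3,4) by simp
      then have "set_less S T"
        using \<open>T \<noteq> S\<close> by (intro set_less_antidiagonal[OF \<open>antidiagonal T\<close>] finT) simp_all
      moreover have "set_less T S"
        by (rule set_less_antidiagonal[OF antidiagonal_S trans \<open>T \<noteq> S\<close> finite_S])
      ultimately show False using set_less_asym by blast
    qed
  qed
qed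

end

section \<open>The lexicographically least bad antidiagonal with a given top\<close>

locale lex_min_bad_antidiagonal = minimal_bad_antidiagonal +
  assumes lex_min: "\<And>T. minimal_bad n w T \<Longrightarrow> top_of T (a, b) \<Longrightarrow> T \<noteq> S \<Longrightarrow> set_less S T"
begin

lemma inj_w: "inj w"
  using perm by (rule permutes_inj)

lemma card_dot_cols: "j \<le> b \<Longrightarrow> card {c \<in> w ` dots w p b. c \<le> j} = dot_count w p j"
proof -
  assume "j \<le> b"
  then have "{c \<in> w ` dots w p b. c \<le> j} = w ` dots w p j"
    by (auto simp: dots_def)
  then show ?thesis
    using card_image[OF inj_on_subset[OF inj_w]] by (simp add: dot_count_def)
qed

text \<open>Moving the lower part of \<open>S\<close> to the columns of the dots inside the block keeps the rows, makes
  the monomial lexicographically smaller and creates no new bad antidiagonal below the top. So the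
  minimality of \<open>S\<close> forces its lower part to occupy exactly these columns.\<close>

lemma cols_S'_eq: "snd ` S' = w ` dots w p b"
proof -
  let ?C = "w ` dots w p b"
  have "card ?C = dot_count w p b"
    using card_image[OF inj_on_subset[OF inj_w]] by (simp add: dot_count_def)
  then obtain T where T: "antidiagonal T" "fst ` T = fst ` S'" "snd ` T = ?C"
    using antidiagonal_exists[of "fst ` S'" ?C] card_rows_S' by auto
  have injT: "inj_on fst T" "inj_on snd T" using antidiagonal_inj[OF T(1)] .
  have "finite (fst ` T)" using T(2) by simp
  then have finT: "finite T" using injT(1) by (rule finite_imageD)
  have Cb: "1 \<le> c \<and> c < b" if "c \<in> ?C" for c
  proof -
    obtain x where x: "x \<in> dots w p b" "c = w x" using \<open>c \<in> ?C\<close> by (rule imageE)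
    then have x': "x \<in> {1..p}" "w x \<le> b" by (auto simp: dots_def)
    then have "x \<in> {1..n}" using bounds(1) by auto
    then have "w x \<in> {1..n}" using permutes_in_image[OF perm] by simp
    then show ?thesis using x x' col_b[of x] by auto
  qed
  have T_below: "a < fst u \<and> snd u < b" if "u \<in> T" for u
  proof -
    obtain v where "v \<in> S'" "fst u = fst v" using imageI[OF \<open>u \<in> T\<close>, of fst] T(2) by (metis imageE)
    then show ?thesis
      using below_top[of v] Cb[of "snd u"] imageI[OF \<open>u \<in> T\<close>, of snd] T(3) by simp
  qed
  let ?S = "insert (a, b) T"
  have anti: "antidiagonal ?S" using antidiagonal_insert[OF T(1)] T_below by blast
  have yT: "(a, b) \<notin> T" using T_below by fastforce
  have "card T = card S'"
    using card_image[OF injT(1)] card_image[OF inj_on_subset[OF antidiagonal_inj(1)[OF antidiagonal_S]], of S']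
      T(2) by simp
  then have cardT: "card ?S = card S"
    using yT finT card.remove[OF finite_S top_in] by simp
  have "?S \<subseteq> {1..p} \<times> {1..b}"
  proof
    fix u assume u: "u \<in> ?S"
    show "u \<in> {1..p} \<times> {1..b}"
    proof (cases "u = (a, b)")
      case False
      then have "u \<in> T" using u by simp
      then obtain v where "v \<in> S" "fst u = fst v" using imageI[OF \<open>u \<in> T\<close>, of fst] T(2) by (metis DiffD1 imageE)
      moreover have "v \<in> {1..p} \<times> {1..b}" using \<open>v \<in> S\<close> bounds(3) by blast
      moreover have "1 \<le> snd u \<and> snd u < b"
        using Cb[of "snd u"] imageI[OF \<open>u \<in> T\<close>, of snd] T(3) by simp
      ultimately show ?thesis by (cases u) auto
    qed (use top_in bounds(3) in auto)
  qed
  then have "bad n w ?S"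
    unfolding bad_def using anti bounds(1,2,4) cardT by (intro conjI bexI[of _ p] bexI[of _ b]) simp_all
  then obtain B where B: "B \<subseteq> ?S" "minimal_bad n w B"
    using bad_contains_minimal_bad by blast
  then have badB: "bad n w B" unfolding minimal_bad_def by blast
  \<comment> \<open>Below the top, \<open>T\<close> uses only columns of dots, so its column counts
    are admissible for \<open>not_bad_below_top\<close>.\<close>
  have yB: "(a, b) \<in> B"
  proof (rule ccontr)
    assume "(a, b) \<notin> B"
    then have BT: "B \<subseteq> T" using B(1) by blast
    have "\<not> bad n w B"
    proof (rule not_bad_below_top)
      show "fst ` B \<subseteq> fst ` S'" using image_mono[OF BT, of fst] T(2) by simp
      show "snd u \<le> b" if "u \<in> B" for u using T_below[of u] that BT by auto
      fix j assume "j \<in> {1..n}"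
      have sub: "snd ` B \<subseteq> ?C" using image_mono[OF BT, of snd] T(3) by simp
      have "{c \<in> snd ` B. c \<le> j} \<subseteq> {c \<in> ?C. c \<le> min j b}"
      proof
        fix c assume c: "c \<in> {c \<in> snd ` B. c \<le> j}"
        then have "c \<in> ?C" using sub by blast
        then show "c \<in> {c \<in> ?C. c \<le> min j b}" using Cb[of c] c by simp
      qed
      then have "card {c \<in> snd ` B. c \<le> j} \<le> card {c \<in> ?C. c \<le> min j b}"
        by (rule card_mono[rotated]) simp
      also have "\<dots> = dot_count w p (min j b)" by (rule card_dot_cols) simp
      also have "\<dots> \<le> dot_count w p j" by (rule dot_count_mono) simp_all
      finally show "card {c \<in> snd ` B. c \<le> j} \<le> dot_count w p j" .
    qed
    then show False using badB by simp
  qed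
  have "top_of B (a, b)"
    unfolding top_of_def using yB B(1) T_below by auto
  \<comment> \<open>In every row \<open>T\<close> lies weakly west of \<open>S\<close>: both entries
    are the \<open>k\<close>-th smallest in their column sets, where \<open>k\<close> counts the
    rows from this one down, and by \<open>card_cols\<close> at least \<open>k\<close> dot columns
    are at most \<open>snd s\<close>.\<close>
  have left: "\<exists>s\<in>S. fst s = fst t \<and> snd t \<le> snd s" if t: "t \<in> ?S" for t
  proof (cases "t = (a, b)")
    case True
    then show ?thesis using top_in by (intro bexI[of _ "(a, b)"]) simp_all
  next
    case False
    then have tT: "t \<in> T" using t by simp
    then obtain s where s: "s \<in> S'" "fst s = fst t"
      using imageI[OF tT, of fst] T(2) by (metis imageE)
    define k where "k = card {r \<in> fst ` S'. fst t \<le> r}"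
    have antiS': "antidiagonal S'" using antidiagonal_subset[OF antidiagonal_S] by blast
    have "{u \<in> T. snd u \<le> snd t} = {u \<in> T. fst t \<le> fst u}"
      using antidiagonal_le_iff[OF T(1) tT] by blast
    moreover have "fst ` {u \<in> T. fst t \<le> fst u} = {r \<in> fst ` S'. fst t \<le> r}"
      unfolding T(2)[symmetric] by blast
    moreover have "snd ` {u \<in> T. snd u \<le> snd t} = {c \<in> ?C. c \<le> snd t}"
      unfolding T(3)[symmetric] by blast
    moreover have "card (fst ` {u \<in> T. fst t \<le> fst u}) = card {u \<in> T. fst t \<le> fst u}"
      by (rule card_image[OF inj_on_subset[OF injT(1)]]) blast
    moreover have "card (snd ` {u \<in> T. snd u \<le> snd t}) = card {u \<in> T. snd u \<le> snd t}"
      by (rule card_image[OF inj_on_subset[OF injT(2)]]) blast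
    ultimately have k1: "card {c \<in> ?C. c \<le> snd t} = k" by (simp add: k_def)
    have "{u \<in> S'. snd u \<le> snd s} = {u \<in> S'. fst t \<le> fst u}"
      using antidiagonal_le_iff[OF antiS' s(1)] s(2) by auto
    moreover have "fst ` {u \<in> S'. fst t \<le> fst u} = {r \<in> fst ` S'. fst t \<le> r}" by blast
    moreover have "snd ` {u \<in> S'. snd u \<le> snd s} = {c \<in> snd ` S'. c \<le> snd s}" by blast
    moreover have "card (fst ` {u \<in> S'. fst t \<le> fst u}) = card {u \<in> S'. fst t \<le> fst u}"
      by (rule card_image[OF inj_on_subset[OF antidiagonal_inj(1)[OF antiS']]]) blast
    moreover have "card (snd ` {u \<in> S'. snd u \<le> snd s}) = card {u \<in> S'. snd u \<le> snd s}"
      by (rule card_image[OF inj_on_subset[OF antidiagonal_inj(2)[OF antiS']]]) blast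
    ultimately have k2: "card {c \<in> snd ` S'. c \<le> snd s} = k" by (simp add: k_def)
    have "snd s < b" using below_top[OF s(1)] by simp
    moreover have "s \<in> {1..p} \<times> {1..b}" using s(1) bounds(3) by blast
    ultimately have "snd s \<in> {1..n}" "snd s \<le> b" using bounds(2) by auto
    then have "k \<le> card {c \<in> ?C. c \<le> snd s}"
      using card_cols[of "snd s"] k2 card_dot_cols[of "snd s"] by simp
    have "snd t \<le> snd s"
    proof (rule ccontr)
      assume "\<not> snd t \<le> snd s"
      moreover have "snd t \<in> ?C" using imageI[OF tT, of snd] T(3) by simp
      ultimately have "{c \<in> ?C. c \<le> snd s} \<subset> {c \<in> ?C. c \<le> snd t}" by auto
      then have "card {c \<in> ?C. c \<le> snd s} < card {c \<in> ?C. c \<le> snd t}"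
        by (intro psubset_card_mono) simp
      then show False using k1 \<open>k \<le> _\<close> by simp
    qed
    then show ?thesis using s by blast
  qed
  \<comment> \<open>Otherwise \<open>B\<close> would be smaller than \<open>S\<close> with the same
    top. Above the topmost missing element, an element of \<open>B\<close> shares its row with an
    element of \<open>S\<close> that is also in \<open>B\<close>, so the two coincide.\<close>
  have "\<not> S - B \<noteq> {}"
  proof
    assume "S - B \<noteq> {}"
    then obtain v where "top_of (S - B) v"
      using antidiagonal_exists_top[OF antidiagonal_subset[OF antidiagonal_S], of "S - B"] by auto
    then have v: "v \<in> S" "v \<notin> B" and vmin: "\<And>u. u \<in> S \<Longrightarrow> u \<notin> B \<Longrightarrow> u \<noteq> v \<Longrightarrow> fst v < fst u"
      unfolding top_of_def by blast+
    have above: "u \<in> B" if "u \<in> S" "fst u < fst v" for u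
      using vmin[OF that(1)] that(2) by (metis less_asym less_irrefl)
    have "u \<in> B \<longleftrightarrow> u \<in> S" if "new_less v u" for u
    proof
      assume uB: "u \<in> B"
      then obtain s where s: "s \<in> S" "fst s = fst u" "snd u \<le> snd s"
        using left B(1) by blast
      have "fst u < fst v"
      proof (rule ccontr)
        assume "\<not> fst u < fst v"
        then have "fst s = fst v" "snd v < snd s" using that s by (auto simp: new_less_def)
        then show False using inj_onD[OF antidiagonal_inj(1)[OF antidiagonal_S] _ s(1) v(1)] by auto
      qed
      then have "s \<in> B" using above s by simp
      then have "s = u"
        using inj_onD[OF antidiagonal_inj(1)[OF anti] s(2)] uB B(1) by blast
      then show "u \<in> S" using s by simp
    next
      assume uS: "u \<in> S"
      have "fst u < fst v"
      proof (rule ccontr)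
        assume "\<not> fst u < fst v"
        then have "fst u = fst v" "snd v < snd u" using that by (auto simp: new_less_def)
        then show False using inj_onD[OF antidiagonal_inj(1)[OF antidiagonal_S] _ uS v(1)] by auto
      qed
      then show "u \<in> B" using above uS by simp
    qed
    then have "set_less B S" unfolding set_less_def using v by blast
    moreover have "B \<noteq> S" using v by blast
    then have "set_less S B" using lex_min B(2) \<open>top_of B (a, b)\<close> by blast
    ultimately show False using set_less_asym by blast
  qed
  then have "S \<subseteq> ?S" using B(1) by blast
  then have "S = ?S"
    using cardT finT by (metis card_subset_eq finite_insert)
  then have "S' = T" using yT by blast
  then show ?thesis using T(3) by simp
qed

text \<open>The dot of column \<open>d\<close> lies in the block of \<open>S\<close> but below that
  of \<open>S2\<close>, so \<open>p2 < p\<close>; since the dots increase, widening the block of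
  \<open>S2\<close> from \<open>d\<close> to \<open>b\<close> adds no dot. Hence the top of
  \<open>S2\<close> can be replaced by \<open>(a, b)\<close>, and a minimal bad subset of the result
  is smaller than \<open>S\<close> with the same top.\<close>

theorem grid_free_of_tops:
  assumes c: "c \<in> fst ` S'" and d: "d \<in> snd ` S'"
    and S2: "minimal_bad n w S2" "top_of S2 (c, d)"
  shows False
proof -
  define p2 where "p2 = Max (fst ` S2)"
  interpret S2: minimal_bad_antidiagonal n w S2 c d p2
    by unfold_locales (use perm vex S2 p2_def in auto)
  obtain x where x: "x \<in> dots w p b" "d = w x"
    using d cols_S'_eq by (metis imageE)
  then have xp: "x \<in> {1..p}" "w x \<le> b" by (auto simp: dots_def)
  have "p2 < x"
  proof (rule ccontr)
    assume "\<not> p2 < x"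
    then show False using S2.col_b[of x] xp x(2) by auto
  qed
  then have p2: "p2 < p" using xp by simp
  have "d \<le> b" using x xp by simp
  have "dots w p2 b \<subseteq> dots w p2 d"
  proof
    fix i assume i: "i \<in> dots w p2 b"
    then have "i \<in> dots w p b" "i < x" using p2 \<open>p2 < x\<close> by (auto simp: dots_def)
    then have "w i < d" using increasing[of i x] x by simp
    then show "i \<in> dots w p2 d" using i by (auto simp: dots_def)
  qed
  then have dc: "dot_count w p2 b \<le> dot_count w p2 d"
    unfolding dot_count_def by (intro card_mono) simp_all
  obtain u0 where u0: "u0 \<in> S'" "fst u0 = c" using c by (metis imageE)
  obtain v0 where v0: "v0 \<in> S'" "snd v0 = d" using d by (metis imageE)
  have "a < c" "d < b" using below_top[OF u0(1)] below_top[OF v0(1)] u0 v0 by auto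
  let ?S3 = "insert (a, b) (S2 - {(c, d)})"
  have below: "a < fst u \<and> snd u < b \<and> c < fst u" if "u \<in> S2 - {(c, d)}" for u
    using S2.below_top[OF that] \<open>a < c\<close> \<open>d < b\<close> by auto
  have anti: "antidiagonal ?S3"
    using below by (intro antidiagonal_insert antidiagonal_subset[OF S2.antidiagonal_S]) auto
  have "(a, b) \<notin> S2 - {(c, d)}" using below by fastforce
  then have "card ?S3 = card S2"
    using card.remove[OF S2.finite_S S2.top_in] by simp
  moreover have "?S3 \<subseteq> {1..p2} \<times> {1..b}"
  proof
    fix u assume u: "u \<in> ?S3"
    have c2: "c \<le> p2" using S2.top_in S2.bounds(3) by auto
    have "1 \<le> a" using top_in bounds(3) by auto
    show "u \<in> {1..p2} \<times> {1..b}"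
    proof (cases "u = (a, b)")
      case True
      then show ?thesis using \<open>1 \<le> a\<close> c2 \<open>a < c\<close> bounds(2) by auto
    next
      case False
      then have "u \<in> S2" using u by blast
      then have "u \<in> {1..p2} \<times> {1..d}" using S2.bounds(3) by blast
      then show ?thesis using \<open>d \<le> b\<close> by auto
    qed
  qed
  ultimately have "bad n w ?S3"
    unfolding bad_def using anti S2.bounds(1,4) bounds(2) dc
    by (intro conjI bexI[of _ p2] bexI[of _ b]) simp_all
  then obtain B where B: "B \<subseteq> ?S3" "minimal_bad n w B"
    by (auto dest!: bad_contains_minimal_bad)
  then have badB: "bad n w B" unfolding minimal_bad_def by blast
  have yB: "(a, b) \<in> B"
  proof (rule ccontr)
    assume "(a, b) \<notin> B"
    then have "B \<subset> S2" using B(1) S2.top_in by blast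
    then show False using S2.not_bad_subset[of B] badB by simp
  qed
  have topB: "top_of B (a, b)"
    unfolding top_of_def using yB B(1) below by auto
  \<comment> \<open>The second element \<open>v\<close> of \<open>S\<close> decides the comparison:
    it lies in row \<open>c\<close> or higher, whereas \<open>B\<close> apart from
    \<open>(a, b)\<close> lies strictly below row \<open>c\<close>.\<close>
  have "top_of S' (SOME y. top_of S' y)"
    by (rule someI_ex, rule antidiagonal_exists_top[OF antidiagonal_subset[OF antidiagonal_S]])
      (use u0 in auto)
  then obtain v where v: "v \<in> S'" "\<And>u. u \<in> S' \<Longrightarrow> u \<noteq> v \<Longrightarrow> fst v < fst u \<and> snd u < snd v"
    unfolding top_of_def by blast
  have "fst v \<le> c" using v(2)[OF u0(1)] u0(2) by (cases "u0 = v") auto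
  have vB: "v \<notin> B"
  proof
    assume "v \<in> B"
    then have "v \<in> S2 - {(c, d)}" using B(1) v(1) by blast
    then show False using below[of v] \<open>fst v \<le> c\<close> by simp
  qed
  have "u \<in> B \<longleftrightarrow> u \<in> S" if vu: "new_less v u" for u
  proof (cases "u = (a, b)")
    case True
    then show ?thesis using yB top_in by simp
  next
    case False
    have "u \<notin> B"
    proof
      assume "u \<in> B"
      then have "u \<in> S2 - {(c, d)}" using B(1) False by blast
      then have "fst v < fst u" using below[of u] \<open>fst v \<le> c\<close> by simp
      then show False using vu by (auto simp: new_less_def)
    qed
    moreover have "u \<notin> S"
    proof
      assume "u \<in> S"
      then have "u \<in> S'" using False by simp
      then show False using v(2)[of u] vu by (cases "u = v") (auto simp: new_less_def)
    qed
    ultimately show ?thesis by simp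
  qed
  then have "set_less B S" unfolding set_less_def using v(1) vB by blast
  moreover have "B \<noteq> S" using v(1) vB by blast
  then have "set_less S B" using lex_min B(2) topB by blast
  ultimately show False using set_less_asym by blast
qed

end

section \<open>Minors of the generic matrix\<close>

definition squarefree_pprod :: "'v set \<Rightarrow> 'v pprod" where
  "squarefree_pprod S = (\<Sum>v\<in>S. single v 1)"

lemma lookup_squarefree: "finite S \<Longrightarrow> lookup (squarefree_pprod S) v = (if v \<in> S then 1 else 0)"
  by (simp add: squarefree_pprod_def lookup_sum lookup_single when_def sum.delta')

lemma keys_squarefree [simp]: "finite S \<Longrightarrow> keys (squarefree_pprod S) = S"
  by (auto simp: in_keys_iff lookup_squarefree split: if_splits)

lemma set_less_imp_lex_less:
  assumes "set_less S T" "finite S" "finite T"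
  shows "lex_less new_less (squarefree_pprod S) (squarefree_pprod T)"
  using assms unfolding set_less_def lex_less_def by (fastforce simp: lookup_squarefree)

lemma lex_less_imp_set_less:
  assumes "lex_less new_less (squarefree_pprod S) (squarefree_pprod T)" "finite S" "finite T"
  shows "set_less S T"
proof -
  obtain v where v: "lookup (squarefree_pprod S) v < lookup (squarefree_pprod T) v"
      "\<And>u. new_less v u \<Longrightarrow> lookup (squarefree_pprod S) u = lookup (squarefree_pprod T) u"
    using assms(1) unfolding lex_less_def by blast
  have "v \<in> T - S" using v(1) assms(2,3) by (simp add: lookup_squarefree split: if_splits)
  moreover have "u \<in> S \<longleftrightarrow> u \<in> T" if "new_less v u" for u
    using v(2)[OF that] assms(2,3) by (simp add: lookup_squarefree split: if_splits)
  ultimately show ?thesis unfolding set_less_def by blast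
qed

definition generic_minor ::
  "nat \<Rightarrow> (nat \<Rightarrow> nat) \<Rightarrow> (nat \<Rightarrow> nat) \<Rightarrow> (nat \<times> nat, 'k::field) mpoly" where
  "generic_minor k \<rho> \<kappa> = det (mat k k (\<lambda>(i, j). mvar (\<rho> i, \<kappa> j)))"

lemma generic_minor_leibniz:
  assumes "inj_on \<rho> {0..<k}"
  shows "(generic_minor k \<rho> \<kappa> :: (nat \<times> nat, 'k::field) mpoly) = (\<Sum>\<pi> | \<pi> permutes {0..<k}.
    single (squarefree_pprod ((\<lambda>i. (\<rho> i, \<kappa> (\<pi> i))) ` {0..<k})) (of_int (sign \<pi>)))"
proof -
  have prod: "(\<Prod>x\<in>A. mvar (f x) :: (nat \<times> nat, 'k) mpoly) = single (\<Sum>x\<in>A. single (f x) 1) 1"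
    if "finite A" for A :: "nat set" and f
    using that by induction (simp_all add: mvar_def mult_single)
  have "signof \<pi> * (\<Prod>i = 0..<k. mat k k (\<lambda>(i, j). mvar (\<rho> i, \<kappa> j)) $$ (i, \<pi> i)) =
      single (squarefree_pprod ((\<lambda>i. (\<rho> i, \<kappa> (\<pi> i))) ` {0..<k})) (of_int (sign \<pi>) :: 'k)"
    if \<pi>: "\<pi> permutes {0..<k}" for \<pi>
  proof -
    have "(\<Prod>i = 0..<k. mat k k (\<lambda>(i, j). mvar (\<rho> i, \<kappa> j)) $$ (i, \<pi> i)) =
        (\<Prod>i = 0..<k. mvar (\<rho> i, \<kappa> (\<pi> i)) :: (nat \<times> nat, 'k) mpoly)"
      using permutes_in_image[OF \<pi>] by (intro prod.cong refl) auto
    also have "\<dots> = single (\<Sum>i = 0..<k. single (\<rho> i, \<kappa> (\<pi> i)) 1) 1"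
      by (simp add: prod)
    also have "(\<Sum>i = 0..<k. single (\<rho> i, \<kappa> (\<pi> i)) 1) =
        squarefree_pprod ((\<lambda>i. (\<rho> i, \<kappa> (\<pi> i))) ` {0..<k})"
      unfolding squarefree_pprod_def
      by (subst sum.reindex) (use assms in \<open>auto simp: inj_on_def\<close>)
    finally show ?thesis by (cases "sign \<pi> = 1") (auto simp: sign_def single_uminus)
  qed
  then show ?thesis
    unfolding generic_minor_def by (subst det_def'[of _ k]) simp_all
qed

text \<open>Distinct permutations have distinct graphs in the grid, so no two Leibniz terms share a
  monomial and nothing cancels.\<close>

lemma generic_minor_transversals:
  fixes S :: "(nat \<times> nat) set"
  assumes S: "inj_on fst S" "inj_on snd S"
    and \<rho>: "bij_betw \<rho> {0..<k} (fst ` S)" and \<kappa>: "bij_betw \<kappa> {0..<k} (snd ` S)"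
  defines "D \<equiv> generic_minor k \<rho> \<kappa> :: (nat \<times> nat, 'k::field) mpoly"
  shows "lookup D (squarefree_pprod S) = 1 \<or> lookup D (squarefree_pprod S) = - 1"
    and "keys D \<subseteq> squarefree_pprod ` Collect (transversal S)"
proof -
  let ?g = "\<lambda>\<pi>. (\<lambda>i. (\<rho> i, \<kappa> (\<pi> i))) ` {0..<k}"
  let ?P = "{\<pi>. \<pi> permutes {0..<k}}"
  have inj: "inj_on \<rho> {0..<k}" "inj_on \<kappa> {0..<k}" using \<rho> \<kappa> by (simp_all add: bij_betw_def)
  have D: "D = (\<Sum>\<pi>\<in>?P. single (squarefree_pprod (?g \<pi>)) (of_int (sign \<pi>)))"
    unfolding D_def by (rule generic_minor_leibniz[OF inj(1)])
  have finP: "finite ?P" by (rule finite_permutations) simp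
  have g_inj: "\<pi> = \<pi>'" if "\<pi> \<in> ?P" "\<pi>' \<in> ?P" "?g \<pi> = ?g \<pi>'" for \<pi> \<pi>'
  proof
    fix i
    show "\<pi> i = \<pi>' i"
    proof (cases "i \<in> {0..<k}")
      case True
      then have "(\<rho> i, \<kappa> (\<pi> i)) \<in> ?g \<pi>'" using that(3) by blast
      then obtain i' where i': "i' \<in> {0..<k}" "\<rho> i = \<rho> i'" "\<kappa> (\<pi> i) = \<kappa> (\<pi>' i')" by auto
      then have "i = i'" using inj_onD[OF inj(1)] True by blast
      have "\<pi> i \<in> {0..<k}" "\<pi>' i \<in> {0..<k}"
        using that True permutes_in_image by (metis mem_Collect_eq)+
      then show ?thesis using inj_onD[OF inj(2), of "\<pi> i" "\<pi>' i"] i' \<open>i = i'\<close> by simp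
    qed (use that in \<open>auto simp: permutes_def\<close>)
  qed
  define f where "f i = the_inv_into S fst (\<rho> i)" for i
  have fb: "bij_betw f {0..<k} S"
    using bij_betw_trans[OF \<rho> bij_betw_the_inv_into[OF bij_betw_imageI[OF S(1) refl]]]
    by (simp add: f_def comp_def cong: bij_betw_cong)
  have f1: "fst (f i) = \<rho> i" if "i \<in> {0..<k}" for i
    unfolding f_def using bij_betwE[OF \<rho>] that by (intro f_the_inv_into_f[OF S(1)]) blast
  define \<kappa>' where "\<kappa>' = the_inv_into {0..<k} \<kappa>"
  have \<kappa>': "bij_betw \<kappa>' (snd ` S) {0..<k}"
    unfolding \<kappa>'_def by (rule bij_betw_the_inv_into[OF \<kappa>])
  have \<kappa>\<kappa>': "\<kappa> (\<kappa>' c) = c" if "c \<in> snd ` S" for c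
    unfolding \<kappa>'_def using that \<kappa> by (simp add: f_the_inv_into_f_bij_betw)
  \<comment> \<open>The permutation whose graph, read through \<open>\<rho>\<close> and
    \<open>\<kappa>\<close>, is \<open>S\<close>.\<close>
  define \<pi>0 where "\<pi>0 i = (if i \<in> {0..<k} then \<kappa>' (snd (f i)) else i)" for i
  have "bij_betw (\<kappa>' \<circ> snd \<circ> f) {0..<k} {0..<k}"
    using bij_betw_trans[OF fb bij_betw_trans[OF bij_betw_imageI[OF S(2) refl] \<kappa>']]
    by (simp add: comp_assoc)
  then have "bij_betw \<pi>0 {0..<k} {0..<k}"
    by (rule bij_betw_cong[THEN iffD1, rotated]) (simp add: \<pi>0_def)
  then have \<pi>0: "\<pi>0 \<in> ?P"
    using bij_imp_permutes[of \<pi>0 "{0..<k}"] by (simp add: \<pi>0_def)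
  have "(\<rho> i, \<kappa> (\<pi>0 i)) = f i" if i: "i \<in> {0..<k}" for i
  proof -
    have "f i \<in> S" using bij_betwE[OF fb] i by blast
    then have "\<kappa> (\<pi>0 i) = snd (f i)" using \<kappa>\<kappa>' i by (simp add: \<pi>0_def)
    then show ?thesis using f1[OF i] by (simp add: prod_eq_iff)
  qed
  then have "?g \<pi>0 = f ` {0..<k}" by (rule image_cong[OF refl])
  then have g0: "?g \<pi>0 = S" using fb by (simp only: bij_betw_def)
  have "lookup D (squarefree_pprod S) =
      (\<Sum>\<pi>\<in>?P. if \<pi> = \<pi>0 then of_int (sign \<pi>) else 0)"
    unfolding D lookup_sum lookup_single when_def
  proof (intro sum.cong refl if_cong)
    fix \<pi> assume "\<pi> \<in> ?P"
    show "squarefree_pprod (?g \<pi>) = squarefree_pprod S \<longleftrightarrow> \<pi> = \<pi>0"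
    proof
      assume "squarefree_pprod (?g \<pi>) = squarefree_pprod S"
      then have "keys (squarefree_pprod (?g \<pi>)) = keys (squarefree_pprod (?g \<pi>0))"
        by (simp only: g0)
      then have "?g \<pi> = ?g \<pi>0" by simp
      then show "\<pi> = \<pi>0" by (rule g_inj[OF \<open>\<pi> \<in> ?P\<close> \<pi>0])
    qed (simp add: g0)
  qed
  also have "\<dots> = of_int (sign \<pi>0)" using finP \<pi>0 by simp
  finally show "lookup D (squarefree_pprod S) = 1 \<or> lookup D (squarefree_pprod S) = - 1"
    by (auto simp: sign_def)
  show "keys D \<subseteq> squarefree_pprod ` Collect (transversal S)"
  proof
    fix m assume "m \<in> keys D"
    then have "m \<in> (\<Union>\<pi>\<in>?P. keys (single (squarefree_pprod (?g \<pi>)) (of_int (sign \<pi>) :: 'k)))"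
      unfolding D by (rule subsetD[OF keys_sum])
    then obtain \<pi> where \<pi>: "\<pi> permutes {0..<k}" "m = squarefree_pprod (?g \<pi>)"
      by (metis (no_types, lifting) UN_E empty_iff keys_single mem_Collect_eq singletonD)
    have "inj_on fst (?g \<pi>)" using inj(1) by (auto simp: inj_on_def)
    moreover have "inj_on snd (?g \<pi>)"
    proof (rule inj_onI)
      fix u v assume "u \<in> ?g \<pi>" "v \<in> ?g \<pi>" "snd u = snd v"
      then obtain i j where ij: "i \<in> {0..<k}" "j \<in> {0..<k}" "u = (\<rho> i, \<kappa> (\<pi> i))" "v = (\<rho> j, \<kappa> (\<pi> j))"
          "\<kappa> (\<pi> i) = \<kappa> (\<pi> j)" by auto
      have "\<pi> i \<in> {0..<k}" "\<pi> j \<in> {0..<k}" using permutes_in_image[OF \<pi>(1)] ij by simp_all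
      then have "\<pi> i = \<pi> j" using inj_onD[OF inj(2) ij(5)] by simp
      then have "i = j" using permutes_inj[OF \<pi>(1)] by (metis injD)
      then show "u = v" using ij by simp
    qed
    moreover have "fst ` ?g \<pi> = fst ` S"
      using \<rho> by (simp add: image_image bij_betw_def)
    moreover have "snd ` ?g \<pi> = \<kappa> ` (\<pi> ` {0..<k})" by (simp add: image_image)
    then have "snd ` ?g \<pi> = snd ` S"
      using \<kappa> permutes_image[OF \<pi>(1)] by (simp add: bij_betw_def)
    ultimately have "transversal S (?g \<pi>)" unfolding transversal_def by simp
    then show "m \<in> squarefree_pprod ` Collect (transversal S)" using \<pi>(2) by simp
  qed
qed

section \<open>Submatrices of the generic matrix\<close>

lemma bij_betw_pick:
  assumes "finite I"
  shows "bij_betw (pick I) {0..<card I} I"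
proof -
  have "inj_on (pick I) {0..<card I}"
  proof (rule inj_onI)
    fix i j assume "i \<in> {0..<card I}" "j \<in> {0..<card I}" "pick I i = pick I j"
    then show "i = j" using pick_mono[of i I j] pick_mono[of j I i] by (cases i j rule: linorder_cases) auto
  qed
  moreover from this have "pick I ` {0..<card I} = I"
    using assms pick_in_set[of _ I] by (intro card_subset_eq) (auto simp: card_image)
  ultimately show ?thesis by (simp add: bij_betw_def)
qed

lemma submatrix_mat:
  assumes "I \<subseteq> {..<p}" "J \<subseteq> {..<q}"
  shows "submatrix (mat p q f) I J = mat (card I) (card J) (\<lambda>(i, j). f (pick I i, pick J j))"
proof -
  have eq: "{i. i < p \<and> i \<in> I} = I" "{j. j < q \<and> j \<in> J} = J" using assms by auto
  have fin: "finite I" "finite J" using assms finite_subset by blast+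
  show ?thesis
    unfolding submatrix_def
    by (rule eq_matI)
      (use bij_betwE[OF bij_betw_pick[OF fin(1)]] bij_betwE[OF bij_betw_pick[OF fin(2)]] assms
        in \<open>auto simp: eq subset_iff\<close>)
qed

lemma pick_lessThan: "i < p \<Longrightarrow> pick {..<p} i = i"
  using pick_reduce_set[of i p UNIV] pick_UNIV[of i] by (simp add: lessThan_def)

lemma northwest_mat:
  assumes "p \<le> n" "q \<le> n"
  shows "northwest (mat n n f) p q = mat p q f"
  unfolding northwest_def
  by (subst submatrix_mat) (use assms in \<open>auto intro!: eq_matI simp: pick_lessThan\<close>)

lemma minors_northwest_genericE:
  assumes "p \<le> n" "q \<le> n" "f \<in> minors (northwest (generic_matrix n) p q) k"
  obtains \<rho> \<kappa> where "f = generic_minor k \<rho> \<kappa>"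
    "\<And>i. i < k \<Longrightarrow> \<rho> i \<in> {1..p}" "\<And>i. i < k \<Longrightarrow> \<kappa> i \<in> {1..q}"
proof -
  obtain I J where IJ: "I \<subseteq> {..<p}" "J \<subseteq> {..<q}" "card I = k" "card J = k"
    and f: "f = det (submatrix (mat p q (\<lambda>(i, j). mvar (i + 1, j + 1))) I J)"
    using assms(3) unfolding generic_matrix_def northwest_mat[OF assms(1,2)] minors_def by auto
  have fin: "finite I" "finite J" using IJ finite_subset by blast+
  have "f = generic_minor k (\<lambda>i. pick I i + 1) (\<lambda>j. pick J j + 1)"
    unfolding f submatrix_mat[OF IJ(1,2)] generic_minor_def IJ(3,4)
    by (intro arg_cong[of _ _ det] eq_matI) auto
  then show thesis
  proof (rule that)
    show "pick I i + 1 \<in> {1..p}" if "i < k" for i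
      using bij_betwE[OF bij_betw_pick[OF fin(1)]] IJ that by fastforce
    show "pick J i + 1 \<in> {1..q}" if "i < k" for i
      using bij_betwE[OF bij_betw_pick[OF fin(2)]] IJ that by fastforce
  qed
qed

lemma minor_of_antidiagonal:
  assumes S: "antidiagonal S" "S \<subseteq> {1..p} \<times> {1..q}" and pq: "p \<le> n" "q \<le> n"
  shows "\<exists>D \<in> minors (northwest (generic_matrix n) p q) (card S).
    (lookup D (squarefree_pprod S) = 1 \<or> lookup D (squarefree_pprod S) = - 1) \<and>
    keys D \<subseteq> squarefree_pprod ` Collect (transversal S)"
proof -
  \<comment> \<open>Matrix entries are numbered from 0, variables from 1.\<close>
  define I J where "I = (\<lambda>i. i - 1) ` fst ` S" and "J = (\<lambda>j. j - 1) ` snd ` S"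
  have finS: "finite S" using S(2) by (rule finite_subset) simp
  have pos: "1 \<le> fst u" "fst u \<le> p" "1 \<le> snd u" "snd u \<le> q" if "u \<in> S" for u
    using S(2) that by auto
  have I: "I \<subseteq> {..<p}" and J: "J \<subseteq> {..<q}"
    unfolding I_def J_def using pos by (auto simp: Suc_le_eq) fastforce+
  have "bij_betw Suc I (fst ` S)"
    unfolding I_def by (intro bij_betw_imageI) (use pos in \<open>force simp: image_image\<close>)+
  moreover have "bij_betw Suc J (snd ` S)"
    unfolding J_def by (intro bij_betw_imageI) (use pos in \<open>force simp: image_image\<close>)+
  ultimately have card: "card I = card S" "card J = card S"
    using bij_betw_same_card[of Suc I "fst ` S"] bij_betw_same_card[of Suc J "snd ` S"]
      card_image[OF antidiagonal_inj(1)[OF S(1)]] card_image[OF antidiagonal_inj(2)[OF S(1)]]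
    by metis+
  have fin: "finite I" "finite J" unfolding I_def J_def using finS by simp_all
  let ?\<rho> = "\<lambda>i. Suc (pick I i)" and ?\<kappa> = "\<lambda>j. Suc (pick J j)"
  have \<rho>: "bij_betw ?\<rho> {0..<card S} (fst ` S)"
    using bij_betw_trans[OF bij_betw_pick[OF fin(1)] \<open>bij_betw Suc I _\<close>] by (simp add: comp_def card)
  have \<kappa>: "bij_betw ?\<kappa> {0..<card S} (snd ` S)"
    using bij_betw_trans[OF bij_betw_pick[OF fin(2)] \<open>bij_betw Suc J _\<close>] by (simp add: comp_def card)
  have "generic_minor (card S) ?\<rho> ?\<kappa> =
      det (submatrix (northwest (generic_matrix n) p q :: (nat \<times> nat, 'a) mpoly mat) I J)"
    unfolding generic_matrix_def northwest_mat[OF pq] submatrix_mat[OF I J] generic_minor_def card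
    by (intro arg_cong[of _ _ det] eq_matI) auto
  moreover have "\<dots> \<in> minors (northwest (generic_matrix n) p q) (card S)"
    unfolding minors_def generic_matrix_def northwest_mat[OF pq] using I J card by auto
  ultimately show ?thesis
    using generic_minor_transversals[OF antidiagonal_inj[OF S(1)] \<rho> \<kappa>] by metis
qed

lemma mvars_generic_minor:
  "mvars (generic_minor k \<rho> \<kappa> :: (nat \<times> nat, 'k::field) mpoly) \<subseteq> \<rho> ` {..<k} \<times> \<kappa> ` {..<k}"
proof -
  have "mvars (signof \<pi> * (\<Prod>i = 0..<k. mat k k (\<lambda>(i, j). mvar (\<rho> i, \<kappa> j)) $$ (i, \<pi> i))
      :: (nat \<times> nat, 'k) mpoly) \<subseteq> \<rho> ` {..<k} \<times> \<kappa> ` {..<k}"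
    if \<pi>: "\<pi> permutes {0..<k}" for \<pi>
  proof -
    have "mvars (\<Prod>i = 0..<k. mat k k (\<lambda>(i, j). mvar (\<rho> i, \<kappa> j)) $$ (i, \<pi> i)
      :: (nat \<times> nat, 'k) mpoly) \<subseteq> \<rho> ` {..<k} \<times> \<kappa> ` {..<k}"
      using permutes_in_image[OF \<pi>] by (intro order_trans[OF mvars_prod] UN_least) auto
    moreover have "mvars (signof \<pi> :: (nat \<times> nat, 'k) mpoly) = {}"
      by (cases "sign \<pi> = 1") (auto simp: sign_def)
    ultimately show ?thesis
      by (intro order_trans[OF mvars_mult] Un_least) simp_all
  qed
  then show ?thesis
    unfolding generic_minor_def
    by (subst det_def'[of _ k]) (auto intro!: order_trans[OF mvars_sum] UN_least)
qed

section \<open>Vanishing of minors, and ranks of partial permutation matrices\<close>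

text \<open>Both factors are padded with zeros to size \<open>k\<close>; column \<open>r\<close> of
  the first is then zero.\<close>

lemma det_of_low_rank:
  fixes U :: "nat \<Rightarrow> nat \<Rightarrow> 'a::comm_ring_1"
  assumes "r < k"
  shows "det (mat k k (\<lambda>(i, j). \<Sum>l<r. U i l * V l j)) = 0"
proof -
  define A where "A = mat k k (\<lambda>(i, l). if l < r then U i l else 0)"
  define B where "B = mat k k (\<lambda>(l, j). if l < r then V l j else 0)"
  have AB: "A \<in> carrier_mat k k" "B \<in> carrier_mat k k" by (simp_all add: A_def B_def)
  have "mat k k (\<lambda>(i, j). \<Sum>l<r. U i l * V l j) = A * B"
  proof (rule eq_matI)
    fix i j assume "i < dim_row (A * B)" "j < dim_col (A * B)"
    then have ij: "i < k" "j < k" by (simp_all add: A_def B_def)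
    then have "(A * B) $$ (i, j) = (\<Sum>l = 0..<k. (if l < r then U i l else 0) * (if l < r then V l j else 0))"
      by (simp add: A_def B_def scalar_prod_def)
    also have "\<dots> = (\<Sum>l<r. U i l * V l j)"
      by (rule sum.mono_neutral_cong_right) (use assms in auto)
    finally show "mat k k (\<lambda>(i, j). \<Sum>l<r. U i l * V l j) $$ (i, j) = (A * B) $$ (i, j)"
      using ij by simp
  qed (simp_all add: A_def B_def)
  moreover have "det A = 0"
  proof -
    have "(\<Prod>i = 0..<k. A $$ (i, \<pi> i)) = 0" if \<pi>: "\<pi> permutes {0..<k}" for \<pi>
    proof -
      have "r \<in> \<pi> ` {0..<k}" using permutes_image[OF \<pi>] assms by simp
      then obtain i where "i \<in> {0..<k}" "\<pi> i = r" by (metis imageE)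
      then have "A $$ (i, \<pi> i) = 0" using assms by (simp add: A_def)
      then show ?thesis using \<open>i \<in> {0..<k}\<close> by (intro prod_zero) auto
    qed
    then show ?thesis by (subst det_def'[OF AB(1)]) simp
  qed
  ultimately show ?thesis using det_mult[OF AB] by simp
qed

lemma generic_minor_vanishes:
  fixes h :: "'k::field \<Rightarrow> 'f::field"
  assumes h: "comm_ring_hom h" and z: "rank_le A B r z" and "r < k"
    and "\<And>i. i < k \<Longrightarrow> \<rho> i \<in> A" "\<And>i. i < k \<Longrightarrow> \<kappa> i \<in> B"
  shows "mpoly_eval h z (generic_minor k \<rho> \<kappa>) = 0"
proof -
  interpret ev: comm_ring_hom "mpoly_eval h z" by (rule comm_ring_hom_mpoly_eval[OF h])
  obtain U V where UV: "\<And>i j. i \<in> A \<Longrightarrow> j \<in> B \<Longrightarrow> z (i, j) = (\<Sum>l<r. U i l * V l j)"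
    using z by (rule rank_leE) blast
  have "mpoly_eval h z (generic_minor k \<rho> \<kappa>) =
      det (map_mat (mpoly_eval h z) (mat k k (\<lambda>(i, j). mvar (\<rho> i, \<kappa> j))))"
    unfolding generic_minor_def by simp
  also have "map_mat (mpoly_eval h z) (mat k k (\<lambda>(i, j). mvar (\<rho> i, \<kappa> j))) =
      mat k k (\<lambda>(i, j). \<Sum>l<r. U (\<rho> i) l * V l (\<kappa> j))"
    by (rule eq_matI) (use assms(4,5) in \<open>auto simp: mpoly_eval_mvar[OF h] UV\<close>)
  also have "det \<dots> = 0" by (rule det_of_low_rank) fact
  finally show ?thesis .
qed

text \<open>The nonzero columns of a partial permutation matrix are distinct unit vectors, one for
  each dot, and form a maximal independent set of columns.\<close>

lemma nw_rank_eq_dot_count: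
  assumes "p \<le> n" "q \<le> n" and perm: "w permutes {1..n}"
  shows "nw_rank n w p q = dot_count w p q"
proof -
  interpret vec_space "TYPE(rat)" p .
  define A where "A = (mat p q (\<lambda>(i, j). if w (i + 1) = j + 1 then 1 else 0) :: rat mat)"
  have A: "A \<in> carrier_mat p q" by (simp add: A_def)
  define U where "U = (\<lambda>i. unit_vec p (i - 1) :: rat vec) ` dots w p q"
  have w_eq: "w (x + 1) = w (y + 1) \<longleftrightarrow> x = y" for x y
    using permutes_inj[OF perm] by (metis injD add_right_cancel)
  have col: "col A j = (if \<exists>i<p. w (i + 1) = j + 1 then unit_vec p (THE i. w (i + 1) = j + 1) else 0\<^sub>v p)"
    if "j < q" for j
  proof (cases "\<exists>i<p. w (i + 1) = j + 1")
    case True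
    then obtain i where i: "i < p" "w (i + 1) = j + 1" by blast
    have uniq: "x = i" if "w (x + 1) = j + 1" for x
      using i(2) that w_eq[of x i] by simp
    then have "(THE i. w (i + 1) = j + 1) = i" using i by blast
    moreover have "w (Suc x) = Suc j \<longleftrightarrow> x = i" for x
      using uniq[of x] i(2) by auto
    then have "col A j = unit_vec p i"
      using that by (intro eq_vecI) (simp_all add: A_def unit_vec_def)
    ultimately show ?thesis using True by simp
  next
    case False
    then show ?thesis by (auto intro!: eq_vecI simp: A_def that)
  qed
  have cols: "set (cols A) = {col A j | j. j < q}"
    using A by (auto simp: cols_def)
  have U_cols: "U \<subseteq> set (cols A)"
  proof
    fix u assume "u \<in> U"
    then obtain i where i: "i \<in> dots w p q" "u = unit_vec p (i - 1)" unfolding U_def by blast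
    then have i': "1 \<le> i" "i \<le> p" "w i \<le> q" by (auto simp: dots_def)
    then have "w i \<in> {1..n}" using permutes_in_image[OF perm, of i] assms by auto
    then have wi: "w ((i - 1) + 1) = (w i - 1) + 1" "i - 1 < p" "w i - 1 < q" using i' by auto
    have "(THE x. w (x + 1) = (w i - 1) + 1) = i - 1"
      unfolding wi(1)[symmetric] w_eq by blast
    then have "col A (w i - 1) = u"
      using col[OF wi(3)] wi(1,2) i(2) by auto
    then show "u \<in> set (cols A)" using cols wi(3) by blast
  qed
  have cols_U: "v \<in> U" if v: "v \<in> set (cols A)" "v \<noteq> 0\<^sub>v p" for v
  proof -
    obtain j where j: "j < q" "v = col A j" using v(1) cols by blast
    then obtain i where i: "i < p" "w (i + 1) = j + 1" using col[OF j(1)] v(2) by (auto split: if_splits)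
    then have "(THE i. w (i + 1) = j + 1) = i"
      unfolding i(2)[symmetric] w_eq by blast
    then have "v = unit_vec p ((i + 1) - 1)" using col[OF j(1)] j(2) i by auto
    moreover have "i + 1 \<in> dots w p q" using i j by (auto simp: dots_def)
    ultimately show ?thesis unfolding U_def by blast
  qed
  have "U \<subseteq> set (unit_vecs p)"
    unfolding U_def unit_vecs_def by (auto simp: dots_def)
  then have indpt: "lin_indpt U"
    using unit_vecs_basis subset_li_is_li unfolding basis_def by blast
  have "maximal U (\<lambda>T. T \<subseteq> set (cols A) \<and> lin_indpt T)"
    unfolding maximal_def
  proof (intro conjI allI impI)
    fix T assume T: "U \<subseteq> T \<and> T \<subseteq> set (cols A) \<and> lin_indpt T"
    then have "T \<subseteq> carrier_vec p" using cols_dim[of A] A by auto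
    moreover have "(UNIV :: rat set) \<noteq> {0}" by (metis UNIV_I singletonD zero_neq_one)
    ultimately have "0\<^sub>v p \<notin> T" using zero_nin_lin_indpt T by blast
    then show "T = U" using T cols_U by blast
  qed (use U_cols indpt in auto)
  then have "rank A = card U" by (rule rank_card_indpt[OF A])
  also have "\<dots> = dot_count w p q"
    unfolding U_def dot_count_def
  proof (rule card_image, rule inj_onI)
    fix x y assume "x \<in> dots w p q" "y \<in> dots w p q" "unit_vec p (x - 1) = (unit_vec p (y - 1) :: rat vec)"
    then show "x = y"
      by (subst (asm) unit_vec_eq) (auto simp: dots_def)
  qed
  finally show ?thesis
    unfolding nw_rank_def perm_matrix_def northwest_mat[OF assms(1,2)] A_def .
qed

section \<open>Leading power products\<close>

lemma finite_has_greatest: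
  assumes "finite A" "A \<noteq> {}"
    and total: "\<And>x y. x \<noteq> y \<Longrightarrow> R x y \<or> R y x"
    and trans: "\<And>x y z. R x y \<Longrightarrow> R y z \<Longrightarrow> R x z"
  shows "\<exists>x\<in>A. \<forall>y\<in>A. y \<noteq> x \<longrightarrow> R y x"
  using assms(1,2)
proof (induction A rule: finite_ne_induct)
  case (insert x A)
  then obtain y where y: "y \<in> A" "\<And>u. u \<in> A \<Longrightarrow> u \<noteq> y \<Longrightarrow> R u y" by blast
  show ?case
  proof (cases "R y x")
    case True
    then have "R u x" if "u \<in> A" for u using y(2)[OF that] trans by metis
    then show ?thesis by blast
  next
    case False
    then have "R x y" using total insert.hyps y(1) by metis
    then show ?thesis using y by blast
  qed
qed simp

lemma new_less_total: "u \<noteq> v \<Longrightarrow> new_less u v \<or> new_less v u"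
  by (auto simp: new_less_def prod_eq_iff)

lemma new_less_trans: "new_less u v \<Longrightarrow> new_less v x \<Longrightarrow> new_less u x"
  by (auto simp: new_less_def)

lemma new_less_asym: "new_less u v \<Longrightarrow> \<not> new_less v u"
  by (auto simp: new_less_def)

lemma lex_less_total:
  assumes "s \<noteq> t"
  shows "lex_less new_less s t \<or> lex_less new_less t s"
proof -
  let ?A = "{v. lookup s v \<noteq> lookup t v}"
  have "?A \<subseteq> keys s \<union> keys t" by (auto simp: in_keys_iff)
  then have "finite ?A" by (rule finite_subset) simp
  moreover have "\<exists>v. lookup s v \<noteq> lookup t v"
    using assms poly_mapping_eqI[of s t] by metis
  then have "?A \<noteq> {}" by blast
  ultimately have "\<exists>v\<in>?A. \<forall>u\<in>?A. u \<noteq> v \<longrightarrow> new_less u v"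
    by (rule finite_has_greatest) (fact new_less_total, fact new_less_trans)
  then obtain v where v: "lookup s v \<noteq> lookup t v"
      "\<And>u. lookup s u \<noteq> lookup t u \<Longrightarrow> u \<noteq> v \<Longrightarrow> new_less u v"
    by blast
  then have "lookup s u = lookup t u" if "new_less v u" for u
    using that new_less_asym by metis
  then show ?thesis using v(1) unfolding lex_less_def by (metis linorder_neqE_nat)
qed

lemma lex_less_trans:
  assumes "lex_less new_less s t" "lex_less new_less t x"
  shows "lex_less new_less s x"
proof -
  obtain v v' where v: "lookup s v < lookup t v" "\<And>u. new_less v u \<Longrightarrow> lookup s u = lookup t u"
    and v': "lookup t v' < lookup x v'" "\<And>u. new_less v' u \<Longrightarrow> lookup t u = lookup x u"
    using assms unfolding lex_less_def by blast
  consider "v = v'" | "new_less v v'" | "new_less v' v" using new_less_total by blast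
  then show ?thesis
  proof cases
    case 1
    then have "lookup s v < lookup x v" using v(1) v'(1) by simp
    then show ?thesis
      unfolding lex_less_def using 1 v(2) v'(2) by (intro exI[of _ v] conjI allI impI) simp_all
  next
    case 2
    then have "lookup s v' < lookup x v'" using v(2) v'(1) by simp
    moreover have "lookup s u = lookup x u" if "new_less v' u" for u
      using that 2 v(2) v'(2) new_less_trans by metis
    ultimately show ?thesis unfolding lex_less_def by blast
  next
    case 3
    then have "lookup s v < lookup x v" using v(1) v'(2) by simp
    moreover have "lookup s u = lookup x u" if "new_less v u" for u
      using that 3 v(2) v'(2) new_less_trans by metis
    ultimately show ?thesis unfolding lex_less_def by blast
  qed
qed

lemma lex_less_asym:
  assumes "lex_less new_less s t"
  shows "\<not> lex_less new_less t s"
proof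
  assume "lex_less new_less t s"
  then obtain v v' where v: "lookup s v < lookup t v" "\<And>u. new_less v u \<Longrightarrow> lookup s u = lookup t u"
    and v': "lookup t v' < lookup s v'" "\<And>u. new_less v' u \<Longrightarrow> lookup t u = lookup s u"
    using assms unfolding lex_less_def by blast
  then show False using new_less_total[of v v'] by fastforce
qed

lemma not_lex_less_of_le:
  assumes "\<And>v. lookup s v \<le> lookup t v"
  shows "\<not> lex_less new_less t s"
  using assms unfolding lex_less_def by (meson not_le)

lemma lpp_eqI:
  assumes "m \<in> keys f" "\<And>m'. m' \<in> keys f \<Longrightarrow> m' \<noteq> m \<Longrightarrow> lex_less new_less m' m"
  shows "lpp new_less f = m"
  unfolding lpp_def
proof (rule the_equality)
  show "x = m" if "x \<in> keys f \<and> (\<forall>m'\<in>keys f. m' \<noteq> x \<longrightarrow> lex_less new_less m' x)" for x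
    using that assms(1) assms(2)[of x] lex_less_asym[of x m] by metis
qed (use assms in simp)

lemma lpp_properties:
  assumes "f \<noteq> 0"
  shows lpp_in_keys: "lpp new_less f \<in> keys f"
    and lpp_greatest: "\<And>m. m \<in> keys f \<Longrightarrow> m \<noteq> lpp new_less f \<Longrightarrow> lex_less new_less m (lpp new_less f)"
proof -
  have "\<exists>m\<in>keys f. \<forall>m'\<in>keys f. m' \<noteq> m \<longrightarrow> lex_less new_less m' m"
    using assms
    by (intro finite_has_greatest[OF finite_keys _ lex_less_total lex_less_trans]) simp_all
  then obtain m where m: "m \<in> keys f"
      "\<And>m'. m' \<in> keys f \<Longrightarrow> m' \<noteq> m \<Longrightarrow> lex_less new_less m' m"
    by blast
  then have "lpp new_less f = m" by (rule lpp_eqI)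
  then show "lpp new_less f \<in> keys f"
    and "\<And>m. m \<in> keys f \<Longrightarrow> m \<noteq> lpp new_less f \<Longrightarrow> lex_less new_less m (lpp new_less f)"
    using m by simp_all
qed

text \<open>A monomial below the one of \<open>S\<close> is decided at a variable of
  \<open>S\<close>; at every greater variable, in particular beyond the top, it agrees with the
  monomial of \<open>S\<close>, which is zero there.\<close>

lemma lookup_above_top:
  assumes S: "finite S" "top_of S y" and f: "f \<noteq> 0" "lpp new_less f = squarefree_pprod S"
    and m: "m \<in> keys f" and u: "new_less y u"
  shows "lookup m u = 0"
proof -
  have S_le: "new_less s y" if "s \<in> S" "s \<noteq> y" for s
  proof -
    have "s \<in> S - {y}" using that by simp
    then show ?thesis using S(2) unfolding top_of_def new_less_def by blast
  qed
  have "u \<notin> S" using S_le[of u] u new_less_asym by blast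
  then have u0: "lookup (squarefree_pprod S) u = 0" by (simp add: lookup_squarefree S)
  show ?thesis
  proof (cases "m = squarefree_pprod S")
    case False
    then obtain v where v: "lookup m v < lookup (squarefree_pprod S) v"
        "\<And>x. new_less v x \<Longrightarrow> lookup m x = lookup (squarefree_pprod S) x"
      using lpp_greatest[OF f(1) m] f(2) unfolding lex_less_def by auto
    have "v \<in> S" using v(1) S(1) by (simp add: lookup_squarefree split: if_splits)
    then have "new_less v u" using S_le[of v] u new_less_trans by (cases "v = y") auto
    then show ?thesis using v(2) u0 by simp
  qed (use u0 in simp)
qed

lemma lv_eq_top:
  assumes S: "finite S" "top_of S y" and f: "f \<noteq> 0" "lpp new_less f = squarefree_pprod S"
  shows "lv new_less f = y" "\<not> mconstant f"
proof -
  have "y \<in> S" using S(2) unfolding top_of_def by blast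
  then have y: "y \<in> mvars f"
    using lpp_in_keys[OF f(1)] f(2) S(1) unfolding mvars_def
    by (intro UN_I[of "squarefree_pprod S"]) simp_all
  then show "\<not> mconstant f" unfolding mconstant_def by blast
  have "new_less u y" if u: "u \<in> mvars f" "u \<noteq> y" for u
  proof -
    obtain m where "m \<in> keys f" "u \<in> keys m" using u(1) unfolding mvars_def by blast
    then have "\<not> new_less y u" using lookup_above_top[OF S f, of m u] by (auto simp: in_keys_iff)
    then show ?thesis using new_less_total u(2) by blast
  qed
  then show "lv new_less f = y"
    unfolding lv_def
  proof (intro the_equality)
    show "v = y" if "v \<in> mvars f \<and> (\<forall>u\<in>mvars f. u \<noteq> v \<longrightarrow> new_less u v)" for v
      using that y \<open>\<And>u. u \<in> mvars f \<Longrightarrow> u \<noteq> y \<Longrightarrow> new_less u y\<close>[of v] new_less_asym[of v y] by metis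
  qed (use y in simp)
qed

section \<open>Ideals and reduced Groebner bases\<close>

lemma mpoly_ring_simps:
  "carrier (mpoly_ring V) = {f. mvars f \<subseteq> V}" "f \<otimes>\<^bsub>mpoly_ring V\<^esub> g = f * g"
  "f \<oplus>\<^bsub>mpoly_ring V\<^esub> g = f + g" "\<zero>\<^bsub>mpoly_ring V\<^esub> = 0"
  by (simp_all add: mpoly_ring_def)

lemma ring_mpoly_ring: "ring (mpoly_ring V)"
  using cring_mpoly_ring by (rule cring.axioms(1))

lemma a_inv_mpoly_ring:
  assumes "mvars f \<subseteq> V"
  shows "\<ominus>\<^bsub>mpoly_ring V\<^esub> f = - f"
proof -
  interpret ring "mpoly_ring V" by (rule ring_mpoly_ring)
  show ?thesis by (rule minus_equality) (use assms in \<open>simp_all add: mpoly_ring_simps\<close>)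
qed

lemma mpoly_idealI:
  assumes "\<And>f. f \<in> I \<Longrightarrow> mvars f \<subseteq> V" "0 \<in> I"
    and "\<And>f g. f \<in> I \<Longrightarrow> g \<in> I \<Longrightarrow> f + g \<in> I" "\<And>f. f \<in> I \<Longrightarrow> - f \<in> I"
    and "\<And>f g. f \<in> I \<Longrightarrow> mvars g \<subseteq> V \<Longrightarrow> g * f \<in> I"
  shows "ideal I (mpoly_ring V)"
proof (rule idealI[OF ring_mpoly_ring])
  show "subgroup I (add_monoid (mpoly_ring V))"
  proof
    fix x assume x: "x \<in> I"
    have "inv\<^bsub>add_monoid (mpoly_ring V)\<^esub> x = - x"
      using a_inv_mpoly_ring[OF assms(1)[OF x]] by (simp add: a_inv_def)
    then show "inv\<^bsub>add_monoid (mpoly_ring V)\<^esub> x \<in> I" using assms(4)[OF x] by simp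
  qed (use assms in \<open>auto simp: mpoly_ring_simps\<close>)
qed (use assms in \<open>auto simp: mpoly_ring_simps mult.commute\<close>)

lemma mpoly_ideal_closed:
  assumes "ideal I (mpoly_ring V)"
  shows "\<And>f. f \<in> I \<Longrightarrow> mvars f \<subseteq> V"
    and "\<And>f g. f \<in> I \<Longrightarrow> g \<in> I \<Longrightarrow> f - g \<in> I"
    and "\<And>f g. f \<in> I \<Longrightarrow> mvars g \<subseteq> V \<Longrightarrow> g * f \<in> I"
proof -
  interpret ideal I "mpoly_ring V" by fact
  show sub: "mvars f \<subseteq> V" if "f \<in> I" for f
    using a_subset that by (auto simp: mpoly_ring_simps)
  show mult: "g * f \<in> I" if "f \<in> I" "mvars g \<subseteq> V" for f g
    using I_l_closed[OF that(1), of g] that(2) by (simp add: mpoly_ring_simps)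
  show "f - g \<in> I" if "f \<in> I" "g \<in> I" for f g
    using additive_subgroup.a_closed[OF additive_subgroup_axioms that(1) mult[OF that(2), of "- 1"]]
    by (simp add: mpoly_ring_simps)
qed

lemma keys_lterm: "f \<noteq> 0 \<Longrightarrow> keys (lterm new_less f) = {lpp new_less f}"
  using lpp_in_keys[of f] by (simp add: lterm_def lcoef_def in_keys_iff)

text \<open>The polynomials all of whose monomials are divisible by a leading power product of
  \<open>G\<close> form an ideal; it contains the leading terms of \<open>G\<close>, hence that of
  \<open>f\<close>.\<close>

lemma groebner_basis_lpp_divides:
  fixes G :: "(nat \<times> nat, 'k::field) mpoly set"
  assumes gb: "groebner_basis new_less V I G" and I: "ideal I (mpoly_ring V)"
    and f: "f \<in> I" "f \<noteq> 0"
  shows "\<exists>g\<in>G. \<forall>v. lookup (lpp new_less g) v \<le> lookup (lpp new_less f) v"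
proof -
  define M where "M = {f :: (nat \<times> nat, 'k) mpoly. mvars f \<subseteq> V \<and>
    (\<forall>m\<in>keys f. \<exists>g\<in>G. \<forall>v. lookup (lpp new_less g) v \<le> lookup m v)}"
  have G: "G \<subseteq> I - {0}" using gb unfolding groebner_basis_def by blast
  have lterm_vars: "mvars (lterm new_less f) \<subseteq> V" if "f \<in> I - {0}" for f
  proof -
    have "keys (lpp new_less f) \<subseteq> mvars f"
      using lpp_in_keys[of f] that unfolding mvars_def by blast
    then show ?thesis
      using mpoly_ideal_closed(1)[OF I] that unfolding mvars_def[of "lterm _ _"]
      by (fastforce simp: keys_lterm)
  qed
  have "ideal M (mpoly_ring V)"
  proof (rule mpoly_idealI)
    show "f + g \<in> M" if "f \<in> M" "g \<in> M" for f g
      using that mvars_add[of f g] keys_add[of f g] unfolding M_def by blast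
    show "- f \<in> M" if "f \<in> M" for f
      using that unfolding M_def by simp
    show "g * f \<in> M" if f: "f \<in> M" and g: "mvars g \<subseteq> V" for f g
    proof -
      have "\<exists>h\<in>G. \<forall>v. lookup (lpp new_less h) v \<le> lookup m v" if mgf: "m \<in> keys (g * f)" for m
      proof -
        obtain m1 m2 where m: "m1 \<in> keys g" "m2 \<in> keys f" "m = m1 + m2"
          using mgf keys_mult[of g f] by blast
        then obtain h where "h \<in> G" "\<And>v. lookup (lpp new_less h) v \<le> lookup m2 v"
          using f unfolding M_def by blast
        then show ?thesis using m by (auto simp: lookup_add intro: trans_le_add2)
      qed
      moreover have "mvars (g * f) \<subseteq> V"
        using mvars_mult[of g f] f g unfolding M_def by blast
      ultimately show ?thesis unfolding M_def by simp
    qed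
  qed (auto simp: M_def)
  moreover have "lterm new_less ` G \<subseteq> M"
  proof
    fix t assume "t \<in> lterm new_less ` G"
    then obtain g where g: "g \<in> G" "t = lterm new_less g" by blast
    then have "keys t = {lpp new_less g}" "mvars t \<subseteq> V"
      using G keys_lterm[of g] lterm_vars[of g] by auto
    then show "t \<in> M" unfolding M_def using g(1) by auto
  qed
  ultimately have "genideal (mpoly_ring V) (lterm new_less ` G) \<subseteq> M"
    by (rule ring.genideal_minimal[OF ring_mpoly_ring])
  moreover have "lterm new_less f \<in> genideal (mpoly_ring V) (lterm new_less ` (I - {0}))"
    using f lterm_vars
    by (intro subsetD[OF ring.genideal_self[OF ring_mpoly_ring]]) (auto simp: mpoly_ring_simps)
  ultimately have "lterm new_less f \<in> M"
    using gb unfolding groebner_basis_def by auto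
  then show ?thesis unfolding M_def using keys_lterm[OF f(2)] by simp
qed

lemma reduced_groebner_basis_not_divides:
  assumes "reduced_groebner_basis new_less V I G"
    and "g \<in> G" "h \<in> G" "h \<noteq> g" "m \<in> keys g"
  shows "\<not> (\<forall>v. lookup (lpp new_less h) v \<le> lookup m v)"
proof
  assume le: "\<forall>v. lookup (lpp new_less h) v \<le> lookup m v"
  have "h \<noteq> 0"
    using assms unfolding reduced_groebner_basis_def groebner_basis_def by blast
  then have c: "lcoef new_less h \<noteq> 0"
    using lpp_in_keys[of h] by (simp add: lcoef_def in_keys_iff)
  have "m = lpp new_less h + (m - lpp new_less h)"
  proof (rule poly_mapping_eqI)
    show "lookup m v = lookup (lpp new_less h + (m - lpp new_less h)) v" for v
      using spec[OF le, of v] by (simp add: lookup_add lookup_minus)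
  qed
  then have "single m (lookup g m) =
      lterm new_less h * single (m - lpp new_less h) (lookup g m / lcoef new_less h)"
    using c by (simp add: lterm_def mult_single)
  then have "lterm new_less h dvd single m (lookup g m)" by (rule dvdI)
  moreover have "single m (lookup g m) \<in> mterms g"
    using assms(5) unfolding mterms_def by blast
  ultimately show False
    using assms unfolding reduced_groebner_basis_def by blast
qed

section \<open>Schubert determinantal ideals\<close>

text \<open>Rational functions in one variable provide infinitely many points even if the
  coefficient field is finite.\<close>

lemma rational_functions_infinite_extension:
  defines "h \<equiv> (\<lambda>c :: 'k::field. Fract [:c:] 1)"
  shows "comm_ring_hom h" "infinite (UNIV :: 'k poly fract set)"
proof -
  show "comm_ring_hom h"
    by unfold_locales (simp_all add: h_def One_fract_def Zero_fract_def eq_fract one_pCons)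
  have "inj (\<lambda>i. Fract (monom (1 :: 'k) i) 1)"
    by (rule injI) (simp add: eq_fract monom_eq_iff')
  then have "infinite (range (\<lambda>i. Fract (monom (1 :: 'k) i) 1))" by (rule range_inj_infinite)
  then show "infinite (UNIV :: 'k poly fract set)" by (rule infinite_super[OF subset_UNIV])
qed

lemma schubert_generators:
  assumes perm: "w permutes {1..n}"
    and f: "f \<in> (\<Union>p\<in>{1..n}. \<Union>q\<in>{1..n}.
      minors (northwest (generic_matrix n) p q) (nw_rank n w p q + 1))"
  shows "\<exists>p\<in>{1..n}. \<exists>q\<in>{1..n}. \<exists>\<rho> \<kappa>. f = generic_minor (dot_count w p q + 1) \<rho> \<kappa> \<and>
    (\<forall>i < dot_count w p q + 1. \<rho> i \<in> {1..p} \<and> \<kappa> i \<in> {1..q})"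
proof -
  obtain p q where pq: "p \<in> {1..n}" "q \<in> {1..n}"
    and f': "f \<in> minors (northwest (generic_matrix n) p q) (dot_count w p q + 1)"
    using f nw_rank_eq_dot_count[OF _ _ perm] by auto
  have "p \<le> n" "q \<le> n" using pq by simp_all
  then obtain \<rho> \<kappa> where "f = generic_minor (dot_count w p q + 1) \<rho> \<kappa>"
    "\<And>i. i < dot_count w p q + 1 \<Longrightarrow> \<rho> i \<in> {1..p}" "\<And>i. i < dot_count w p q + 1 \<Longrightarrow> \<kappa> i \<in> {1..q}"
    by (rule minors_northwest_genericE[OF _ _ f']) blast
  then show ?thesis using pq by blast
qed

lemma schubert_generators_in_ring:
  assumes "w permutes {1..n}"
  shows "(\<Union>p\<in>{1..n}. \<Union>q\<in>{1..n}.
      minors (northwest (generic_matrix n) p q) (nw_rank n w p q + 1)) \<subseteq> carrier (mpoly_ring (Xvars n))"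
proof
  fix f :: "(nat \<times> nat, 'a) mpoly"
  assume "f \<in> (\<Union>p\<in>{1..n}. \<Union>q\<in>{1..n}.
      minors (northwest (generic_matrix n) p q) (nw_rank n w p q + 1))"
  from schubert_generators[OF assms this] obtain p q \<rho> \<kappa> where "p \<in> {1..n}" "q \<in> {1..n}"
    and f: "f = generic_minor (dot_count w p q + 1) \<rho> \<kappa>"
    and \<rho>: "\<And>i. i < dot_count w p q + 1 \<Longrightarrow> \<rho> i \<in> {1..p}"
    and \<kappa>: "\<And>i. i < dot_count w p q + 1 \<Longrightarrow> \<kappa> i \<in> {1..q}"
    by blast
  have "\<rho> ` {..<dot_count w p q + 1} \<subseteq> {1..n}" "\<kappa> ` {..<dot_count w p q + 1} \<subseteq> {1..n}"
    using \<rho> \<kappa> \<open>p \<in> _\<close> \<open>q \<in> _\<close> by fastforce+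
  then show "f \<in> carrier (mpoly_ring (Xvars n))"
    unfolding f mpoly_ring_simps Xvars_def
    using mvars_generic_minor[of "dot_count w p q + 1" \<rho> \<kappa>] by blast
qed

lemma ideal_schubert_ideal:
  "w permutes {1..n} \<Longrightarrow> ideal (schubert_ideal n w) (mpoly_ring (Xvars n))"
  unfolding schubert_ideal_def
  by (intro ring.genideal_ideal[OF ring_mpoly_ring] schubert_generators_in_ring)

lemma schubert_ideal_vanishes:
  fixes h :: "'k::field \<Rightarrow> 'f::field"
  assumes perm: "w permutes {1..n}" and h: "comm_ring_hom h"
    and z: "z \<in> rank_variety 1 n {(p, q, dot_count w p q) | p q. p \<in> {1..n} \<and> q \<in> {1..n}} {}"
    and f: "f \<in> schubert_ideal n w"
  shows "mpoly_eval h z f = 0"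
proof -
  interpret ev: comm_ring_hom "mpoly_eval h z" by (rule comm_ring_hom_mpoly_eval[OF h])
  let ?I = "{f. mvars f \<subseteq> Xvars n \<and> mpoly_eval h z f = 0}"
  have "ideal ?I (mpoly_ring (Xvars n))"
  proof (rule mpoly_idealI)
    show "f + g \<in> ?I" if "f \<in> ?I" "g \<in> ?I" for f g
      using that mvars_add[of f g] by (auto simp: ev.hom_add)
    show "g * f \<in> ?I" if "f \<in> ?I" "mvars g \<subseteq> Xvars n" for f g
      using that mvars_mult[of g f] by (auto simp: ev.hom_mult)
  qed (simp_all add: mpoly_eval_uminus[OF h])
  moreover have "(\<Union>p\<in>{1..n}. \<Union>q\<in>{1..n}.
      minors (northwest (generic_matrix n) p q) (nw_rank n w p q + 1)) \<subseteq> ?I"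
  proof
    fix f :: "(nat \<times> nat, 'k) mpoly"
    assume f: "f \<in> (\<Union>p\<in>{1..n}. \<Union>q\<in>{1..n}.
      minors (northwest (generic_matrix n) p q) (nw_rank n w p q + 1))"
    from schubert_generators[OF perm this] obtain p q \<rho> \<kappa> where pq: "p \<in> {1..n}" "q \<in> {1..n}"
      and f': "f = generic_minor (dot_count w p q + 1) \<rho> \<kappa>"
      and \<rho>: "\<And>i. i < dot_count w p q + 1 \<Longrightarrow> \<rho> i \<in> {1..p}"
      and \<kappa>: "\<And>i. i < dot_count w p q + 1 \<Longrightarrow> \<kappa> i \<in> {1..q}"
      by blast
    have "rank_le {1..p} {1..min q n} (dot_count w p q) z"
      using z pq unfolding rank_variety_def by blast
    then have "rank_le {1..p} {1..q} (dot_count w p q) z" using pq by (simp add: min_def)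
    then have "mpoly_eval h z f = 0"
      unfolding f' by (rule generic_minor_vanishes[OF h]) (use \<rho> \<kappa> in auto)
    moreover have "mvars f \<subseteq> Xvars n"
      using subsetD[OF schubert_generators_in_ring[OF perm] f] by (simp add: mpoly_ring_simps)
    ultimately show "f \<in> ?I" by simp
  qed
  ultimately have "schubert_ideal n w \<subseteq> ?I"
    unfolding schubert_ideal_def by (rule ring.genideal_minimal[OF ring_mpoly_ring])
  then show ?thesis using f by blast
qed

text \<open>The elimination theorem at its initial stage \<open>(1, n)\<close>, where all variables
  are present and both rectangles lie in the full northwest block.\<close>

lemma lpp_schubert_ideal_bad:
  fixes f :: "(nat \<times> nat, 'k::field) mpoly"
  assumes perm: "w permutes {1..n}" and f: "f \<in> schubert_ideal n w" "f \<noteq> 0"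
  shows "\<exists>S \<subseteq> keys (lpp new_less f). minimal_bad n w S"
proof -
  let ?h = "\<lambda>c :: 'k. Fract [:c:] 1"
  let ?C = "{(p, q, dot_count w p q) | p q. p \<in> {1..n} \<and> q \<in> {1..n}}"
  have "\<exists>S \<subseteq> keys (lpp new_less f). violating 1 n ?C {} S"
  proof (rule leading_monomial_contains_violating[OF rational_functions_infinite_extension])
    show "keys m \<subseteq> region n 1 n" if "m \<in> keys f" for m
    proof -
      have "keys m \<subseteq> Xvars n"
        using mpoly_ideal_closed(1)[OF ideal_schubert_ideal[OF perm] f(1)] that
        unfolding mvars_def by blast
      then show ?thesis by (auto simp: Xvars_def region_def)
    qed
    show "lpp new_less f \<in> keys f" by (rule lpp_in_keys[OF f(2)])
    show "lex_less new_less m (lpp new_less f)" if "m \<in> keys f" "m \<noteq> lpp new_less f" for m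
      using lpp_greatest[OF f(2) that] .
    show "mpoly_eval ?h z f = 0" if "z \<in> rank_variety 1 n ?C {}" for z
      by (rule schubert_ideal_vanishes[OF perm rational_functions_infinite_extension(1) that f(1)])
  qed auto
  then obtain S where S: "S \<subseteq> keys (lpp new_less f)" "violating 1 n ?C {} S" by blast
  then obtain p q where pq: "p \<in> {1..n}" "q \<in> {1..n}" "card S = Suc (dot_count w p q)"
    "S \<subseteq> {1<..p} \<times> {1..q} \<or> S \<subseteq> {1..p} \<times> {1..min q n}" "antidiagonal S"
    unfolding violating_def by auto
  have "S \<subseteq> {1..p} \<times> {1..q}"
    using pq(4) by (elim disjE order_trans) auto
  then have "bad n w S"
    unfolding bad_def using pq by (intro conjI bexI[of _ p] bexI[of _ q]) simp_all
  then obtain T where "T \<subseteq> S" "minimal_bad n w T"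
    by (auto dest!: bad_contains_minimal_bad)
  then show ?thesis using S(1) by (intro exI[of _ T]) simp
qed

text \<open>By \<open>card_S\<close> the minor on the rows and columns of \<open>S\<close> has
  exactly the size prescribed for the bounding block, so it is a generator; its other terms are
  transversals and therefore smaller.\<close>

lemma minimal_bad_minor:
  assumes perm: "w permutes {1..n}" and vex: "vexillary n w" and S: "minimal_bad n w S"
  shows "\<exists>D \<in> schubert_ideal n w. D \<noteq> (0 :: (nat \<times> nat, 'k::field) mpoly) \<and>
    lpp new_less D = squarefree_pprod S \<and>
    keys D \<subseteq> squarefree_pprod ` Collect (transversal S)"
proof -
  obtain a b where y: "top_of S (a, b)"
    using bad_exists_top S unfolding minimal_bad_def by (metis surj_pair)
  define p where "p = Max (fst ` S)"
  interpret minimal_bad_antidiagonal n w S a b p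
    by unfold_locales (use perm vex S y p_def in simp_all)
  obtain D :: "(nat \<times> nat, 'k) mpoly" where
    D: "D \<in> minors (northwest (generic_matrix n) p b) (card S)"
      "lookup D (squarefree_pprod S) = 1 \<or> lookup D (squarefree_pprod S) = - 1"
    and DT: "keys D \<subseteq> squarefree_pprod ` Collect (transversal S)"
    using minor_of_antidiagonal[OF antidiagonal_S bounds(3), of n] bounds(1,2) by auto
  have "D \<in> minors (northwest (generic_matrix n) p b) (nw_rank n w p b + 1)"
    using D(1) card_S nw_rank_eq_dot_count[OF _ _ perm] bounds(1,2) by simp
  then have "D \<in> schubert_ideal n w"
    unfolding schubert_ideal_def
    using bounds(1,2)
    by (intro subsetD[OF ring.genideal_self[OF ring_mpoly_ring schubert_generators_in_ring[OF perm]]]) blast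
  moreover have Sk: "squarefree_pprod S \<in> keys D" using D(2) by (auto simp: in_keys_iff)
  moreover have "lpp new_less D = squarefree_pprod S"
  proof (rule lpp_eqI[OF Sk])
    fix m assume m: "m \<in> keys D" "m \<noteq> squarefree_pprod S"
    obtain T where T: "m = squarefree_pprod T" "transversal S T"
      using subsetD[OF DT m(1)] by blast
    then have "T \<noteq> S" using m(2) by blast
    then have "set_less T S"
      by (intro set_less_antidiagonal[OF antidiagonal_S T(2)]) simp_all
    then show "lex_less new_less m (squarefree_pprod S)"
      unfolding T(1) using T(2) by (intro set_less_imp_lex_less) (simp_all add: transversal_def)
  qed
  ultimately show ?thesis using DT by (intro bexI[of _ D]) auto
qed

lemma squarefree_le_iff:
  "finite S \<Longrightarrow> (\<forall>v. lookup (squarefree_pprod S) v \<le> lookup m v) \<longleftrightarrow> S \<subseteq> keys m"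
  by (auto simp: lookup_squarefree in_keys_iff Suc_le_eq)

lemma minimal_bad_finite: "minimal_bad n w S \<Longrightarrow> finite S"
  unfolding minimal_bad_def using bad_finite by blast

section \<open>Reduced bases, W-characteristic sets and their initials\<close>

text \<open>A minimal bad \<open>S\<close> divides the leading power product of \<open>g\<close>,
  and some \<open>h\<close> in \<open>G\<close> divides the one of the minor of \<open>S\<close>.
  Reducedness forces \<open>h = g\<close>, and the chain of divisibilities collapses.\<close>

lemma reduced_groebner_basis_schubert_lpp:
  fixes G :: "(nat \<times> nat, 'k::field) mpoly set"
  assumes perm: "w permutes {1..n}" and vex: "vexillary n w"
    and G: "reduced_groebner_basis new_less (Xvars n) (schubert_ideal n w) G"
    and g: "g \<in> G"
  shows "g \<in> schubert_ideal n w" "g \<noteq> 0"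
    and "\<exists>S. minimal_bad n w S \<and> lpp new_less g = squarefree_pprod S"
proof -
  have gb: "groebner_basis new_less (Xvars n) (schubert_ideal n w) G"
    using G unfolding reduced_groebner_basis_def by blast
  then show gI: "g \<in> schubert_ideal n w" and g0: "g \<noteq> 0"
    using g unfolding groebner_basis_def by auto
  obtain S where S: "S \<subseteq> keys (lpp new_less g)" "minimal_bad n w S"
    using lpp_schubert_ideal_bad[OF perm gI g0] by blast
  have fin: "finite S" using S(2) by (rule minimal_bad_finite)
  obtain D :: "(nat \<times> nat, 'k) mpoly" where
    D: "D \<in> schubert_ideal n w" "D \<noteq> 0" "lpp new_less D = squarefree_pprod S"
    using minimal_bad_minor[OF perm vex S(2)] by blast
  obtain h where h: "h \<in> G" "\<And>v. lookup (lpp new_less h) v \<le> lookup (squarefree_pprod S) v"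
    using groebner_basis_lpp_divides[OF gb ideal_schubert_ideal[OF perm] D(1,2)] D(3) by auto
  have S_le: "lookup (squarefree_pprod S) v \<le> lookup (lpp new_less g) v" for v
    using squarefree_le_iff[OF fin] S(1) by blast
  have "h = g"
    using reduced_groebner_basis_not_divides[OF G g h(1) _ lpp_in_keys[OF g0]] h(2) S_le
    by (meson le_trans)
  then have "lpp new_less g = squarefree_pprod S"
    using h(2) S_le by (intro poly_mapping_eqI) (simp add: le_antisym)
  then show "\<exists>S. minimal_bad n w S \<and> lpp new_less g = squarefree_pprod S"
    using S(2) by blast
qed

lemma minimal_bad_is_lpp:
  fixes G :: "(nat \<times> nat, 'k::field) mpoly set"
  assumes perm: "w permutes {1..n}" and vex: "vexillary n w"
    and G: "reduced_groebner_basis new_less (Xvars n) (schubert_ideal n w) G"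
    and S: "minimal_bad n w S"
  shows "\<exists>g\<in>G. lpp new_less g = squarefree_pprod S"
proof -
  have gb: "groebner_basis new_less (Xvars n) (schubert_ideal n w) G"
    using G unfolding reduced_groebner_basis_def by blast
  obtain D :: "(nat \<times> nat, 'k) mpoly" where
    D: "D \<in> schubert_ideal n w" "D \<noteq> 0" "lpp new_less D = squarefree_pprod S"
    using minimal_bad_minor[OF perm vex S] by blast
  obtain h where h: "h \<in> G" "\<And>v. lookup (lpp new_less h) v \<le> lookup (squarefree_pprod S) v"
    using groebner_basis_lpp_divides[OF gb ideal_schubert_ideal[OF perm] D(1,2)] D(3) by auto
  obtain S' where S': "minimal_bad n w S'" "lpp new_less h = squarefree_pprod S'"
    using reduced_groebner_basis_schubert_lpp[OF perm vex G h(1)] by blast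
  have "S' \<subseteq> S"
    using h(2) squarefree_le_iff[OF minimal_bad_finite[OF S'(1)], of "squarefree_pprod S"]
      minimal_bad_finite[OF S] S'(2) by simp
  then have "S' = S" using S S'(1) unfolding minimal_bad_def by blast
  then show ?thesis using h(1) S'(2) by blast
qed

lemma W_characteristic_set_lex_min:
  fixes G :: "(nat \<times> nat, 'k::field) mpoly set"
  assumes perm: "w permutes {1..n}" and vex: "vexillary n w"
    and G: "reduced_groebner_basis new_less (Xvars n) (schubert_ideal n w) G"
    and g: "g \<in> with_lv new_less G y"
    and least: "\<And>h. h \<in> with_lv new_less G y \<Longrightarrow> h \<noteq> g \<Longrightarrow>
      lex_less new_less (lpp new_less g) (lpp new_less h)"
  obtains S a b where "y = (a, b)" "lpp new_less g = squarefree_pprod S"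
    "lex_min_bad_antidiagonal n w S a b (Max (fst ` S))"
proof -
  have gG: "g \<in> G" and gy: "lv new_less g = y" using g unfolding with_lv_def by auto
  note gI = reduced_groebner_basis_schubert_lpp[OF perm vex G gG]
  obtain S where S: "minimal_bad n w S" "lpp new_less g = squarefree_pprod S"
    using gI(3) by blast
  have finS: "finite S" using S(1) by (rule minimal_bad_finite)
  have "bad n w S" using S(1) by (simp add: minimal_bad_def)
  then obtain y' where "top_of S y'" by (auto dest!: bad_exists_top)
  then have top: "top_of S y" using lv_eq_top(1)[OF finS _ gI(2) S(2)] gy by simp
  obtain a b where ab: "y = (a, b)" by (cases y)
  have "lex_min_bad_antidiagonal n w S a b (Max (fst ` S))"
  proof unfold_locales
    fix T assume T: "minimal_bad n w T" "top_of T (a, b)" "T \<noteq> S"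
    have finT: "finite T" using T(1) by (rule minimal_bad_finite)
    obtain h where h: "h \<in> G" "lpp new_less h = squarefree_pprod T"
      using minimal_bad_is_lpp[OF perm vex G T(1)] by blast
    have h0: "h \<noteq> 0" by (rule reduced_groebner_basis_schubert_lpp(2)[OF perm vex G h(1)])
    have "h \<in> with_lv new_less G y"
      using lv_eq_top[OF finT T(2) h0 h(2)] h(1) ab unfolding with_lv_def by simp
    moreover have "keys (squarefree_pprod T) \<noteq> keys (squarefree_pprod S)"
      using T(3) finS finT by simp
    then have "h \<noteq> g" using h(2) S(2) by metis
    ultimately have "lex_less new_less (squarefree_pprod S) (squarefree_pprod T)"
      using least S(2) h(2) by metis
    then show "set_less S T" using finS finT by (rule lex_less_imp_set_less)
  qed (use perm vex S top ab in simp_all)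
  then show thesis using that ab S(2) by blast
qed

text \<open>Subtracting a multiple of the minor of \<open>S\<close> from \<open>g\<close> leaves a polynomial without \<open>y\<close>: otherwise
  its leading power product would be reducible.\<close>

lemma key_with_top_is_transversal:
  fixes G :: "(nat \<times> nat, 'k::field) mpoly set"
  assumes perm: "w permutes {1..n}" and vex: "vexillary n w"
    and G: "reduced_groebner_basis new_less (Xvars n) (schubert_ideal n w) G"
    and g: "g \<in> G" "lpp new_less g = squarefree_pprod S"
    and S: "minimal_bad n w S" "top_of S y"
    and m: "m \<in> keys g" "y \<in> keys m"
  shows "m \<in> squarefree_pprod ` Collect (transversal S)"
proof -
  have gb: "groebner_basis new_less (Xvars n) (schubert_ideal n w) G"
    using G unfolding reduced_groebner_basis_def by blast
  note I = mpoly_ideal_closed[OF ideal_schubert_ideal[OF perm]]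
  note gI = reduced_groebner_basis_schubert_lpp[OF perm vex G g(1)]
  obtain a b where ab: "y = (a, b)" by (cases y)
  interpret minimal_bad_antidiagonal n w S a b "Max (fst ` S)"
    by unfold_locales (use perm vex S ab in simp_all)
  obtain D :: "(nat \<times> nat, 'k) mpoly" where
    D: "D \<in> schubert_ideal n w" "D \<noteq> 0" "lpp new_less D = squarefree_pprod S"
    and DT: "keys D \<subseteq> squarefree_pprod ` Collect (transversal S)"
    using minimal_bad_minor[OF perm vex S(1)] by blast
  \<comment> \<open>Cancels the leading monomial of \<open>S\<close> in the difference
    \<open>f\<close>.\<close>
  define c where "c = lookup g (squarefree_pprod S) / lookup D (squarefree_pprod S)"
  define f where "f = g - single 0 c * D"
  have lookup_f: "lookup f k = lookup g k - c * lookup D k" for k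
  proof -
    have "single 0 c * D = Poly_Mapping.map ((*) c) D" by (rule mult_map_scale_conv_mult[symmetric])
    then show ?thesis by (simp add: f_def lookup_minus map.rep_eq when_def in_keys_iff)
  qed
  have "mvars (single 0 c :: (nat \<times> nat, 'k) mpoly) \<subseteq> Xvars n"
    using mvars_single[of 0 c] by auto
  then have fI: "f \<in> schubert_ideal n w"
    unfolding f_def by (intro I(2) gI(1) I(3) D(1))
  have "m \<in> keys D"
  proof (rule ccontr)
    assume "m \<notin> keys D"
    then have mf: "m \<in> keys f" using m(1) by (simp add: in_keys_iff lookup_f)
    then have f0: "f \<noteq> 0" by auto
    define l where "l = lpp new_less f"
    have l: "l \<in> keys f" unfolding l_def by (rule lpp_in_keys[OF f0])
    then have l_cases: "l \<in> keys g \<or> l \<in> keys D" by (auto simp: in_keys_iff lookup_f)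
    have "lookup D (squarefree_pprod S) \<noteq> 0"
      using lpp_in_keys[OF D(2)] D(3) by (simp add: in_keys_iff)
    then have "lookup f (squarefree_pprod S) = 0" by (simp add: lookup_f c_def)
    then have lS: "l \<noteq> squarefree_pprod S" using l by (auto simp: in_keys_iff)
    have l_above: "lookup l u = 0" if "new_less y u" for u
      using l_cases lookup_above_top[OF finite_S S(2) gI(2) g(2) _ that]
        lookup_above_top[OF finite_S S(2) D(2,3) _ that] by blast
    \<comment> \<open>The leading monomial \<open>l\<close> is at least \<open>m\<close>, which
      contains \<open>y\<close>, and neither polynomial has a variable beyond \<open>y\<close>; so
      \<open>l\<close> contains \<open>y\<close> too.\<close>
    have yl: "y \<in> keys l"
    proof (cases "m = l")
      case False
      then obtain v where v: "lookup m v < lookup l v"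
          "\<And>u. new_less v u \<Longrightarrow> lookup m u = lookup l u"
        using lpp_greatest[OF f0 mf] unfolding l_def lex_less_def by blast
      have "\<not> new_less y v" using l_above[of v] v(1) by auto
      then consider "v = y" | "new_less v y" using new_less_total by blast
      then show ?thesis using v m(2) by cases (auto simp: in_keys_iff)
    qed (use m in simp)
    obtain h where h: "h \<in> G" "\<forall>v. lookup (lpp new_less h) v \<le> lookup l v"
      using groebner_basis_lpp_divides[OF gb ideal_schubert_ideal[OF perm] fI f0]
      unfolding l_def by blast
    show False
    \<comment> \<open>A term of \<open>g\<close> divisible by the leading monomial of
      \<open>h\<close> forces \<open>h = g\<close>, but then \<open>l\<close> would not be below the
      leading monomial of \<open>g\<close>. A term of the minor containing \<open>y\<close> is
      excluded by \<open>transversal_bad\<close>.\<close>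
    proof (cases "l \<in> keys g")
      case True
      then have "h = g" using reduced_groebner_basis_not_divides[OF G g(1) h(1)] h(2) by blast
      then have "lookup (squarefree_pprod S) v \<le> lookup l v" for v
        using spec[OF h(2), of v] g(2) by simp
      then have "\<not> lex_less new_less l (squarefree_pprod S)"
        by (rule not_lex_less_of_le)
      then show False using lpp_greatest[OF gI(2) True] lS g(2) by simp
    next
      case False
      then have "l \<in> keys D" using l_cases by simp
      then obtain T where T: "l = squarefree_pprod T" "transversal S T"
        using DT by blast
      then have finT: "finite T" by (simp add: transversal_def)
      obtain B where B: "minimal_bad n w B" "lpp new_less h = squarefree_pprod B"
        using reduced_groebner_basis_schubert_lpp[OF perm vex G h(1)] by blast
      have "B \<subseteq> T"
        using h(2) squarefree_le_iff[OF minimal_bad_finite[OF B(1)], of l] B(2) T(1) finT by simp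
      moreover have "(a, b) \<in> T" using yl T(1) finT ab by simp
      moreover have "bad n w B" using B(1) unfolding minimal_bad_def by blast
      ultimately have "T = S" using transversal_bad[OF T(2)] by blast
      then show False using lS T(1) by simp
    qed
  qed
  then show ?thesis using DT by blast
qed

text \<open>Every term contributing to the initial contains \<open>y\<close>, so its support is a
  transversal of \<open>S\<close>; there \<open>y\<close> already occupies row \<open>a\<close> and
  column \<open>b\<close>, which leaves only the grid of the remaining rows and columns.\<close>

lemma mvars_ini_subset_grid:
  fixes G :: "(nat \<times> nat, 'k::field) mpoly set"
  assumes perm: "w permutes {1..n}" and vex: "vexillary n w"
    and G: "reduced_groebner_basis new_less (Xvars n) (schubert_ideal n w) G"
    and g: "g \<in> G" "lpp new_less g = squarefree_pprod S"
    and S: "minimal_bad n w S" "top_of S (a, b)" and lv: "lv new_less g = (a, b)"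
  shows "mvars (ini new_less g) \<subseteq> fst ` (S - {(a, b)}) \<times> snd ` (S - {(a, b)})"
proof
  interpret minimal_bad_antidiagonal n w S a b "Max (fst ` S)"
    by unfold_locales (use perm vex S in simp_all)
  fix u assume u: "u \<in> mvars (ini new_less g)"
  define d where "d = degree_in (a, b) g"
  have "squarefree_pprod S \<in> keys g"
    using lpp_in_keys[OF reduced_groebner_basis_schubert_lpp(2)[OF perm vex G g(1)]] g(2) by simp
  then have "lookup (squarefree_pprod S) (a, b) \<le> d"
    unfolding d_def degree_in_def by (intro Max_ge) simp_all
  \<comment> \<open>Positive degree ensures that the terms forming the initial really contain
    \<open>y\<close>.\<close>
  then have d: "1 \<le> d" using top_in by (simp add: lookup_squarefree)
  obtain m where m: "m \<in> keys (coeff_in (a, b) d g)" "u \<in> keys m"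
    using u unfolding mvars_def ini_def Let_def lv d_def by blast
  then have m0: "lookup m (a, b) = 0" and mg: "m + single (a, b) d \<in> keys g"
    by (simp_all add: keys_coeff_in)
  have "(a, b) \<in> keys (m + single (a, b) d)"
    using d by (simp add: in_keys_iff lookup_add)
  then obtain T where T: "m + single (a, b) d = squarefree_pprod T" "transversal S T"
    using key_with_top_is_transversal[OF perm vex G g S mg] by blast
  have T': "finite T" "inj_on fst T" "inj_on snd T" "fst ` T = fst ` S" "snd ` T = snd ` S"
    using T(2) by (simp_all add: transversal_def)
  have keysT: "keys (m + single (a, b) d) = T" using T(1) T'(1) by simp
  have yT: "(a, b) \<in> T" using \<open>(a, b) \<in> keys (m + _)\<close> keysT by simp
  have "u \<in> keys (m + single (a, b) d)" using m(2) by (simp add: in_keys_iff lookup_add)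
  then have uT: "u \<in> T" using keysT by simp
  have "u \<noteq> (a, b)" using m(2) m0 by (auto simp: in_keys_iff)
  then have "fst u \<noteq> a" "snd u \<noteq> b"
    using inj_onD[OF T'(2) _ uT yT] inj_onD[OF T'(3) _ uT yT] by auto
  moreover have "fst u \<in> fst ` S" "snd u \<in> snd ` S"
    using imageI[OF uT, of fst] imageI[OF uT, of snd] T'(4,5) by simp_all
  ultimately have "fst u \<in> fst ` S'" "snd u \<in> snd ` S'"
    unfolding rows_S' cols_S' by simp_all
  then show "u \<in> fst ` S' \<times> snd ` S'" by (simp add: mem_Times_iff)
qed

theorem theorem6p2:
  fixes n :: nat and w :: "nat \<Rightarrow> nat"
    and Cs :: "(nat \<times> nat, 'k::field) mpoly list"
  assumes "w permutes {1..n}"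
    and "vexillary n w"
    and "W_characteristic_set new_less (Xvars n) (schubert_ideal n w) Cs"
  shows "normal_triangular_set new_less Cs"
proof -
  note perm = assms(1) and vex = assms(2)
  obtain G where G: "reduced_groebner_basis new_less (Xvars n) (schubert_ideal n w) G"
    and tri: "triangular_set new_less Cs"
    and Cs: "set Cs = {g. \<exists>y. g \<in> with_lv new_less G y \<and>
      (\<forall>h\<in>with_lv new_less G y. h \<noteq> g \<longrightarrow> lex_less new_less (lpp new_less g) (lpp new_less h))}"
    using assms(3) unfolding W_characteristic_set_def by blast
  have elem: "\<exists>S a b. T \<in> G \<and> lv new_less T = (a, b) \<and> lpp new_less T = squarefree_pprod S \<and>
      lex_min_bad_antidiagonal n w S a b (Max (fst ` S))" if "T \<in> set Cs" for T
  proof -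
    obtain y where y: "T \<in> with_lv new_less G y"
      "\<And>h. h \<in> with_lv new_less G y \<Longrightarrow> h \<noteq> T \<Longrightarrow> lex_less new_less (lpp new_less T) (lpp new_less h)"
      using \<open>T \<in> set Cs\<close> unfolding Cs by blast
    then have "T \<in> G" "lv new_less T = y" unfolding with_lv_def by auto
    with W_characteristic_set_lex_min[OF perm vex G y] show ?thesis by metis
  qed
  have "mvars (ini new_less T) \<inter> lv new_less ` set Cs = {}" if T: "T \<in> set Cs" for T
  proof (rule ccontr)
    assume "\<not> ?thesis"
    then obtain T2 where u: "lv new_less T2 \<in> mvars (ini new_less T)" and T2: "T2 \<in> set Cs" by blast
    obtain S a b where S: "T \<in> G" "lv new_less T = (a, b)" "lpp new_less T = squarefree_pprod S"
      "lex_min_bad_antidiagonal n w S a b (Max (fst ` S))"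
      using elem[OF T] by blast
    obtain S2 c d where S2: "lv new_less T2 = (c, d)"
      "lex_min_bad_antidiagonal n w S2 c d (Max (fst ` S2))"
      using elem[OF T2] by blast
    interpret lex_min_bad_antidiagonal n w S a b "Max (fst ` S)" by (rule S(4))
    interpret S2: lex_min_bad_antidiagonal n w S2 c d "Max (fst ` S2)" by (rule S2(2))
    have "(c, d) \<in> fst ` S' \<times> snd ` S'"
      using mvars_ini_subset_grid[OF perm vex G S(1,3) min top S(2)] u S2(1) by auto
    then show False using grid_free_of_tops[OF _ _ S2.min S2.top] by blast
  qed
  then show ?thesis unfolding normal_triangular_set_def using tri by blast
qed

end
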